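(* Let $\gamma$ be a non-simple closed geodesic of the pair of pants $P=\mathbb D/\Gamma$, and let $w(\gamma)=s_1^{i_1}r_1^{j_1}\cdots s_n^{i_n}r_n^{j_n}$ be the cyclically reduced word (up to cyclic permutation) associated to $\gamma$, where $n,i_1,j_1,\dots,i_n,j_n$ are positive integers, $s_k\in\{a,\bar a\}$ and $r_k\in\{b,\bar b\}$ for all $1\le k\le n$. Let $L(\gamma)=\sum_{k=1}^n(i_k+j_k)$. Then $$L(\gamma)-n-1\le i(\gamma;\gamma)\le nL(\gamma)-n^2 .$$
   Context: Setting. $\mathbb D$ is the Poincaré disk with its hyperbolic metric, $a,b$ are hyperbolic isometries of $\mathbb D$, and $\bar e$ denotes the inverse of $e$. There are four pairwise disjoint closed half-disks $D(a),D(\bar a),D(b),D(\bar b)$ of $\mathbb D$, bounded by circles orthogonal to $\mathbb S^1=\partial\mathbb D$, with $a(D(\bar a))=\mathbb D\setminus \mathring D(a)$ and $b(D(\bar b))=\mathbb D\setminus\mathring D(b)$, and the corresponding arcs $A(e)$ of $\partial\mathbb D$ occur anticlockwise in the cyclic order $A(a),A(\bar b),A(b),A(\bar a)$. The group $\Gamma=\langle a,b\rangle$ is a (free) Schottky group, $P=\mathbb D/\Gamma$ is a pair of pants, and $\mathcal D=\bigcap_{e\in\{a,\bar a,b,\bar b\}}(\mathbb D\setminus\mathring D(e))$ is a fundamental domain. Coding. An infinite reduced word $f_1f_2\cdots$ in the letters $a,\bar a,b,\bar b$ denotes the limit point $\lim_m f_1\cdots f_m(o)\in\partial\mathbb D$.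 Oriented closed geodesics of $P$ (multiples allowed) correspond bijectively to nonempty cyclically reduced words $e_1\cdots e_L$ up to cyclic permutation; $L=L(\gamma)$ is the combinatorial length. The lifts of $\gamma$ meeting $\mathcal D$ are the geodesics $\gamma_i$ ($1\le i\le L$, indices mod $L$) with positive endpoint the periodic word $e_ie_{i+1}\cdots$ and negative endpoint the periodic word $\bar e_{i-1}\bar e_{i-2}\cdots$. Self-intersection number. If the word of $\gamma$ is not a proper power, $i(\gamma;\gamma)$ is the number of equivalence classes of intersecting unordered pairs $\{\gamma_i,\gamma_j\}$, $i\ne j$, where two pairs are equivalent if some element of $\Gamma$ maps one pair onto the other (equivalently, the number of pairs $i<j$ with $\gamma_i\cap\gamma_j\cap\mathcal D\neq\emptyset$, up to boundary identification). If $\gamma=\gamma_0^m$, then $i(\gamma;\gamma)=m^2\,i(\gamma_0;\gamma_0)$. A closed geodesic is non-simple if $i(\gamma;\gamma)>0$. *)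

theory Defs
  imports "HOL-Complex_Analysis.Complex_Analysis"
begin

section \<open>The Poincare disk\<close>

abbreviation disk :: "complex set" where
  "disk \<equiv> ball 0 1"

definition hyp_dist :: "complex \<Rightarrow> complex \<Rightarrow> real" where
  "hyp_dist z w =
     arcosh (1 + 2 * (cmod (z - w))\<^sup>2 / ((1 - (cmod z)\<^sup>2) * (1 - (cmod w)\<^sup>2)))"

text \<open>
  Orientation preservation is expressed by holomorphy. An isometry is hyperbolic (as opposed to
  elliptic or parabolic) when its displacement function attains a positive minimum.
  Maps of the disk are functions on all of \<open>\<complex>\<close> whose values off the disk are never used.
\<close>

definition hyperbolic_isometry :: "(complex \<Rightarrow> complex) \<Rightarrow> bool" where
  "hyperbolic_isometry f \<longleftrightarrow>
     f ` disk = disk \<and> f holomorphic_on disk \<and>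
     (\<forall>z\<in>disk. \<forall>w\<in>disk. hyp_dist (f z) (f w) = hyp_dist z w) \<and>
     (\<exists>z\<in>disk. 0 < hyp_dist z (f z) \<and> (\<forall>w\<in>disk. hyp_dist z (f z) \<le> hyp_dist w (f w)))"

definition geodesic_line :: "(real \<Rightarrow> complex) \<Rightarrow> bool" where
  "geodesic_line c \<longleftrightarrow> range c \<subseteq> disk \<and> (\<forall>s t. hyp_dist (c s) (c t) = \<bar>s - t\<bar>)"

text \<open>The point set of the geodesic with negative endpoint \<open>p\<close> and positive endpoint \<open>q\<close>.\<close>

definition geodesic :: "complex \<Rightarrow> complex \<Rightarrow> complex set" where
  "geodesic p q = {z. \<exists>c. geodesic_line c \<and> (c \<longlongrightarrow> p) at_bot \<and> (c \<longlongrightarrow> q) at_top \<and> z \<in> range c}"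

text \<open>
  The closed half-disk of \<open>\<D>\<close> (closed relative to \<open>\<D>\<close>) facing the closed arc of the unit circle
  from \<open>cis \<alpha>\<close> anticlockwise to \<open>cis \<beta>\<close>, where \<open>\<alpha> < \<beta> < \<alpha> + 2 * pi\<close>. Put \<open>h = (\<beta> - \<alpha>) / 2\<close> and
  \<open>m = (\<alpha> + \<beta>) / 2\<close>. If \<open>cos h > 0\<close>, the inequality reads \<open>\<bar>z - c\<bar>\<^sup>2 \<le> \<bar>c\<bar>\<^sup>2 - 1\<close> with
  \<open>c = cis m / cos h\<close>, the disk bounded by the circle orthogonal to the unit circle through the
  two endpoints; if \<open>cos h = 0\<close> the bounding circle degenerates to a diameter, and if
  \<open>cos h < 0\<close> the half-disk is the outside of the orthogonal circle.
\<close>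

definition half_disk :: "real \<Rightarrow> real \<Rightarrow> complex set" where
  "half_disk \<alpha> \<beta> =
     {z \<in> disk. cos ((\<beta> - \<alpha>) / 2) * (1 + (cmod z)\<^sup>2) \<le> 2 * (cis ((\<alpha> + \<beta>) / 2) \<bullet> z)}"


section \<open>The Schottky group of a pair of pants\<close>

datatype letter = A | Abar | B | Bbar

fun bar :: "letter \<Rightarrow> letter" where
  "bar A = Abar"
| "bar Abar = A"
| "bar B = Bbar"
| "bar Bbar = B"

text \<open>
  \<open>D(e) = half_disk (lo e) (hi e)\<close>, with arc at infinity \<open>A(e)\<close> from \<open>cis (lo e)\<close> to
  \<open>cis (hi e)\<close>. The chain of strict inequalities between the angles says that the four closed
  arcs (hence the four half-disks) are pairwise disjoint and occur anticlockwise in the cyclic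
  order \<open>A(a), A(\<bar>b), A(b), A(\<bar>a)\<close>.
\<close>

locale pants =
  fixes a b :: "complex \<Rightarrow> complex" and lo hi :: "letter \<Rightarrow> real"
  assumes a_hyperbolic: "hyperbolic_isometry a"
    and b_hyperbolic: "hyperbolic_isometry b"
    and arcs: "lo A < hi A" "hi A < lo Bbar" "lo Bbar < hi Bbar" "hi Bbar < lo B"
      "lo B < hi B" "hi B < lo Abar" "lo Abar < hi Abar" "hi Abar < lo A + 2 * pi"
    and a_pairing: "a ` half_disk (lo Abar) (hi Abar) = disk - interior (half_disk (lo A) (hi A))"
    and b_pairing: "b ` half_disk (lo Bbar) (hi Bbar) = disk - interior (half_disk (lo B) (hi B))"

fun letter_map :: "(complex \<Rightarrow> complex) \<Rightarrow> (complex \<Rightarrow> complex) \<Rightarrow> letter \<Rightarrow> complex \<Rightarrow> complex" where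
  "letter_map a b A = a"
| "letter_map a b Abar = inv_into disk a"
| "letter_map a b B = b"
| "letter_map a b Bbar = inv_into disk b"

definition word_map ::
  "(complex \<Rightarrow> complex) \<Rightarrow> (complex \<Rightarrow> complex) \<Rightarrow> letter list \<Rightarrow> complex \<Rightarrow> complex" where
  "word_map a b w = foldr (\<lambda>e g. letter_map a b e \<circ> g) w id"

definition Gam :: "(complex \<Rightarrow> complex) \<Rightarrow> (complex \<Rightarrow> complex) \<Rightarrow> (complex \<Rightarrow> complex) set" where
  "Gam a b = range (word_map a b)"


section \<open>Coding of closed geodesics\<close>

definition limit_point ::
  "(complex \<Rightarrow> complex) \<Rightarrow> (complex \<Rightarrow> complex) \<Rightarrow> (nat \<Rightarrow> letter) \<Rightarrow> complex" where
  "limit_point a b f = lim (\<lambda>m. word_map a b (map f [0..<m]) 0)"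

definition cyc_nth :: "letter list \<Rightarrow> int \<Rightarrow> letter" where
  "cyc_nth w k = w ! nat (k mod int (length w))"

definition cyclically_reduced :: "letter list \<Rightarrow> bool" where
  "cyclically_reduced w \<longleftrightarrow> (\<forall>k. cyc_nth w (k + 1) \<noteq> bar (cyc_nth w k))"

text \<open>
  An oriented closed geodesic of \<open>P\<close> is given by a nonempty cyclically reduced word, up to
  cyclic permutation. Its lifts meeting the fundamental domain are the geodesics
  \<open>lift a b w i\<close>, \<open>0 \<le> i < length w\<close>; letters are numbered from 0 here.
\<close>

definition closed_geodesic_word :: "letter list \<Rightarrow> bool" where
  "closed_geodesic_word w \<longleftrightarrow> w \<noteq> [] \<and> cyclically_reduced w"

definition lift ::
  "(complex \<Rightarrow> complex) \<Rightarrow> (complex \<Rightarrow> complex) \<Rightarrow> letter list \<Rightarrow> nat \<Rightarrow> complex set" where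
  "lift a b w i =
     geodesic (limit_point a b (\<lambda>m. bar (cyc_nth w (int i - 1 - int m))))
              (limit_point a b (\<lambda>m. cyc_nth w (int i + int m)))"


section \<open>Self-intersection number\<close>

definition intersecting_pairs ::
  "(complex \<Rightarrow> complex) \<Rightarrow> (complex \<Rightarrow> complex) \<Rightarrow> letter list \<Rightarrow> complex set set set" where
  "intersecting_pairs a b w =
     {{lift a b w i, lift a b w j} | i j.
        i < length w \<and> j < length w \<and> i \<noteq> j \<and> lift a b w i \<inter> lift a b w j \<noteq> {}}"

definition pair_equiv ::
  "(complex \<Rightarrow> complex) \<Rightarrow> (complex \<Rightarrow> complex) \<Rightarrow> letter list
     \<Rightarrow> (complex set set \<times> complex set set) set" where
  "pair_equiv a b w =
     {(X, Y). X \<in> intersecting_pairs a b w \<and> Y \<in> intersecting_pairs a b w \<and>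
              (\<exists>g\<in>Gam a b. (\<lambda>l. g ` l) ` X = Y)}"

definition primitive_self_int ::
  "(complex \<Rightarrow> complex) \<Rightarrow> (complex \<Rightarrow> complex) \<Rightarrow> letter list \<Rightarrow> nat" where
  "primitive_self_int a b w = card (intersecting_pairs a b w // pair_equiv a b w)"

definition word_power :: "letter list \<Rightarrow> nat \<Rightarrow> letter list" where
  "word_power v m = concat (replicate m v)"

definition primitive_word :: "letter list \<Rightarrow> bool" where
  "primitive_word w \<longleftrightarrow> w \<noteq> [] \<and> (\<forall>v m. w = word_power v m \<longrightarrow> m = 1)"

definition root_word :: "letter list \<Rightarrow> letter list" where
  "root_word w = (THE v. primitive_word v \<and> (\<exists>m. w = word_power v m))"

text \<open>The exponent \<open>m\<close> in \<open>\<gamma> = \<gamma>\<^sub>0\<^sup>m\<close> is \<open>length w div length (root_word w)\<close>.\<close>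

definition self_int ::
  "(complex \<Rightarrow> complex) \<Rightarrow> (complex \<Rightarrow> complex) \<Rightarrow> letter list \<Rightarrow> nat" where
  "self_int a b w =
     (length w div length (root_word w))\<^sup>2 * primitive_self_int a b (root_word w)"

definition non_simple ::
  "(complex \<Rightarrow> complex) \<Rightarrow> (complex \<Rightarrow> complex) \<Rightarrow> letter list \<Rightarrow> bool" where
  "non_simple a b w \<longleftrightarrow> self_int a b w > 0"

end

theory Submission
  imports Defs
begin

text \<open>
  In the Klein model geodesics are chords, so two lifts cross iff their endpoints are linked on the
  circle. By ping-pong the endpoints lie in the arcs given by their first letters, and linking is read
  off the letters at the two ends of the common part of the two lifts in the Cayley tree of \<open>\<Gamma>\<close>.
  Translating a pair of lifts by \<open>\<Gamma>\<close> means sliding along this common part.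

  Upper bound: a crossing with a common edge has two ends, at which the two lifts branch; there are at most
  \<open>2 n (L - 2 n) + 4 p (n - p)\<close> unordered branchings, where \<open>2 p\<close> is the number of sign changes of the
  letters along the word. A crossing without a common edge pairs one of \<open>p\<close> turns with one of \<open>p\<close>
  opposite turns. Hence the primitive self-intersection number is at most
  \<open>n (L - 2 n) + 2 p (n - p) + p\<^sup>2 = n L - n\<^sup>2 - (n - p)\<^sup>2\<close>.

  Lower bound: each block of length \<open>l\<close> crosses itself \<open>l - 1\<close> times, which gives \<open>L - 2 n\<close> crossings.
  If all letters have the same sign, comparing the periodic sequence of block lengths with its shift by
  \<open>2 m\<close> blocks, \<open>0 < m < n\<close>, one meets a descent followed by an ascent, which is a crossing.
  Otherwise the same comparison inside each run of letters of equal sign gives \<open>n - 2 p\<close> crossings, and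
  the opposite turns give \<open>p\<^sup>2 \<ge> 2 p - 1\<close> more.
\<close>

section \<open>Moebius maps of the disk\<close>

text \<open>Both counts rest on a description of the classes by integers. A lift is an index modulo
  the word length, and an element of \<Gamma> carrying one lift through the fundamental domain to
  another is forced, letter by letter, to shift its index by one step back or forth; otherwise
  ping-pong would put both endpoints into one arc. Equivalence of crossings thus becomes a walk on
  pairs of indices, with the same letter acting on both. For the lower bound each crossing that is
  used has a canonical starting pair (\<open>anchor\<close>), from which the walk can only follow
  the common part. For the upper bound the four ordered branchings attached to a crossing must be
  distinct; the danger is a common part equal to its own inverse, which a parity argument excludes.
  All this needs distinct endpoints for distinct indices, hence primitive words. The proof therefore
  treats the primitive root and scales by the square of the exponent. The scaled lower bound needs
  at least one crossing of the root, and this is where non-simplicity enters.\<close>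

definition mob :: "complex \<Rightarrow> complex \<Rightarrow> complex \<Rightarrow> complex" where
  "mob \<alpha> \<beta> z = (\<alpha> * z + \<beta>) / (cnj \<beta> * z + cnj \<alpha>)"

text \<open>\<open>mob\<close> is the action of the matrix with rows
  \<open>(\<alpha>, \<beta>)\<close> and \<open>(cnj \<beta>, cnj \<alpha>)\<close>, whose
  determinant is positive but not normalised. Agreement is asked on the closed disk, because these
  maps will act on limit points.\<close>

definition disk_moebius :: "(complex \<Rightarrow> complex) \<Rightarrow> bool" where
  "disk_moebius g \<longleftrightarrow> (\<exists>\<alpha> \<beta>. cmod \<beta> < cmod \<alpha> \<and> (\<forall>z\<in>cball 0 1. g z = mob \<alpha> \<beta> z))"

lemma mob_denom_nonzero:
  assumes "cmod \<beta> < cmod \<alpha>" "cmod z \<le> 1"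
  shows "cnj \<beta> * z + cnj \<alpha> \<noteq> 0"
proof
  assume "cnj \<beta> * z + cnj \<alpha> = 0"
  then have "cnj \<alpha> = - (cnj \<beta> * z)" by (simp add: add_eq_0_iff)
  then have "cmod \<alpha> = cmod \<beta> * cmod z"
    by (metis complex_mod_cnj norm_minus_cancel norm_mult)
  also have "\<dots> \<le> cmod \<beta>" using assms(2) by (simp add: mult_left_le)
  finally show False using assms(1) by simp
qed

text \<open>The Hermitian form of signature (1,1) gets multiplied by the determinant; invariance of
  the disk and of the circle both follow.\<close>

lemma norm_sq_diff_mob:
  fixes \<alpha> \<beta> z :: complex
  shows "(cmod (cnj \<beta> * z + cnj \<alpha>))\<^sup>2 - (cmod (\<alpha> * z + \<beta>))\<^sup>2 =
         ((cmod \<alpha>)\<^sup>2 - (cmod \<beta>)\<^sup>2) * (1 - (cmod z)\<^sup>2)"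
proof -
  have "complex_of_real ((cmod (cnj \<beta> * z + cnj \<alpha>))\<^sup>2 - (cmod (\<alpha> * z + \<beta>))\<^sup>2) =
        complex_of_real (((cmod \<alpha>)\<^sup>2 - (cmod \<beta>)\<^sup>2) * (1 - (cmod z)\<^sup>2))"
    unfolding of_real_diff of_real_mult complex_norm_square of_real_1
    by (simp add: algebra_simps)
  then show ?thesis using of_real_eq_iff by blast
qed

lemma one_minus_norm_mob:
  assumes "cmod \<beta> < cmod \<alpha>" "cmod z \<le> 1"
  shows "1 - (cmod (mob \<alpha> \<beta> z))\<^sup>2 =
         ((cmod \<alpha>)\<^sup>2 - (cmod \<beta>)\<^sup>2) * (1 - (cmod z)\<^sup>2) / (cmod (cnj \<beta> * z + cnj \<alpha>))\<^sup>2"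
  using mob_denom_nonzero[OF assms] norm_sq_diff_mob[of \<beta> z \<alpha>]
  by (simp add: mob_def norm_divide power_divide divide_simps)

lemma det_pos: "cmod \<beta> < cmod \<alpha> \<Longrightarrow> 0 < (cmod \<alpha>)\<^sup>2 - (cmod \<beta>)\<^sup>2"
  by (simp add: power_strict_mono)

lemma norm_mob_less:
  assumes "cmod \<beta> < cmod \<alpha>" "cmod z < 1"
  shows "cmod (mob \<alpha> \<beta> z) < 1"
proof -
  have "0 < 1 - (cmod z)\<^sup>2" using assms(2) by (simp add: power_less_one_iff abs_square_less_1)
  then have "0 < 1 - (cmod (mob \<alpha> \<beta> z))\<^sup>2"
    using one_minus_norm_mob[of \<beta> \<alpha> z] assms det_pos[OF assms(1)] mob_denom_nonzero[of \<beta> \<alpha> z] by simp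
  then show ?thesis by (simp add: abs_square_less_1)
qed

lemma norm_mob_eq_1:
  assumes "cmod \<beta> < cmod \<alpha>" "cmod z = 1"
  shows "cmod (mob \<alpha> \<beta> z) = 1"
proof -
  have "1 - (cmod (mob \<alpha> \<beta> z))\<^sup>2 = 0"
    using one_minus_norm_mob[of \<beta> \<alpha> z] assms by simp
  then show ?thesis by (simp add: power2_eq_1_iff) (smt (verit) norm_ge_zero)
qed

lemma norm_mob_le: "cmod \<beta> < cmod \<alpha> \<Longrightarrow> cmod z \<le> 1 \<Longrightarrow> cmod (mob \<alpha> \<beta> z) \<le> 1"
  using norm_mob_less[of \<beta> \<alpha> z] norm_mob_eq_1[of \<beta> \<alpha> z] by fastforce

lemma mob_diff:
  assumes "cmod \<beta> < cmod \<alpha>" "cmod z \<le> 1" "cmod w \<le> 1"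
  shows "mob \<alpha> \<beta> z - mob \<alpha> \<beta> w =
    of_real ((cmod \<alpha>)\<^sup>2 - (cmod \<beta>)\<^sup>2) * (z - w) / ((cnj \<beta> * z + cnj \<alpha>) * (cnj \<beta> * w + cnj \<alpha>))"
  unfolding mob_def of_real_diff complex_norm_square
  using mob_denom_nonzero[OF assms(1,2)] mob_denom_nonzero[OF assms(1,3)]
  by (simp add: divide_simps) (simp add: algebra_simps)

lemma mob_compose:
  assumes "cmod \<beta> < cmod \<alpha>" "cmod \<beta>' < cmod \<alpha>'" "cmod z \<le> 1"
  shows "mob \<alpha> \<beta> (mob \<alpha>' \<beta>' z) = mob (\<alpha> * \<alpha>' + \<beta> * cnj \<beta>') (\<alpha> * \<beta>' + \<beta> * cnj \<alpha>') z"
proof -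
  let ?D = "cnj \<beta>' * z + cnj \<alpha>'"
  have D: "?D \<noteq> 0" using mob_denom_nonzero assms by blast
  have 1: "\<alpha> * mob \<alpha>' \<beta>' z + \<beta> = (\<alpha> * (\<alpha>' * z + \<beta>') + \<beta> * ?D) / ?D"
    using D by (simp add: mob_def field_simps)
  have 2: "cnj \<beta> * mob \<alpha>' \<beta>' z + cnj \<alpha> = (cnj \<beta> * (\<alpha>' * z + \<beta>') + cnj \<alpha> * ?D) / ?D"
    using D by (simp add: mob_def field_simps)
  have "mob \<alpha> \<beta> (mob \<alpha>' \<beta>' z) = (\<alpha> * (\<alpha>' * z + \<beta>') + \<beta> * ?D) / (cnj \<beta> * (\<alpha>' * z + \<beta>') + cnj \<alpha> * ?D)"
    unfolding mob_def[of \<alpha> \<beta>] 1 2 using D by simp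
  then show ?thesis by (simp add: mob_def algebra_simps)
qed

lemma mob_compose_params:
  assumes "cmod \<beta> < cmod \<alpha>" "cmod \<beta>' < cmod \<alpha>'"
  shows "cmod (\<alpha> * \<beta>' + \<beta> * cnj \<alpha>') < cmod (\<alpha> * \<alpha>' + \<beta> * cnj \<beta>')"
proof -
  have "complex_of_real ((cmod (\<alpha> * \<alpha>' + \<beta> * cnj \<beta>'))\<^sup>2 - (cmod (\<alpha> * \<beta>' + \<beta> * cnj \<alpha>'))\<^sup>2) =
        complex_of_real (((cmod \<alpha>)\<^sup>2 - (cmod \<beta>)\<^sup>2) * ((cmod \<alpha>')\<^sup>2 - (cmod \<beta>')\<^sup>2))"
    unfolding of_real_diff of_real_mult complex_norm_square
    by (simp add: algebra_simps)
  then have "(cmod (\<alpha> * \<alpha>' + \<beta> * cnj \<beta>'))\<^sup>2 - (cmod (\<alpha> * \<beta>' + \<beta> * cnj \<alpha>'))\<^sup>2 > 0"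
    using det_pos[OF assms(1)] det_pos[OF assms(2)] of_real_eq_iff by (metis mult_pos_pos)
  then show ?thesis by (meson diff_gt_0_iff_gt norm_ge_zero power_less_imp_less_base)
qed

text \<open>The adjugate matrix inverts up to a real scalar, and a scalar matrix acts
  trivially.\<close>

lemma mob_inverse:
  assumes "cmod \<beta> < cmod \<alpha>" "cmod z \<le> 1"
  shows "mob (cnj \<alpha>) (- \<beta>) (mob \<alpha> \<beta> z) = z"
proof -
  have "mob (cnj \<alpha>) (- \<beta>) (mob \<alpha> \<beta> z) = mob (cnj \<alpha> * \<alpha> - \<beta> * cnj \<beta>) 0 z"
    using mob_compose[of "-\<beta>" "cnj \<alpha>" \<beta> \<alpha> z] assms by (simp add: mult.commute)
  moreover have "cnj \<alpha> * \<alpha> - \<beta> * cnj \<beta> = of_real ((cmod \<alpha>)\<^sup>2 - (cmod \<beta>)\<^sup>2)"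
    unfolding of_real_diff complex_norm_square by (simp add: mult.commute)
  moreover have "complex_of_real ((cmod \<alpha>)\<^sup>2 - (cmod \<beta>)\<^sup>2) \<noteq> 0"
    using det_pos[OF assms(1)] of_real_eq_0_iff by (metis less_irrefl)
  ultimately show ?thesis by (metis (no_types, lifting) add.right_neutral complex_cnj_complex_of_real complex_cnj_zero
        mob_def mult_zero_left nonzero_mult_div_cancel_left add_0)
qed

lemma disk_moebius_id: "disk_moebius (\<lambda>z. z)"
  unfolding disk_moebius_def by (rule exI[of _ 1], rule exI[of _ 0]) (simp add: mob_def)

lemma disk_moebius_comp:
  assumes "disk_moebius f" "disk_moebius g"
  shows "disk_moebius (f \<circ> g)"
proof -
  obtain \<alpha> \<beta> \<alpha>' \<beta>' where *: "cmod \<beta> < cmod \<alpha>" "\<And>z. cmod z \<le> 1 \<Longrightarrow> f z = mob \<alpha> \<beta> z"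
     "cmod \<beta>' < cmod \<alpha>'" "\<And>z. cmod z \<le> 1 \<Longrightarrow> g z = mob \<alpha>' \<beta>' z"
    using assms unfolding disk_moebius_def by auto
  have "(f \<circ> g) z = mob (\<alpha> * \<alpha>' + \<beta> * cnj \<beta>') (\<alpha> * \<beta>' + \<beta> * cnj \<alpha>') z" if "cmod z \<le> 1" for z
    using that * norm_mob_le[of \<beta>' \<alpha>' z] mob_compose[of \<beta> \<alpha> \<beta>' \<alpha>' z] by simp
  then show ?thesis unfolding disk_moebius_def using mob_compose_params[OF *(1,3)] by auto
qed

lemma disk_moebius_norm:
  assumes "disk_moebius g"
  shows "cmod z < 1 \<Longrightarrow> cmod (g z) < 1" "cmod z = 1 \<Longrightarrow> cmod (g z) = 1" "cmod z \<le> 1 \<Longrightarrow> cmod (g z) \<le> 1"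
  using assms norm_mob_less norm_mob_eq_1 norm_mob_le unfolding disk_moebius_def by auto

lemma disk_moebius_inverse:
  assumes "disk_moebius g"
  obtains h where "disk_moebius h" "\<And>z. cmod z \<le> 1 \<Longrightarrow> h (g z) = z" "\<And>z. cmod z \<le> 1 \<Longrightarrow> g (h z) = z"
proof -
  obtain \<alpha> \<beta> where *: "cmod \<beta> < cmod \<alpha>" "\<And>z. cmod z \<le> 1 \<Longrightarrow> g z = mob \<alpha> \<beta> z"
    using assms unfolding disk_moebius_def by auto
  have h: "disk_moebius (mob (cnj \<alpha>) (- \<beta>))" unfolding disk_moebius_def using *(1)
    by (intro exI[of _ "cnj \<alpha>"] exI[of _ "-\<beta>"]) simp
  show thesis
  proof (rule that[OF h])
    fix z :: complex assume z: "cmod z \<le> 1"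
    then show "mob (cnj \<alpha>) (- \<beta>) (g z) = z" using * mob_inverse by simp
    have "mob \<alpha> \<beta> (mob (cnj \<alpha>) (- \<beta>) z) = z" using mob_inverse[of "-\<beta>" "cnj \<alpha>" z] *(1) z by simp
    then show "g (mob (cnj \<alpha>) (- \<beta>) z) = z" using * z disk_moebius_norm(3)[OF h z] by simp
  qed
qed

lemma disk_moebius_inj:
  assumes "disk_moebius g" shows "inj_on g (cball 0 1)"
proof -
  obtain h where "\<And>z. cmod z \<le> 1 \<Longrightarrow> h (g z) = z" by (rule disk_moebius_inverse[OF assms]) blast
  then show ?thesis by (intro inj_on_inverseI[of _ h]) simp
qed

lemma disk_moebius_cont:
  assumes "disk_moebius g" shows "continuous_on (cball 0 1) g"
proof -
  obtain \<alpha> \<beta> where *: "cmod \<beta> < cmod \<alpha>" "\<And>z. z \<in> cball 0 1 \<Longrightarrow> g z = mob \<alpha> \<beta> z"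
    using assms unfolding disk_moebius_def by auto
  have "continuous_on (cball 0 1) (mob \<alpha> \<beta>)"
    unfolding mob_def using mob_denom_nonzero[OF *(1)] by (intro continuous_intros) auto
  then show ?thesis using *(2) by (metis (no_types, lifting) continuous_on_cong)
qed

text \<open>This is sinh^2 of half the hyperbolic distance, a rational expression that keeps
  \<open>arcosh\<close> out of the computations.\<close>

definition hyp_ratio :: "complex \<Rightarrow> complex \<Rightarrow> real" where
  "hyp_ratio z w = (cmod (z - w))\<^sup>2 / ((1 - (cmod z)\<^sup>2) * (1 - (cmod w)\<^sup>2))"

lemma hyp_dist_ratio: "hyp_dist z w = arcosh (1 + 2 * hyp_ratio z w)"
  by (simp add: hyp_dist_def hyp_ratio_def)

lemma hyp_ratio_nonneg: "cmod z < 1 \<Longrightarrow> cmod w < 1 \<Longrightarrow> 0 \<le> hyp_ratio z w"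
  unfolding hyp_ratio_def by (intro divide_nonneg_nonneg mult_nonneg_nonneg) (auto simp: abs_square_le_1)

lemma cosh_hyp_dist: "cmod z < 1 \<Longrightarrow> cmod w < 1 \<Longrightarrow> cosh (hyp_dist z w) = 1 + 2 * hyp_ratio z w"
  unfolding hyp_dist_ratio using hyp_ratio_nonneg by (intro cosh_arcosh_real) simp

lemma hyp_dist_eq_iff:
  assumes "cmod z < 1" "cmod w < 1" "cmod z' < 1" "cmod w' < 1"
  shows "hyp_dist z w = hyp_dist z' w' \<longleftrightarrow> hyp_ratio z w = hyp_ratio z' w'"
proof
  assume "hyp_dist z w = hyp_dist z' w'"
  then have "1 + 2 * hyp_ratio z w = 1 + 2 * hyp_ratio z' w'"
    using cosh_hyp_dist[OF assms(1,2)] cosh_hyp_dist[OF assms(3,4)] by metis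
  then show "hyp_ratio z w = hyp_ratio z' w'" by simp
qed (simp add: hyp_dist_ratio)

text \<open>The difference and the two factors 1 - |z|^2, 1 - |w|^2 pick up the determinant and the
  denominators, and these cancel in \<open>hyp_ratio\<close>.\<close>

lemma disk_moebius_hyp_dist:
  assumes "disk_moebius g" "cmod z < 1" "cmod w < 1"
  shows "hyp_dist (g z) (g w) = hyp_dist z w"
proof -
  obtain \<alpha> \<beta> where *: "cmod \<beta> < cmod \<alpha>" "\<And>z. cmod z \<le> 1 \<Longrightarrow> g z = mob \<alpha> \<beta> z"
    using assms unfolding disk_moebius_def by auto
  let ?d = "(cmod \<alpha>)\<^sup>2 - (cmod \<beta>)\<^sup>2"
  let ?a = "cmod (cnj \<beta> * z + cnj \<alpha>)" let ?b = "cmod (cnj \<beta> * w + cnj \<alpha>)"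
  have d: "?d > 0" "?a > 0" "?b > 0"
    using det_pos[OF *(1)] mob_denom_nonzero[OF *(1)] assms by (auto simp: order_less_imp_le)
  have cancel: "(d * n / (a * b))\<^sup>2 / ((d * x / a\<^sup>2) * (d * y / b\<^sup>2)) = n\<^sup>2 / (x * y)"
    if "d > 0" "a > 0" "b > 0" for d n a b x y :: real
    using that by (simp add: power_mult_distrib power_divide divide_simps) (simp add: power2_eq_square)
  have "cmod (mob \<alpha> \<beta> z - mob \<alpha> \<beta> w) = ?d * cmod (z - w) / (?a * ?b)"
    using mob_diff[OF *(1), of z w] assms abs_of_pos[OF d(1)]
    by (simp add: norm_mult norm_divide norm_of_real del: of_real_diff of_real_power)
  then have "hyp_ratio (mob \<alpha> \<beta> z) (mob \<alpha> \<beta> w) = hyp_ratio z w"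
    unfolding hyp_ratio_def using one_minus_norm_mob[OF *(1), of z] one_minus_norm_mob[OF *(1), of w] assms(2,3)
      cancel[OF d] by simp
  then show ?thesis using * assms by (simp add: hyp_dist_ratio)
qed

text \<open>Compose \<open>f\<close> with a Moebius map taking \<open>f 0\<close> to 0. Preservation
  of the distance to the centre gives |h z| = |z|, so the equality case of the Schwarz lemma makes
  \<open>h\<close> a rotation, and solving for \<open>f\<close> yields a Moebius map.\<close>

lemma hyperbolic_isometry_disk_moebius:
  assumes "hyperbolic_isometry f"
  obtains g where "disk_moebius g" "\<And>z. cmod z < 1 \<Longrightarrow> f z = g z"
proof -
  have im: "\<And>z. cmod z < 1 \<Longrightarrow> cmod (f z) < 1"
    and hol: "f holomorphic_on ball 0 1"
    and iso: "\<And>z w. cmod z < 1 \<Longrightarrow> cmod w < 1 \<Longrightarrow> hyp_dist (f z) (f w) = hyp_dist z w"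
    using assms unfolding hyperbolic_isometry_def by auto
  define c where "c = f 0"
  define h where "h z = (f z - c) / (1 - cnj c * f z)" for z
  have c: "cmod c < 1" using im c_def by simp
  have nz: "1 - cnj c * f z \<noteq> 0" if "cmod z < 1" for z
    using mob_denom_nonzero[of "-c" 1 "f z"] c im[OF that] by simp
  have ratio: "hyp_ratio (f z) c = (cmod z)\<^sup>2 / (1 - (cmod z)\<^sup>2)" if "cmod z < 1" for z
    using iso[of z 0] hyp_dist_eq_iff[of "f z" c z 0] im that c unfolding c_def
    by (simp add: hyp_ratio_def)
  have nh: "cmod (h z) = cmod z" if z: "cmod z < 1" for z
  proof -
    have "(cmod (1 - cnj c * f z))\<^sup>2 - (cmod (f z - c))\<^sup>2 = (1 - (cmod c)\<^sup>2) * (1 - (cmod (f z))\<^sup>2)"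
      using norm_sq_diff_mob[of "-c" "f z" 1] by (simp add: algebra_simps)
    moreover have "(cmod (f z - c))\<^sup>2 = (cmod z)\<^sup>2 / (1 - (cmod z)\<^sup>2) * ((1 - (cmod (f z))\<^sup>2) * (1 - (cmod c)\<^sup>2))"
    proof -
      have "(1 - (cmod (f z))\<^sup>2) * (1 - (cmod c)\<^sup>2) \<noteq> 0"
        using im[OF z] c by (simp add: abs_square_eq_1)
      then show ?thesis using ratio[OF z] unfolding hyp_ratio_def by (metis nonzero_divide_eq_eq)
    qed
    moreover have "(1 - (cmod z)\<^sup>2) \<noteq> 0" using z by (simp add: abs_square_eq_1)
    moreover have "Y = r * X" if "X - Y = k * l" "Y = r / (1 - r) * (l * k)" "1 - r \<noteq> 0" for X Y r k l :: real
    proof -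
      have "Y * (1 - r) = r * (k * l)" using that(2,3) by simp
      also have "\<dots> = r * (X - Y)" using that(1) by simp
      finally show ?thesis by (simp add: algebra_simps)
    qed
    ultimately have "(cmod (f z - c))\<^sup>2 = (cmod z)\<^sup>2 * (cmod (1 - cnj c * f z))\<^sup>2" by blast
    then have "(cmod (h z))\<^sup>2 = (cmod z)\<^sup>2" unfolding h_def using nz[OF z]
      by (simp add: norm_divide power_divide)
    then show ?thesis by (simp add: power2_eq_iff_nonneg)
  qed
  have "h holomorphic_on ball 0 1" unfolding h_def using nz hol by (intro holomorphic_intros) auto
  moreover have "h 0 = 0" by (simp add: h_def c_def)
  ultimately have "\<exists>\<mu>. (\<forall>z. norm z < 1 \<longrightarrow> h z = \<mu> * z) \<and> norm \<mu> = 1"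
    using nh by (intro Schwarz_Lemma(3)[of h 0] disjI1 exI[of _ "1/2"]) auto
  then obtain \<mu> where mu: "\<And>z. cmod z < 1 \<Longrightarrow> h z = \<mu> * z" "cmod \<mu> = 1" by auto
  \<comment> \<open>A square root of \<open>cnj \<mu>\<close> spreads the rotation over numerator
    and denominator, since the diagonal entries of a \<open>mob\<close> matrix have to be
    conjugate.\<close>
  define s where "s = csqrt (cnj \<mu>)"
  have s: "s * s = cnj \<mu>" "cmod s = 1"
    using power2_csqrt[of "cnj \<mu>"] mu(2) by (auto simp: s_def power2_eq_square)
  have ss: "cnj s * s = 1" using s(2) complex_norm_square[of s] by (simp add: mult.commute)
  have mus: "\<mu> * s = cnj s"
  proof -
    have "cnj s * cnj s = \<mu>" using s(1) by (metis complex_cnj_cnj complex_cnj_mult)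
    then show ?thesis using ss by (simp add: mult.assoc flip: \<open>cnj s * cnj s = \<mu>\<close>)
  qed
  have cs: "cnj c * cnj s = cnj (s * c)" by simp
  have "f z = mob (cnj s) (s * c) z" if z: "cmod z < 1" for z
  proof -
    have "f z - c = \<mu> * z * (1 - cnj c * f z)" using mu(1)[OF z] nz[OF z] by (simp add: h_def field_simps)
    then have "f z * (1 + cnj c * \<mu> * z) = \<mu> * z + c" by (simp add: algebra_simps)
    then have "s * (f z * (1 + cnj c * \<mu> * z)) = s * (\<mu> * z + c)" by simp
    then have 1: "f z * (s + cnj c * (\<mu> * s) * z) = (\<mu> * s) * z + s * c"
      by (simp add: algebra_simps)
    have 2: "cnj (s * c) * z + cnj (cnj s) \<noteq> 0"
      using mob_denom_nonzero[of "s*c" "cnj s" z] z c s(2) by (simp add: norm_mult)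
    have "f z * (cnj (s * c) * z + cnj (cnj s)) = cnj s * z + s * c"
      using 1 unfolding mus cs[symmetric] by (simp only: complex_cnj_cnj ac_simps)
    then show ?thesis unfolding mob_def using 2 by (metis nonzero_eq_divide_eq)
  qed
  moreover have "disk_moebius (mob (cnj s) (s * c))" unfolding disk_moebius_def
    using c s(2) by (intro exI[of _ "cnj s"] exI[of _ "s*c"]) (simp add: norm_mult)
  ultimately show thesis using that by blast
qed

section \<open>Chords and the Klein model\<close>

text \<open>Twice the signed area of the triangle p, q, z: positive exactly when z lies to the left
  of the oriented line from p to q.\<close>

definition side :: "complex \<Rightarrow> complex \<Rightarrow> complex \<Rightarrow> real" where
  "side p q z = Im (cnj (q - p) * (z - p))"

lemma cnj_unit: "cmod p = 1 \<Longrightarrow> cnj p = 1 / p"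
  using complex_norm_square[of p] by (metis divide_self_if mult.commute mult_cancel_left1 nonzero_eq_divide_eq norm_zero of_real_1 power_one zero_neq_one)

text \<open>On the unit circle conjugation is inversion, which turns the signed area into a product
  of differences; those transform well under Moebius maps by \<open>mob_diff\<close>.\<close>

lemma side_unit:
  assumes "cmod p = 1" "cmod q = 1" "cmod r = 1"
  shows "complex_of_real (side p q r) * (2 * \<i>) = - ((p - q) * (q - r) * (r - p)) / (p * q * r)"
proof -
  have nz: "p \<noteq> 0" "q \<noteq> 0" "r \<noteq> 0" using assms by auto
  have "complex_of_real (side p q r) * (2 * \<i>) =
      cnj (q - p) * (r - p) - cnj (cnj (q - p) * (r - p))"
    unfolding side_def complex_diff_cnj by (simp add: mult.commute mult.left_commute)
  also have "\<dots> = (1 / q - 1 / p) * (r - p) - (q - p) * (1 / r - 1 / p)"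
    using assms by (simp add: cnj_unit)
  also have "\<dots> = - ((p - q) * (q - r) * (r - p)) / (p * q * r)"
    using nz by (simp add: divide_simps) (simp add: algebra_simps)
  finally show ?thesis .
qed

lemma side_unit_nonzero:
  assumes "cmod p = 1" "cmod q = 1" "cmod r = 1" "p \<noteq> q" "q \<noteq> r" "r \<noteq> p"
  shows "side p q r \<noteq> 0"
  using side_unit[OF assms(1-3)] assms by auto

lemma mob_unit:
  assumes "cmod z = 1"
  shows "mob \<alpha> \<beta> z = z * cnj (cnj \<beta> * z + cnj \<alpha>) / (cnj \<beta> * z + cnj \<alpha>)"
proof -
  have "z \<noteq> 0" using assms by auto
  then have "z * cnj (cnj \<beta> * z + cnj \<alpha>) = \<alpha> * z + \<beta>" using assms by (simp add: cnj_unit algebra_simps)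
  then show ?thesis by (simp add: mob_def)
qed

text \<open>By the product formula the signed area is multiplied by the positive number
  \<open>K\<close>: the unimodular quotients from \<open>mob_unit\<close> combine with the
  denominators to squared norms.\<close>

lemma side_mob_pos_iff:
  assumes "cmod \<beta> < cmod \<alpha>" "cmod p = 1" "cmod q = 1" "cmod r = 1"
  shows "0 < side (mob \<alpha> \<beta> p) (mob \<alpha> \<beta> q) (mob \<alpha> \<beta> r) \<longleftrightarrow> 0 < side p q r"
proof -
  let ?D = "\<lambda>z. cnj \<beta> * z + cnj \<alpha>"
  define d where "d = (cmod \<alpha>)\<^sup>2 - (cmod \<beta>)\<^sup>2"
  have d: "d > 0" using det_pos assms(1) d_def by simp
  have nz: "?D p \<noteq> 0" "?D q \<noteq> 0" "?D r \<noteq> 0" using mob_denom_nonzero assms by auto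
  then have cnz: "cnj (?D p) \<noteq> 0" "cnj (?D q) \<noteq> 0" "cnj (?D r) \<noteq> 0" by (simp_all only: complex_cnj_zero_iff not_False_eq_True)
  have pnz: "p \<noteq> 0" "q \<noteq> 0" "r \<noteq> 0" using assms by auto
  have md: "\<And>z w. cmod z = 1 \<Longrightarrow> cmod w = 1 \<Longrightarrow>
      mob \<alpha> \<beta> z - mob \<alpha> \<beta> w = of_real d * (z - w) / (?D z * ?D w)"
    using mob_diff[OF assms(1)] d_def by simp
  have gen: "- (e * (p - q) / (P * Q) * (e * (q - r) / (Q * R)) * (e * (r - p) / (R * P)))
        / (p * P' / P * (q * Q' / Q) * (r * R' / R)) =
        e ^ 3 / ((P * P') * (Q * Q') * (R * R')) * (- ((p - q) * (q - r) * (r - p)) / (p * q * r))"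
    if "P \<noteq> 0" "Q \<noteq> 0" "R \<noteq> 0" "P' \<noteq> 0" "Q' \<noteq> 0" "R' \<noteq> 0" for e P Q R P' Q' R' :: complex
    using that pnz by (simp add: divide_simps power3_eq_cube)
  define K where "K = d ^ 3 / ((cmod (?D p))\<^sup>2 * (cmod (?D q))\<^sup>2 * (cmod (?D r))\<^sup>2)"
  have K: "K > 0" unfolding K_def using d nz by simp
  have K': "complex_of_real K = of_real d ^ 3 /
      ((?D p * cnj (?D p)) * (?D q * cnj (?D q)) * (?D r * cnj (?D r)))"
    unfolding K_def by (simp only: of_real_divide of_real_mult of_real_power complex_norm_square[symmetric])
  have "complex_of_real (side (mob \<alpha> \<beta> p) (mob \<alpha> \<beta> q) (mob \<alpha> \<beta> r)) * (2 * \<i>) =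
      - (of_real d * (p - q) / (?D p * ?D q) * (of_real d * (q - r) / (?D q * ?D r)) *
        (of_real d * (r - p) / (?D r * ?D p)))
        / (p * cnj (?D p) / ?D p * (q * cnj (?D q) / ?D q) * (r * cnj (?D r) / ?D r))"
    using side_unit[of "mob \<alpha> \<beta> p" "mob \<alpha> \<beta> q" "mob \<alpha> \<beta> r"] norm_mob_eq_1[OF assms(1)] assms
      md[of p q] md[of q r] md[of r p] by (simp only: mob_unit)
  also have "\<dots> = of_real K * (- ((p - q) * (q - r) * (r - p)) / (p * q * r))"
    unfolding K' by (rule gen[OF nz cnz])
  also have "\<dots> = of_real K * (complex_of_real (side p q r) * (2 * \<i>))"
    using side_unit[of p q r] assms by simp
  finally have "complex_of_real (side (mob \<alpha> \<beta> p) (mob \<alpha> \<beta> q) (mob \<alpha> \<beta> r)) = of_real (K * side p q r)"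
    by simp
  then have "side (mob \<alpha> \<beta> p) (mob \<alpha> \<beta> q) (mob \<alpha> \<beta> r) = K * side p q r"
    using of_real_eq_iff by blast
  then show ?thesis using K by (simp add: zero_less_mult_iff)
qed

lemma side_disk_moebius_pos_iff:
  assumes "disk_moebius g" "cmod p = 1" "cmod q = 1" "cmod r = 1"
  shows "0 < side (g p) (g q) (g r) \<longleftrightarrow> 0 < side p q r"
  using assms side_mob_pos_iff unfolding disk_moebius_def by auto

text \<open>For angles increasing within one turn all three half-angle sines are positive, so
  \<open>side\<close> detects the cyclic order.\<close>

lemma side_cis:
  "side (cis x) (cis y) (cis z) = 4 * sin ((y - x) / 2) * sin ((z - y) / 2) * sin ((z - x) / 2)"
proof -
  define u where "u = (y - x) / 2"
  define v where "v = (z - y) / 2"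
  have y: "y = x + 2 * u" and z: "z = x + 2 * u + 2 * v" by (simp_all add: u_def v_def field_simps)
  have 1: "cis (x + 2 * u) - cis x = cis x * (cis (2 * u) - 1)" by (simp add: cis_mult algebra_simps)
  have 2: "cis (x + 2 * u + 2 * v) - cis x = cis x * (cis (2 * u + 2 * v) - 1)"
    by (simp add: cis_mult algebra_simps)
  have "side (cis x) (cis y) (cis z) = Im (cnj (cis x * (cis (2 * u) - 1)) * (cis x * (cis (2 * u + 2 * v) - 1)))"
    unfolding side_def y z 1 2 ..
  also have "cnj (cis x * (cis (2 * u) - 1)) * (cis x * (cis (2 * u + 2 * v) - 1)) =
     (cnj (cis x) * cis x) * ((cnj (cis (2 * u)) - 1) * (cis (2 * u + 2 * v) - 1))"
    by (simp add: algebra_simps)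
  also have "cnj (cis x) * cis x = 1" by (simp add: cis_cnj cis_mult)
  also have "Im (1 * ((cnj (cis (2 * u)) - 1) * (cis (2 * u + 2 * v) - 1))) =
      Im ((cnj (cis (2 * u)) - 1) * (cis (2 * u + 2 * v) - 1))" by (simp only: mult_1_left)
  also have "\<dots> = Im (cis (2 * v) - cis (- 2 * u) - cis (2 * u+2 * v) + 1)"
    by (simp add: algebra_simps cis_mult cis_cnj del: cis.simps)
  also have "\<dots> = sin (2 * v) + sin (2 * u) - sin (2 * u+2 * v)" by simp
  also have "\<dots> = 4 * sin u * sin v * sin (u + v)"
  proof -
    have "sin (2 * u+2 * v) = 2 * sin (u+v) * cos (u+v)"
      using sin_double[of "u+v"] by (simp add: algebra_simps)
    moreover have "sin (2 * v) + sin (2 * u) = 2 * sin (u+v) * cos (u-v)"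
    proof -
      have h: "(2 * u + 2 * v) / 2 = u + v" "(2 * u - 2 * v) / 2 = u - v" by simp_all
      show ?thesis using sin_plus_sin[of "2 * u" "2 * v"] unfolding h by simp
    qed
    moreover have "cos (u - v) - cos (u+v) = 2 * sin u * sin v"
      by (simp add: cos_diff cos_add)
    ultimately show ?thesis
    proof -
      assume a: "sin (2 * u + 2 * v) = 2 * sin (u+v) * cos (u+v)"
        "sin (2 * v) + sin (2 * u) = 2 * sin (u+v) * cos (u-v)"
        and c: "cos (u - v) - cos (u+v) = 2 * sin u * sin v"
      have "sin (2 * v) + sin (2 * u) - sin (2 * u + 2 * v) = 2 * sin (u+v) * (cos (u - v) - cos (u+v))"
        unfolding a by (simp only: right_diff_distrib)
      then show ?thesis unfolding c by simp
    qed
  qed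
  finally show ?thesis by (simp add: u_def v_def add_divide_distrib[symmetric])
qed

lemma side_cis_pos:
  assumes "x < y" "y < z" "z < x + 2 * pi"
  shows "0 < side (cis x) (cis y) (cis z)"
  unfolding side_cis using assms by (intro mult_pos_pos sin_gt_zero) auto

lemma side_rotate:
  "side p q r = side q r p"
  by (simp add: side_def algebra_simps)

lemma side_swap: "side p r q = - side p q r"
  by (simp add: side_def algebra_simps)

text \<open>The power of a point of the line with respect to the circle. It serves in both
  directions: parameters in (0,1) give points of the disk, and a point of the line inside the disk
  has its parameter in (0,1).\<close>

lemma cmod_chord_sq:
  assumes "cmod p = 1" "cmod q = 1"
  shows "(cmod (p + of_real l * (q - p)))\<^sup>2 = 1 - l * (1 - l) * (cmod (q - p))\<^sup>2"
proof -
  have pq: "Re p ^ 2 + Im p ^ 2 = 1" "Re q ^ 2 + Im q ^ 2 = 1"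
    using assms by (simp_all flip: cmod_power2)
  have "(cmod (p + of_real l * (q - p)))\<^sup>2 - (1 - l * (1 - l) * (cmod (q - p))\<^sup>2) =
     (1 - l) * (Re p ^ 2 + Im p ^ 2 - 1) + l * (Re q ^ 2 + Im q ^ 2 - 1)"
    unfolding cmod_power2 by (simp add: power2_eq_square algebra_simps)
  then show ?thesis using pq by simp
qed

lemma open_segment_param: "p \<noteq> q \<Longrightarrow> x \<in> open_segment p q \<longleftrightarrow> (\<exists>l. 0 < l \<and> l < 1 \<and> x = p + of_real l * (q - p))"
  for p q x :: complex
  unfolding in_segment by (auto simp: scaleR_conv_of_real algebra_simps)

lemma open_segment_unit_disk:
  assumes "cmod p = 1" "cmod q = 1" "x \<in> open_segment p q"
  shows "cmod x < 1"
proof -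
  have "p \<noteq> q" using assms(3) by auto
  then obtain l where l: "0 < l" "l < 1" "x = p + of_real l * (q - p)"
    using iffD1[OF open_segment_param assms(3)] by auto
  have "0 < l * (1 - l) * (cmod (q - p))\<^sup>2" using l \<open>p \<noteq> q\<close> by simp
  then have "(cmod x)\<^sup>2 < 1" using cmod_chord_sq[OF assms(1,2), of l] unfolding l(3) by linarith
  then show ?thesis by (simp add: abs_square_less_1)
qed

text \<open>\<open>side p q\<close> is affine along the other chord and vanishes on the line through
  p and q. Opposite signs give a zero on the open chord from r to s; that zero is in the disk, hence
  on the open chord from p to q.\<close>

lemma chords_cross_iff:
  assumes unit: "cmod p = 1" "cmod q = 1" "cmod r = 1" "cmod s = 1"
    and ne: "p \<noteq> q" "r \<noteq> s" "r \<noteq> p" "r \<noteq> q" "s \<noteq> p" "s \<noteq> q"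
  shows "open_segment p q \<inter> open_segment r s \<noteq> {} \<longleftrightarrow> (0 < side p q r \<longleftrightarrow> \<not> 0 < side p q s)"
proof -
  have aff: "side p q (r + of_real l * (s - r)) = (1 - l) * side p q r + l * side p q s" for l
    by (simp add: side_def algebra_simps)
  have on: "side p q (p + of_real l * (q - p)) = 0" for l
    by (simp add: side_def algebra_simps)
  have nz: "side p q r \<noteq> 0" "side p q s \<noteq> 0" using side_unit_nonzero unit ne by metis+
  show ?thesis
  proof
    assume "open_segment p q \<inter> open_segment r s \<noteq> {}"
    then obtain x where x: "x \<in> open_segment p q" "x \<in> open_segment r s" by blast
    obtain k where k: "x = p + of_real k * (q - p)" using iffD1[OF open_segment_param[OF ne(1)] x(1)] by auto
    obtain l where l: "0 < l" "l < 1" "x = r + of_real l * (s - r)"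
      using iffD1[OF open_segment_param[OF ne(2)] x(2)] by auto
    note * = l(1,2) k[unfolded l(3), symmetric]
    have "(1 - l) * side p q r + l * side p q s = 0" using aff[of l] on[of k] *(3) by simp
    then show "0 < side p q r \<longleftrightarrow> \<not> 0 < side p q s"
      using * nz by (smt (verit) mult_pos_pos mult_pos_neg)
  next
    assume opp: "0 < side p q r \<longleftrightarrow> \<not> 0 < side p q s"
    define R S where "R = side p q r" and "S = side p q s"
    \<comment> \<open>The zero of the affine function with values R and S at the two ends.\<close>
    define l where "l = R / (R - S)"
    have l: "0 < l" "l < 1" "(1 - l) * R + l * S = 0"
      using opp nz unfolding l_def R_def[symmetric] S_def[symmetric] by (auto simp: field_simps)
    define x where "x = r + of_real l * (s - r)"
    have xs: "x \<in> open_segment r s" unfolding open_segment_param[OF ne(2)] x_def using l(1,2) by (intro exI[of _ l]) simp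
    have "side p q x = 0" using aff[of l] l(3) x_def R_def S_def by simp
    then have im: "Im (cnj (q - p) * (x - p)) = 0" by (simp add: side_def)
    \<comment> \<open>The coordinate of x along the line, by orthogonal projection to the direction
      q - p.\<close>
    define k where "k = Re (cnj (q - p) * (x - p)) / (cmod (q - p))\<^sup>2"
    have "cnj (q - p) * (x - p) = of_real (k * (cmod (q - p))\<^sup>2)"
      using im ne(1) by (simp add: k_def complex_eq_iff)
    also have "\<dots> = of_real k * ((q - p) * cnj (q - p))" by (simp only: of_real_mult complex_norm_square)
    finally have "x - p = of_real k * (q - p)" using ne(1) by (simp add: mult.commute mult.left_commute)
    then have x: "x = p + of_real k * (q - p)" by (simp add: algebra_simps)
    have "(cmod x)\<^sup>2 < 1" using open_segment_unit_disk[OF unit(3,4) xs] by (simp add: abs_square_less_1)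
    then have "0 < k * (1 - k) * (cmod (q - p))\<^sup>2" using cmod_chord_sq[OF unit(1,2), of k] x by simp
    then have "0 < k" "k < 1" using ne(1) by (auto simp: zero_less_mult_iff)
    then have "x \<in> open_segment p q" unfolding open_segment_param[OF ne(1)] using x by (intro exI[of _ k]) simp
    then show "open_segment p q \<inter> open_segment r s \<noteq> {}" using xs by blast
  qed
qed

text \<open>The change of coordinates from the Poincare to the Klein model, where geodesics are chords.\<close>

definition klein :: "complex \<Rightarrow> complex" where
  "klein z = 2 * z / of_real (1 + (cmod z)\<^sup>2)"

definition klein_inv :: "complex \<Rightarrow> complex" where
  "klein_inv x = x / of_real (1 + sqrt (1 - (cmod x)\<^sup>2))"

lemma klein_inv_klein:
  assumes "cmod z < 1" shows "klein_inv (klein z) = z"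
proof -
  let ?r = "(cmod z)\<^sup>2"
  have r: "0 \<le> ?r" "?r < 1" using assms by (auto simp: abs_square_less_1)
  have "cmod (klein z) = 2 * cmod z / (1 + ?r)"
    unfolding klein_def norm_divide norm_mult norm_of_real using r by simp
  then have "1 - (cmod (klein z))\<^sup>2 = ((1 - ?r) / (1 + ?r))\<^sup>2"
  proof -
    have "1 - 4 * x / (1 + x)\<^sup>2 = ((1 - x) / (1 + x))\<^sup>2" if "x \<ge> 0" for x :: real
      using that by (simp add: power_divide divide_simps) (simp add: power2_eq_square algebra_simps)
    then show ?thesis using \<open>cmod (klein z) = _\<close> r by (simp add: power_divide power_mult_distrib)
  qed
  then have "sqrt (1 - (cmod (klein z))\<^sup>2) = (1 - ?r) / (1 + ?r)" using r by (simp add: real_sqrt_divide)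
  moreover have "1 + (1 - x) / (1 + x) = 2 / (1 + x)" if "x \<ge> 0" for x :: real
    using that by (simp add: field_simps)
  ultimately have "1 + sqrt (1 - (cmod (klein z))\<^sup>2) = 2 / (1 + ?r)" using r by simp
  moreover have "complex_of_real (1 + ?r) \<noteq> 0" using r of_real_eq_0_iff by (metis add_pos_nonneg less_irrefl zero_less_one)
  moreover have "2 * z / e / (2 / e) = z" if "e \<noteq> 0" for e :: complex using that by simp
  ultimately show ?thesis unfolding klein_inv_def klein_def[of z, symmetric]
    by (simp only: klein_def of_real_divide of_real_numeral)
qed

lemma klein_klein_inv:
  assumes "cmod x < 1" shows "cmod (klein_inv x) < 1" "klein (klein_inv x) = x"
proof -
  define s where "s = sqrt (1 - (cmod x)\<^sup>2)"
  have x1: "(cmod x)\<^sup>2 < 1" using assms by (auto simp: abs_square_less_1)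
  then have s: "s > 0" "(cmod x)\<^sup>2 = 1 - s\<^sup>2" by (auto simp: s_def)
  have n: "cmod (klein_inv x) = cmod x / (1 + s)"
    unfolding klein_inv_def s_def[symmetric] norm_divide norm_of_real using s by simp
  show "cmod (klein_inv x) < 1" unfolding n using assms s by simp
  have "1 + (cmod (klein_inv x))\<^sup>2 = 2 / (1 + s)"
    unfolding n power_divide s(2) using s(1) by (simp add: divide_simps) (simp add: power2_eq_square algebra_simps)
  moreover have "complex_of_real (1 + s) \<noteq> 0" using s of_real_eq_0_iff by (metis add_pos_pos less_irrefl zero_less_one)
  moreover have "2 * (x / e) / (2 / e) = x" if "e \<noteq> 0" for e :: complex using that by simp
  ultimately show "klein (klein_inv x) = x" unfolding klein_def klein_inv_def s_def[symmetric]
    by (simp only: of_real_divide of_real_numeral)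
qed

text \<open>This is why geodesics become straight: the Klein image of a point of the ray is a
  combination of the two image endpoints with nonnegative weights. It reduces to two polynomial
  identities that hold modulo \<open>v * cnj v = 1\<close>.\<close>

lemma klein_mob_ray:
  assumes ab: "cmod \<beta> < cmod \<alpha>" and v: "cmod v = 1" and \<tau>: "-1 < \<tau>" "\<tau> < 1"
  defines "Np \<equiv> (cmod (cnj \<beta> * v + cnj \<alpha>))\<^sup>2" and "Nm \<equiv> (cmod (cnj \<beta> * (- v) + cnj \<alpha>))\<^sup>2"
  shows "of_real ((1 + \<tau>)\<^sup>2 * Np + (1 - \<tau>)\<^sup>2 * Nm) * klein (mob \<alpha> \<beta> (of_real \<tau> * v)) =
     of_real ((1 - \<tau>)\<^sup>2 * Nm) * mob \<alpha> \<beta> (- v) + of_real ((1 + \<tau>)\<^sup>2 * Np) * mob \<alpha> \<beta> v"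
proof -
  define t where "t = complex_of_real \<tau>"
  let ?z = "t * v"
  let ?D = "\<lambda>z. cnj \<beta> * z + cnj \<alpha>"
  have z1: "cmod ?z \<le> 1" using \<tau> v by (simp add: t_def norm_mult)
  have D: "?D ?z \<noteq> 0" "?D v \<noteq> 0" "?D (- v) \<noteq> 0"
    using mob_denom_nonzero[OF ab z1] mob_denom_nonzero[OF ab, of v] mob_denom_nonzero[OF ab, of "- v"] v
    by simp_all
  have v0: "v \<noteq> 0" using v by auto
  have cv: "v * cnj v = 1" using v complex_norm_square[of v] by simp
  have W_id: "(1 + t)\<^sup>2 * ((b * v + a) * (B * w + A)) + (1 - t)\<^sup>2 * ((b * (- v) + a) * (B * (- w) + A))
     = 2 * ((b * (t * v) + a) * (B * (t * w) + A) + (A * (t * v) + B) * (a * (t * w) + b))" (is "?l = ?r")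
    if "v * w = 1" for w a A b B :: complex
  proof -
    \<comment> \<open>The cofactor of \<open>v * w - 1\<close> is written out, so that plain
      expansion verifies the identity.\<close>
    have "?l - ?r = (v * w - 1) * (2 * b * B - 2 * a * A * t\<^sup>2)"
      by (simp add: power2_eq_square algebra_simps)
    then show ?thesis using that by simp
  qed
  have N_id: "(1 - t)\<^sup>2 * ((A * (- v) + B) * (B * (- w) + A)) + (1 + t)\<^sup>2 * ((A * v + B) * (B * w + A))
     = 4 * (A * (t * v) + B) * (B * (t * w) + A)" (is "?l = ?r")
    if "v * w = 1" for w A B :: complex
  proof -
    have "?l - ?r = (v * w - 1) * (2 * A * B * (1 - t\<^sup>2))"
      by (simp add: power2_eq_square algebra_simps)
    then show ?thesis using that by simp
  qed
  have K: "klein (mob \<alpha> \<beta> ?z) * of_real ((cmod (?D ?z))\<^sup>2 + (cmod (\<alpha> * ?z + \<beta>))\<^sup>2) = 2 * (\<alpha> * ?z + \<beta>) * cnj (?D ?z)"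
  proof -
    have pos: "(cmod (?D ?z))\<^sup>2 + (cmod (\<alpha> * ?z + \<beta>))\<^sup>2 > 0" using D(1) by (simp add: add_pos_nonneg)
    have "1 + (cmod (mob \<alpha> \<beta> ?z))\<^sup>2 = ((cmod (?D ?z))\<^sup>2 + (cmod (\<alpha> * ?z + \<beta>))\<^sup>2) / (cmod (?D ?z))\<^sup>2"
      using D(1) unfolding mob_def norm_divide power_divide by (simp add: add_divide_distrib)
    then have "klein (mob \<alpha> \<beta> ?z) = 2 * mob \<alpha> \<beta> ?z * of_real ((cmod (?D ?z))\<^sup>2) / of_real ((cmod (?D ?z))\<^sup>2 + (cmod (\<alpha> * ?z + \<beta>))\<^sup>2)"
      unfolding klein_def by simp
    moreover have "complex_of_real ((cmod (?D ?z))\<^sup>2 + (cmod (\<alpha> * ?z + \<beta>))\<^sup>2) \<noteq> 0"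
      using pos of_real_eq_0_iff by (metis less_irrefl)
    ultimately have "klein (mob \<alpha> \<beta> ?z) * of_real ((cmod (?D ?z))\<^sup>2 + (cmod (\<alpha> * ?z + \<beta>))\<^sup>2) = 2 * mob \<alpha> \<beta> ?z * of_real ((cmod (?D ?z))\<^sup>2)"
      by (metis nonzero_eq_divide_eq)
    also have "\<dots> = 2 * (\<alpha> * ?z + \<beta>) * cnj (?D ?z)"
      unfolding complex_norm_square mob_def using D(1) by simp
    finally show ?thesis .
  qed
  have ct: "cnj t = t" by (simp add: t_def)
  have W: "complex_of_real ((1 + \<tau>)\<^sup>2 * Np + (1 - \<tau>)\<^sup>2 * Nm) = 2 * of_real ((cmod (?D ?z))\<^sup>2 + (cmod (\<alpha> * ?z + \<beta>))\<^sup>2)"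
    unfolding Np_def Nm_def of_real_mult of_real_add of_real_diff complex_norm_square
    using W_id[OF cv, of "cnj \<beta>" "cnj \<alpha>" \<beta> \<alpha>] by (simp add: ct flip: t_def)
  have P: "of_real Np * mob \<alpha> \<beta> v = (\<alpha> * v + \<beta>) * cnj (?D v)"
    unfolding Np_def complex_norm_square mob_def using D(2) by simp
  have M: "of_real Nm * mob \<alpha> \<beta> (-v) = (\<alpha> * (-v) + \<beta>) * cnj (?D (-v))"
    unfolding Nm_def complex_norm_square mob_def using D(3) by simp
  have "of_real ((1 - \<tau>)\<^sup>2 * Nm) * mob \<alpha> \<beta> (- v) + of_real ((1 + \<tau>)\<^sup>2 * Np) * mob \<alpha> \<beta> v
    = (1 - t)\<^sup>2 * ((\<alpha> * (-v) + \<beta>) * cnj (?D (-v))) + (1 + t)\<^sup>2 * ((\<alpha> * v + \<beta>) * cnj (?D v))"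
    unfolding P[symmetric] M[symmetric] t_def by simp
  also have "\<dots> = 4 * (\<alpha> * ?z + \<beta>) * cnj (?D ?z)"
    using N_id[OF cv, of \<alpha> \<beta>] by (simp add: ct)
  also have "\<dots> = 2 * (klein (mob \<alpha> \<beta> ?z) * of_real ((cmod (?D ?z))\<^sup>2 + (cmod (\<alpha> * ?z + \<beta>))\<^sup>2))"
    unfolding K by simp
  finally show ?thesis unfolding W t_def[symmetric] by (simp add: mult.commute mult.left_commute)
qed

section \<open>Geodesics\<close>

text \<open>The parameter of tanh is half the arc length on a diameter, because tanh x - tanh y =
  sinh (x - y) / (cosh x cosh y). Unit speed rays therefore use \<open>tanh (t / 2)\<close>.\<close>

lemma hyp_ratio_diameter:
  assumes "cmod v = 1"
  shows "hyp_ratio (of_real (tanh x) * v) (of_real (tanh y) * v) = (sinh (x - y))\<^sup>2"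
proof -
  have 1: "(cmod (of_real (tanh x) * v - of_real (tanh y) * v))\<^sup>2 = (tanh x - tanh y)\<^sup>2"
    using assms by (simp add: left_diff_distrib[symmetric] norm_mult flip: of_real_diff)
  have 2: "1 - (cmod (of_real (tanh u) * v))\<^sup>2 = 1 / (cosh u)\<^sup>2" for u :: real
  proof -
    have "1 - (tanh u)\<^sup>2 = 1 / (cosh u)\<^sup>2"
      unfolding tanh_def power_divide
    proof -
      have "1 - s / c = 1 / c" if "c = s + 1" "c > 0" for c s :: real using that by (simp add: field_simps)
      then show "1 - (sinh u)\<^sup>2 / (cosh u)\<^sup>2 = 1 / (cosh u)\<^sup>2"
        using cosh_square_eq[of u] zero_less_power[OF cosh_real_pos] by metis
    qed
    then show ?thesis using assms by (simp add: norm_mult)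
  qed
  have "tanh x - tanh y = sinh (x - y) / (cosh x * cosh y)"
    by (simp add: tanh_def sinh_diff divide_simps)
  then show ?thesis unfolding hyp_ratio_def 1 2
    by (simp add: power_divide power_mult_distrib)
qed

lemma hyp_dist_eq_abs_iff:
  assumes "cmod z < 1" "cmod w < 1"
  shows "hyp_dist z w = \<bar>s - t\<bar> \<longleftrightarrow> hyp_ratio z w = (sinh ((s - t) / 2))\<^sup>2"
proof -
  have c: "cosh \<bar>s - t\<bar> = 1 + 2 * (sinh ((s - t) / 2))\<^sup>2"
  proof -
    define u where "u = (s - t) / 2"
    have "s - t = 2 * u" by (simp add: u_def)
    then show ?thesis using cosh_double[of u] cosh_square_eq[of u] by (simp add: cosh_real_abs)
  qed
  show ?thesis
  proof
    assume "hyp_dist z w = \<bar>s - t\<bar>"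
    then have "cosh \<bar>s - t\<bar> = 1 + 2 * hyp_ratio z w" using cosh_hyp_dist[OF assms] by simp
    then show "hyp_ratio z w = (sinh ((s - t) / 2))\<^sup>2" using c by simp
  next
    assume "hyp_ratio z w = (sinh ((s - t) / 2))\<^sup>2"
    then have "hyp_dist z w = arcosh (cosh \<bar>s - t\<bar>)" using c by (simp add: hyp_dist_ratio)
    then show "hyp_dist z w = \<bar>s - t\<bar>" using arcosh_cosh_real[of "\<bar>s - t\<bar>"] by simp
  qed
qed

lemma norm_tanh_unit: "cmod v = 1 \<Longrightarrow> cmod (of_real (tanh x) * v) < 1"
  using tanh_real_abs[of x] tanh_real_lt_1[of "\<bar>x\<bar>"] by (simp add: norm_mult)

lemma geodesic_line_ray:
  assumes "disk_moebius g" "cmod v = 1"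
  shows "geodesic_line (\<lambda>t. g (of_real (tanh (t / 2)) * v))"
  unfolding geodesic_line_def
proof (intro conjI allI)
  show "range (\<lambda>t. g (of_real (tanh (t / 2)) * v)) \<subseteq> disk"
    using disk_moebius_norm(1)[OF assms(1)] norm_tanh_unit[OF assms(2)] by auto
  fix s t
  have "hyp_dist (of_real (tanh (s / 2)) * v) (of_real (tanh (t / 2)) * v) = \<bar>s - t\<bar>"
    using norm_tanh_unit[OF assms(2)] hyp_ratio_diameter[OF assms(2)]
    by (subst hyp_dist_eq_abs_iff) (simp_all add: diff_divide_distrib)
  then show "hyp_dist (g (of_real (tanh (s / 2)) * v)) (g (of_real (tanh (t / 2)) * v)) = \<bar>s - t\<bar>"
    using disk_moebius_hyp_dist[OF assms(1)] norm_tanh_unit[OF assms(2)] by simp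
qed

section \<open>Geodesic lines as Moebius images of diameters\<close>

lemma disk_moebius_transitive:
  assumes "cmod w < 1"
  obtains g where "disk_moebius g" "g 0 = w"
proof
  show "disk_moebius (mob 1 w)" unfolding disk_moebius_def using assms
    by (intro exI[of _ 1] exI[of _ w]) simp
qed (simp add: mob_def)

lemma geodesic_line_comp:
  assumes "disk_moebius g" "geodesic_line c"
  shows "geodesic_line (g \<circ> c)"
proof -
  have c: "\<And>t. cmod (c t) < 1" "\<And>s t. hyp_dist (c s) (c t) = \<bar>s - t\<bar>"
    using assms(2) unfolding geodesic_line_def by (auto simp: image_subset_iff)
  then show ?thesis unfolding geodesic_line_def
    using disk_moebius_norm(1)[OF assms(1)] disk_moebius_hyp_dist[OF assms(1)] by auto
qed

text \<open>The distance to 0 fixes the norm of \<open>c t\<close>, and the distance to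
  \<open>c 1\<close> then fixes its inner product with \<open>v\<close>. A vector of norm |\<tau>|
  whose inner product with a unit vector is \<tau> is \<tau> times that vector.\<close>

lemma geodesic_line_through_0:
  assumes "geodesic_line c" "c 0 = 0"
  obtains v where "cmod v = 1" "\<And>t. c t = of_real (tanh (t / 2)) * v"
proof -
  have c: "\<And>t. cmod (c t) < 1" "\<And>s t. hyp_ratio (c s) (c t) = (sinh ((s - t) / 2))\<^sup>2"
    using assms(1) hyp_dist_eq_abs_iff unfolding geodesic_line_def by (auto simp: image_subset_iff)
  have sq: "(cmod (c t))\<^sup>2 = (tanh (t / 2))\<^sup>2" for t
  proof -
    have "1 - (cmod (c t))\<^sup>2 \<noteq> 0" using c(1)[of t] by (simp add: abs_square_eq_1)
    moreover have "(cmod (c t))\<^sup>2 / (1 - (cmod (c t))\<^sup>2) = (sinh (t / 2))\<^sup>2"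
      using c(2)[of t 0] assms(2) by (simp add: hyp_ratio_def)
    ultimately have "(cmod (c t))\<^sup>2 * (1 + (sinh (t / 2))\<^sup>2) = (sinh (t / 2))\<^sup>2"
      by (simp add: field_simps)
    then have "(cmod (c t))\<^sup>2 * (cosh (t / 2))\<^sup>2 = (sinh (t / 2))\<^sup>2"
      using cosh_square_eq[of "t / 2"] by (simp add: add.commute)
    then show ?thesis unfolding tanh_def power_divide by (simp add: field_simps)
  qed
  define a where "a = tanh (1 / 2 :: real)"
  have a: "a > 0" by (simp add: a_def)
  define v where "v = c 1 / of_real a"
  have ca: "cmod (c 1) = a" using sq[of 1] a a_def by (simp add: power2_eq_iff_nonneg)
  then have v: "cmod v = 1" using a by (simp add: v_def norm_divide)
  have c1: "c 1 = of_real a * v" using a by (simp add: v_def)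
  have "c t = of_real (tanh (t / 2)) * v" for t
  proof -
    define \<tau> where "\<tau> = tanh (t / 2)"
    have "hyp_ratio (c t) (c 1) = hyp_ratio (of_real \<tau> * v) (of_real a * v)"
      unfolding c(2) \<tau>_def a_def hyp_ratio_diameter[OF v] by (simp add: diff_divide_distrib)
    moreover have "(cmod (c t))\<^sup>2 = (cmod (of_real \<tau> * v))\<^sup>2" using sq[of t] v by (simp add: \<tau>_def norm_mult)
    moreover have "1 - (cmod (c t))\<^sup>2 \<noteq> 0" "1 - (cmod (c 1))\<^sup>2 \<noteq> 0"
      using c(1)[of t] c(1)[of 1] by (simp_all add: abs_square_eq_1)
    ultimately have "(cmod (c t - c 1))\<^sup>2 = (cmod (of_real \<tau> * v - of_real a * v))\<^sup>2"
      unfolding hyp_ratio_def c1 by simp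
    then have d: "(cmod (c t - of_real a * v))\<^sup>2 = (\<tau> - a)\<^sup>2"
      using v by (simp add: c1 left_diff_distrib[symmetric] norm_mult flip: of_real_diff)
    have t2: "(cmod (c t))\<^sup>2 = \<tau>\<^sup>2" using sq \<tau>_def by simp
    have v2: "(cmod v)\<^sup>2 = 1" using v by simp
    have "a * (cmod (c t - of_real \<tau> * v))\<^sup>2 = 0"
    proof -
      have e: "(cmod (c t - of_real r * v))\<^sup>2 = (cmod (c t))\<^sup>2 - 2 * r * (c t \<bullet> v) + r\<^sup>2 * (cmod v)\<^sup>2" for r
        unfolding cmod_power2 inner_complex_def by (simp add: power2_eq_square algebra_simps)
      have "2 * a * (c t \<bullet> v) = 2 * \<tau> * a"
        using d unfolding e[of a] t2 v2 by (auto simp: power2_eq_square algebra_simps)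
      then have "c t \<bullet> v = \<tau>" using a by (metis mult.assoc mult.commute mult_cancel_left less_irrefl zero_neq_numeral)
      then show ?thesis unfolding e[of \<tau>] t2 v2 by (simp add: power2_eq_square)
    qed
    then show "c t = of_real (tanh (t / 2)) * v" using a by (simp add: \<tau>_def)
  qed
  then show thesis using that v by blast
qed

lemma geodesic_lineE:
  assumes "geodesic_line c"
  obtains g v where "disk_moebius g" "cmod v = 1" "\<And>t. c t = g (of_real (tanh (t / 2)) * v)"
proof -
  have c: "\<And>t. cmod (c t) < 1" using assms unfolding geodesic_line_def by (auto simp: image_subset_iff)
  obtain g where g: "disk_moebius g" "g 0 = c 0" using disk_moebius_transitive[OF c] by metis
  obtain h where h: "disk_moebius h" "\<And>z. cmod z \<le> 1 \<Longrightarrow> h (g z) = z" "\<And>z. cmod z \<le> 1 \<Longrightarrow> g (h z) = z"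
    using disk_moebius_inverse[OF g(1)] by metis
  have "(h \<circ> c) 0 = 0" using h(2)[of 0] g(2) by simp
  then obtain v where v: "cmod v = 1" "\<And>t. (h \<circ> c) t = of_real (tanh (t / 2)) * v"
    using geodesic_line_through_0[OF geodesic_line_comp[OF h(1) assms]] by metis
  have "c t = g (of_real (tanh (t / 2)) * v)" for t
    using h(3)[of "c t"] c[of t] v(2)[of t] by simp
  then show thesis using that g(1) v(1) by blast
qed

lemma disk_moebius_tendsto:
  assumes "disk_moebius g" "(f \<longlongrightarrow> l) F" "cmod l \<le> 1" "eventually (\<lambda>x. cmod (f x) \<le> 1) F"
  shows "((\<lambda>x. g (f x)) \<longlongrightarrow> g l) F"
  using continuous_on_tendsto_compose[OF disk_moebius_cont[OF assms(1)] assms(2)] assms(3,4) by simp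

lemma ray_tendsto:
  assumes "disk_moebius g" "cmod v = 1"
  shows "((\<lambda>t. g (of_real (tanh (t / 2)) * v)) \<longlongrightarrow> g v) at_top"
    and "((\<lambda>t. g (of_real (tanh (t / 2)) * v)) \<longlongrightarrow> g (- v)) at_bot"
proof -
  have half: "filterlim (\<lambda>t::real. t / 2) at_top at_top" "filterlim (\<lambda>t::real. t / 2) at_bot at_bot"
    by real_asymp+
  have "((\<lambda>t. of_real (tanh (t / 2)) * v) \<longlongrightarrow> of_real 1 * v) at_top"
    by (intro tendsto_intros filterlim_compose[OF tanh_real_at_top half(1)])
  then show "((\<lambda>t. g (of_real (tanh (t / 2)) * v)) \<longlongrightarrow> g v) at_top"
    using assms(2) norm_tanh_unit[OF assms(2)]
    by (intro disk_moebius_tendsto[OF assms(1)]) (simp_all add: order_less_imp_le)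
  have "((\<lambda>t. of_real (tanh (t / 2)) * v) \<longlongrightarrow> of_real (- 1) * v) at_bot"
    by (intro tendsto_intros filterlim_compose[OF tanh_real_at_bot half(2)])
  then show "((\<lambda>t. g (of_real (tanh (t / 2)) * v)) \<longlongrightarrow> g (- v)) at_bot"
    using assms(2) norm_tanh_unit[OF assms(2)]
    by (intro disk_moebius_tendsto[OF assms(1)]) (simp_all add: order_less_imp_le)
qed

text \<open>The Moebius map sends the origin to the Poincare point over the midpoint of the chord.\<close>

lemma disk_moebius_chord:
  assumes "cmod p = 1" "cmod q = 1" "p \<noteq> q"
  obtains g v where "disk_moebius g" "cmod v = 1" "g v = q" "g (- v) = p"
proof -
  define s where "s = cmod (q - p) / 2"
  have s: "s > 0" using assms(3) by (simp add: s_def)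
  define S where "S = complex_of_real s"
  \<comment> \<open>This is \<open>klein_inv\<close> of the midpoint of the chord: the midpoint has
    squared norm 1 - s^2, so the square root there equals s.\<close>
  define z where "z = (p + q) / (2 * (1 + S))"
  define v where "v = (q - p) / (2 * S)"
  have pq: "p \<noteq> 0" "q \<noteq> 0" using assms by auto
  have S0: "S \<noteq> 0" "1 + S \<noteq> 0" using s unfolding S_def
    by (simp_all add: complex_eq_iff)
  have cS: "cnj S = S" by (simp add: S_def)
  have "4 * S\<^sup>2 = of_real ((cmod (q - p))\<^sup>2)" by (simp add: S_def s_def power_divide)
  also have "\<dots> = (q - p) * (1 / q - 1 / p)" unfolding complex_norm_square using assms by (simp add: cnj_unit)
  finally have S2: "4 * S\<^sup>2 * p * q = - ((p - q)\<^sup>2)" using pq by (simp add: field_simps power2_eq_square)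
  have v: "cmod v = 1" using s by (simp add: v_def S_def norm_divide norm_mult s_def)
  have "cmod (p + q) \<le> 2" using norm_triangle_ineq[of p q] assms by simp
  moreover have "cmod (2 * (1 + S)) = 2 * (1 + s)"
    using s unfolding S_def norm_mult by (metis abs_of_pos add_pos_pos norm_numeral norm_of_real of_real_1 of_real_add zero_less_one)
  ultimately have z: "cmod z < 1" using s by (simp add: z_def norm_divide)
  have cz: "cnj z = (p + q) / (2 * (1 + S) * p * q)"
    using pq assms S0 by (simp add: z_def cS cnj_unit field_simps)
  \<comment> \<open>Stated for variable endpoints with \<open>z\<close> and \<open>S\<close> fixed:
    exchanging p and q replaces \<open>v\<close> by \<open>- v\<close> and yields the other
    endpoint.\<close>
  have gen: "(q - p) / (2 * S) + z = q * (1 + cnj z * ((q - p) / (2 * S)))"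
    if S2: "4 * S\<^sup>2 * p * q = - ((p - q)\<^sup>2)" and pq: "p \<noteq> 0" "q \<noteq> 0"
    and z: "z = (p + q) / (2 * (1 + S))" "cnj z = (p + q) / (2 * (1 + S) * p * q)" for p q
  proof -
    have c1: "x / (2 * e) * (4 * S * e * p) = 2 * S * p * x" if "e \<noteq> 0" for x e :: complex
      using that by simp
    have c2: "q * (x / (2 * e * p * q) * (y / (2 * S))) * (4 * S * e * p) = x * y" if "e \<noteq> 0" for x y e :: complex
      using that pq S0(1) by simp
    have "((q - p) / (2 * S) + z) * (4 * S * (1 + S) * p) = 2 * (1 + S) * p * (q - p) + 2 * S * p * (p + q)"
    proof -
      have "(q - p) / (2 * S) * (4 * S * (1 + S) * p) = 2 * (1 + S) * p * (q - p)"
        using S0 by (simp add: divide_simps)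
      moreover have "z * (4 * S * (1 + S) * p) = 2 * S * p * (p + q)"
        unfolding z(1) using c1[OF S0(2)] .
      ultimately show ?thesis by (simp only: distrib_right)
    qed
    also have "\<dots> = 4 * S * (1 + S) * p * q + (q\<^sup>2 - p\<^sup>2)"
    proof -
      have "2 * (1 + S) * p * (q - p) + 2 * S * p * (p + q) - 4 * S * (1 + S) * p * q
         = 2 * p * q - 2 * p\<^sup>2 - 4 * S\<^sup>2 * p * q" by (simp add: power2_eq_square algebra_simps)
      also have "\<dots> = q\<^sup>2 - p\<^sup>2" unfolding S2 by (simp add: power2_eq_square algebra_simps)
      finally show ?thesis by (simp only: diff_eq_eq add.commute)
    qed
    also have "\<dots> = q * (1 + cnj z * ((q - p) / (2 * S))) * (4 * S * (1 + S) * p)"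
    proof -
      have "q * (cnj z * ((q - p) / (2 * S))) * (4 * S * (1 + S) * p) = (p + q) * (q - p)"
        unfolding z(2) using c2[OF S0(2)] .
      then show ?thesis by (simp add: power2_eq_square algebra_simps)
    qed
    finally show ?thesis using S0 pq by (simp only: mult_cancel_right) simp
  qed
  have gq: "v + z = q * (1 + cnj z * v)" unfolding v_def using gen[OF S2 pq z_def cz] .
  have gp: "- v + z = p * (1 + cnj z * (- v))"
  proof -
    have "(p - q) / (2 * S) + z = p * (1 + cnj z * ((p - q) / (2 * S)))"
    proof (rule gen[OF _ pq(2,1)])
      show "4 * S\<^sup>2 * q * p = - ((q - p)\<^sup>2)" using S2 by (simp add: power2_eq_square algebra_simps)
      show "z = (q + p) / (2 * (1 + S))" "cnj z = (q + p) / (2 * (1 + S) * q * p)"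
        using cz z_def by (simp_all add: ac_simps)
    qed
    moreover have "- v = (p - q) / (2 * S)" by (simp add: v_def minus_divide_left)
    ultimately show ?thesis by simp
  qed
  show thesis
  proof (rule that[OF _ v])
    show "disk_moebius (mob 1 z)" unfolding disk_moebius_def using z
      by (intro exI[of _ 1] exI[of _ z]) simp
    show "mob 1 z v = q" using gq mob_denom_nonzero[of z 1 v] z v by (simp add: mob_def add.commute)
    show "mob 1 z (- v) = p" using gp mob_denom_nonzero[of z 1 "- v"] z v
      by (simp add: mob_def add.commute)
  qed
qed

lemma klein_ray_in_chord:
  assumes "disk_moebius g" "cmod v = 1" "-1 < \<tau>" "\<tau> < 1"
  shows "klein (g (of_real \<tau> * v)) \<in> open_segment (g (- v)) (g v)"
proof -
  obtain \<alpha> \<beta> where ab: "cmod \<beta> < cmod \<alpha>" and g: "\<And>z. cmod z \<le> 1 \<Longrightarrow> g z = mob \<alpha> \<beta> z"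
    using assms(1) unfolding disk_moebius_def by auto
  define N where "N = (1 + \<tau>)\<^sup>2 * (cmod (cnj \<beta> * v + cnj \<alpha>))\<^sup>2"
  define M where "M = (1 - \<tau>)\<^sup>2 * (cmod (cnj \<beta> * (- v) + cnj \<alpha>))\<^sup>2"
  have "cnj \<beta> * v + cnj \<alpha> \<noteq> 0" "cnj \<beta> * (- v) + cnj \<alpha> \<noteq> 0"
    using mob_denom_nonzero[OF ab, of v] mob_denom_nonzero[OF ab, of "- v"] assms(2) by auto
  then have pos: "N > 0" "M > 0" using assms(3,4) unfolding N_def M_def by auto
  let ?k = "klein (mob \<alpha> \<beta> (of_real \<tau> * v))"
  have eq: "of_real (N + M) * ?k = of_real M * mob \<alpha> \<beta> (- v) + of_real N * mob \<alpha> \<beta> v"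
    using klein_mob_ray[OF ab assms(2-4)] unfolding N_def M_def .
  have nz: "complex_of_real (N + M) \<noteq> 0" using pos of_real_eq_0_iff by (metis add_pos_pos less_irrefl)
  define l where "l = N / (N + M)"
  have l: "0 < l" "l < 1" using pos by (auto simp: l_def)
  have "of_real (N + M) * (mob \<alpha> \<beta> (- v) + of_real l * (mob \<alpha> \<beta> v - mob \<alpha> \<beta> (- v))) =
     of_real (N + M) * mob \<alpha> \<beta> (- v) + of_real N * (mob \<alpha> \<beta> v - mob \<alpha> \<beta> (- v))"
    using nz by (simp add: l_def distrib_left del: of_real_add)
  also have "\<dots> = of_real (N + M) * ?k" unfolding eq by (simp add: algebra_simps)
  finally have k: "?k = mob \<alpha> \<beta> (- v) + of_real l * (mob \<alpha> \<beta> v - mob \<alpha> \<beta> (- v))"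
    using nz by (metis mult_cancel_left)
  have "v \<noteq> - v"
  proof
    assume "v = - v"
    then have "v = 0" by (simp add: complex_eq_iff)
    then show False using assms(2) by simp
  qed
  then have ne: "g (- v) \<noteq> g v" using inj_onD[OF disk_moebius_inj[OF assms(1)], of "- v" v] assms(2)
    by (metis dist_0_norm mem_cball norm_minus_cancel order_refl)
  have "cmod (of_real \<tau> * v) \<le> 1" using assms(2-4) by (simp add: norm_mult)
  then have "klein (g (of_real \<tau> * v)) = g (- v) + of_real l * (g v - g (- v))"
    using k g[of "of_real \<tau> * v"] g[of v] g[of "- v"] assms(2) by simp
  then show ?thesis unfolding open_segment_param[OF ne] using l by (intro exI[of _ l]) simp
qed

lemma klein_ray_onto_chord:
  assumes "disk_moebius g" "cmod v = 1" "x \<in> open_segment (g (- v)) (g v)"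
  obtains \<tau> where "-1 < \<tau>" "\<tau> < 1" "klein (g (of_real \<tau> * v)) = x"
proof -
  obtain \<alpha> \<beta> where ab: "cmod \<beta> < cmod \<alpha>" and g: "\<And>z. cmod z \<le> 1 \<Longrightarrow> g z = mob \<alpha> \<beta> z"
    using assms(1) unfolding disk_moebius_def by auto
  define N where "N = (cmod (cnj \<beta> * v + cnj \<alpha>))\<^sup>2"
  define M where "M = (cmod (cnj \<beta> * (- v) + cnj \<alpha>))\<^sup>2"
  have "cnj \<beta> * v + cnj \<alpha> \<noteq> 0" "cnj \<beta> * (- v) + cnj \<alpha> \<noteq> 0"
    using mob_denom_nonzero[OF ab, of v] mob_denom_nonzero[OF ab, of "- v"] assms(2) by auto
  then have pos: "N > 0" "M > 0" unfolding N_def M_def by auto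
  have "g (- v) \<noteq> g v" using assms(3) by auto
  then obtain l where l: "0 < l" "l < 1" "x = g (- v) + of_real l * (g v - g (- v))"
    using iffD1[OF open_segment_param assms(3)] by auto
  \<comment> \<open>The weights in \<open>klein_mob_ray\<close> have the ratio ((1 + \<tau>) / (1 -
    \<tau>))^2 * N / M, which must equal l / (1 - l); \<rho> is the resulting value of (1 + \<tau>)
    / (1 - \<tau>).\<close>
  define \<rho> where "\<rho> = sqrt (l * M / ((1 - l) * N))"
  have rho: "\<rho> > 0" "\<rho>\<^sup>2 * ((1 - l) * N) = l * M" using l pos by (auto simp: \<rho>_def)
  define \<tau> where "\<tau> = (\<rho> - 1) / (\<rho> + 1)"
  have \<tau>: "-1 < \<tau>" "\<tau> < 1" using rho by (auto simp: \<tau>_def field_simps)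
  have tp: "1 + \<tau> = \<rho> * (2 / (\<rho> + 1))" "1 - \<tau> = 2 / (\<rho> + 1)" using rho by (auto simp: \<tau>_def field_simps)
  let ?n = "(1 + \<tau>)\<^sup>2 * N" let ?m = "(1 - \<tau>)\<^sup>2 * M"
  have ln: "(1 - l) * ?n = l * ?m"
  proof -
    have "(1 - l) * ?n = (\<rho>\<^sup>2 * ((1 - l) * N)) * (2 / (\<rho> + 1))\<^sup>2" unfolding tp power_mult_distrib by simp
    then show ?thesis unfolding rho(2) tp by simp
  qed
  have nm: "?n + ?m > 0" using pos \<tau> by (simp add: add_pos_pos)
  have w: "n = l * (n + m) \<and> m = (1 - l) * (n + m)" if "(1 - l) * n = l * m" for n m :: real
    using that by (simp add: algebra_simps)
  have n: "complex_of_real ?n = of_real l * of_real (?n + ?m)"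
    using w[OF ln] by (metis of_real_mult)
  have m: "complex_of_real ?m = of_real (1 - l) * of_real (?n + ?m)"
    using w[OF ln] by (metis of_real_mult)
  have "of_real (?n + ?m) * klein (mob \<alpha> \<beta> (of_real \<tau> * v)) = of_real ?m * mob \<alpha> \<beta> (- v) + of_real ?n * mob \<alpha> \<beta> v"
    using klein_mob_ray[OF ab assms(2) \<tau>] unfolding N_def M_def .
  then have eq: "of_real (?n + ?m) * klein (mob \<alpha> \<beta> (of_real \<tau> * v)) =
     of_real (1 - l) * of_real (?n + ?m) * mob \<alpha> \<beta> (- v) + of_real l * of_real (?n + ?m) * mob \<alpha> \<beta> v"
    unfolding n[symmetric] m[symmetric] .
  have nz: "complex_of_real (?n + ?m) \<noteq> 0" using nm of_real_eq_0_iff by (metis less_irrefl)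
  have "k = (1 - r) * P + r * Q" if "e * k = (1 - r) * e * P + r * e * Q" "e \<noteq> 0" for e k r P Q :: complex
  proof -
    have "e * k = e * ((1 - r) * P + r * Q)" using that(1) by (simp add: algebra_simps)
    then show ?thesis using that(2) by simp
  qed
  from this[OF _ nz] eq have "klein (mob \<alpha> \<beta> (of_real \<tau> * v)) = of_real (1 - l) * mob \<alpha> \<beta> (- v) + of_real l * mob \<alpha> \<beta> v"
    unfolding of_real_diff[of 1 l] of_real_1 by blast
  also have "\<dots> = x" using l(3) g[of v] g[of "- v"] assms(2) by (simp add: algebra_simps)
  finally have "klein (g (of_real \<tau> * v)) = x" using g[of "of_real \<tau> * v"] assms(2) \<tau> by (simp add: norm_mult)
  then show thesis using that \<tau> by blast
qed

lemma tanh_onto: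
  assumes "-1 < \<tau>" "\<tau> < (1::real)"
  obtains t where "tanh (t / 2) = \<tau>"
proof
  have "exp (- (2 * artanh \<tau>)) = (1 - \<tau>) / (1 + \<tau>)"
    using assms unfolding artanh_def by (simp add: exp_minus field_simps)
  then have "tanh ((2 * artanh \<tau>) / 2) = (1 - (1 - \<tau>) / (1 + \<tau>)) / (1 + (1 - \<tau>) / (1 + \<tau>))"
    by (simp add: tanh_real_altdef)
  also have "\<dots> = \<tau>" using assms by (simp add: divide_simps)
  finally show "tanh ((2 * artanh \<tau>) / 2) = \<tau>" .
qed

text \<open>A geodesic line is the Moebius image of a diameter, so by uniqueness of limits its ends
  are the images of \<open>- v\<close> and \<open>v\<close>, and its Klein image lies on the chord.
  Conversely \<open>disk_moebius_chord\<close> supplies one line that passes through every point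
  over the chord.\<close>

lemma geodesic_eq_chord:
  assumes "cmod p = 1" "cmod q = 1" "p \<noteq> q"
  shows "geodesic p q = {z \<in> disk. klein z \<in> open_segment p q}"
proof (intro subset_antisym subsetI)
  fix z assume "z \<in> geodesic p q"
  then obtain c t where c: "geodesic_line c" "(c \<longlongrightarrow> p) at_bot" "(c \<longlongrightarrow> q) at_top" "z = c t"
    unfolding geodesic_def by blast
  obtain g v where g: "disk_moebius g" "cmod v = 1" "\<And>t. c t = g (of_real (tanh (t / 2)) * v)"
    using geodesic_lineE[OF c(1)] by metis
  have c': "c = (\<lambda>t. g (of_real (tanh (t / 2)) * v))" using g(3) by blast
  have "g v = q" using tendsto_unique[OF _ ray_tendsto(1)[OF g(1,2)] c(3)[unfolded c']] by simp
  moreover have "g (- v) = p" using tendsto_unique[OF _ ray_tendsto(2)[OF g(1,2)] c(2)[unfolded c']] by simp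
  moreover have "-1 < tanh (t / 2)" "tanh (t / 2) < 1" by (auto simp: tanh_real_gt_neg1 tanh_real_lt_1)
  ultimately have "klein z \<in> open_segment p q"
    using klein_ray_in_chord[OF g(1,2), of "tanh (t / 2)"] c(4) g(3) by simp
  moreover have "z \<in> disk" using c(1,4) unfolding geodesic_line_def by blast
  ultimately show "z \<in> {z \<in> disk. klein z \<in> open_segment p q}" by simp
next
  fix z assume "z \<in> {z \<in> disk. klein z \<in> open_segment p q}"
  then have z: "cmod z < 1" "klein z \<in> open_segment p q" by auto
  obtain g v where g: "disk_moebius g" "cmod v = 1" "g v = q" "g (- v) = p"
    using disk_moebius_chord[OF assms] by metis
  obtain \<tau> where \<tau>: "-1 < \<tau>" "\<tau> < 1" "klein (g (of_real \<tau> * v)) = klein z"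
    using klein_ray_onto_chord[OF g(1,2), of "klein z"] z(2) g(3,4) by metis
  have "cmod (of_real \<tau> * v) < 1" using \<tau> g(2) by (simp add: norm_mult)
  then have "g (of_real \<tau> * v) = z"
    using \<tau>(3) klein_inv_klein z(1) disk_moebius_norm(1)[OF g(1)] by metis
  moreover obtain t where "tanh (t / 2) = \<tau>" using tanh_onto[OF \<tau>(1,2)] by metis
  ultimately have "z = (\<lambda>t. g (of_real (tanh (t / 2)) * v)) t" by simp
  then show "z \<in> geodesic p q" unfolding geodesic_def
    using geodesic_line_ray[OF g(1,2)] ray_tendsto[OF g(1,2)] g(3,4) by blast
qed

lemma klein_image_geodesic:
  assumes "cmod p = 1" "cmod q = 1" "p \<noteq> q"
  shows "klein ` geodesic p q = open_segment p q"
proof (intro subset_antisym subsetI)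
  fix x assume x: "x \<in> open_segment p q"
  then have "cmod x < 1" using open_segment_unit_disk assms by blast
  then have "klein_inv x \<in> geodesic p q" "x = klein (klein_inv x)"
    using klein_klein_inv x unfolding geodesic_eq_chord[OF assms] by auto
  then show "x \<in> klein ` geodesic p q" by blast
qed (auto simp: geodesic_eq_chord[OF assms])

text \<open>The endpoints are recovered from the open segment, hence only as an unordered
  pair.\<close>

lemma geodesic_eq_imp:
  assumes "cmod p = 1" "cmod q = 1" "p \<noteq> q" "cmod r = 1" "cmod s = 1" "r \<noteq> s"
    and "geodesic p q = geodesic r s"
  shows "{p, q} = {r, s}"
proof -
  have "open_segment p q = open_segment r s"
    using klein_image_geodesic[OF assms(1-3)] klein_image_geodesic[OF assms(4-6)] assms(7) by metis
  then have "p = q \<and> r = s \<or> {p, q} = {r, s}" by (rule iffD1[OF open_segment_eq])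
  then show ?thesis using assms(3) by blast
qed

lemma geodesics_intersect_iff:
  assumes unit: "cmod p = 1" "cmod q = 1" "cmod r = 1" "cmod s = 1"
    and ne: "p \<noteq> q" "r \<noteq> s" "r \<noteq> p" "r \<noteq> q" "s \<noteq> p" "s \<noteq> q"
  shows "geodesic p q \<inter> geodesic r s \<noteq> {} \<longleftrightarrow> (0 < side p q r \<longleftrightarrow> \<not> 0 < side p q s)"
proof -
  have "geodesic p q \<inter> geodesic r s \<noteq> {} \<longleftrightarrow> open_segment p q \<inter> open_segment r s \<noteq> {}"
  proof
    assume "geodesic p q \<inter> geodesic r s \<noteq> {}"
    then show "open_segment p q \<inter> open_segment r s \<noteq> {}"
      using geodesic_eq_chord[OF unit(1,2) ne(1)] geodesic_eq_chord[OF unit(3,4) ne(2)] by auto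
  next
    assume "open_segment p q \<inter> open_segment r s \<noteq> {}"
    then obtain x where x: "x \<in> open_segment p q" "x \<in> open_segment r s" by blast
    then have "cmod x < 1" using open_segment_unit_disk unit by blast
    then show "geodesic p q \<inter> geodesic r s \<noteq> {}"
      using klein_klein_inv[of x] x geodesic_eq_chord[OF unit(1,2) ne(1)] geodesic_eq_chord[OF unit(3,4) ne(2)]
      by (auto intro!: exI[of _ "klein_inv x"])
  qed
  then show ?thesis using chords_cross_iff[OF unit ne] by simp
qed

lemma geodesic_subset_disk: "geodesic p q \<subseteq> disk"
  unfolding geodesic_def geodesic_line_def by auto

text \<open>One inclusion holds for every Moebius map; applied to the inverse map it gives the
  converse.\<close>

lemma disk_moebius_image_geodesic:
  assumes "disk_moebius g" "cmod p = 1" "cmod q = 1"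
  shows "g ` geodesic p q = geodesic (g p) (g q)"
proof -
  have sub: "f ` geodesic p' q' \<subseteq> geodesic (f p') (f q')"
    if f: "disk_moebius f" and u: "cmod p' = 1" "cmod q' = 1" for f p' q'
  proof
    fix y assume "y \<in> f ` geodesic p' q'"
    then obtain c t where c: "geodesic_line c" "(c \<longlongrightarrow> p') at_bot" "(c \<longlongrightarrow> q') at_top" "y = (f \<circ> c) t"
      unfolding geodesic_def by auto
    have n: "\<And>t. cmod (c t) \<le> 1" using c(1) unfolding geodesic_line_def by (auto simp: image_subset_iff less_imp_le)
    have "((f \<circ> c) \<longlongrightarrow> f p') at_bot" "((f \<circ> c) \<longlongrightarrow> f q') at_top"
      unfolding comp_def by (rule disk_moebius_tendsto[OF f]; use c(2,3) u n in simp)+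
    then show "y \<in> geodesic (f p') (f q')" unfolding geodesic_def
      using geodesic_line_comp[OF f c(1)] c(4) by blast
  qed
  obtain h where h: "disk_moebius h" "\<And>z. cmod z \<le> 1 \<Longrightarrow> h (g z) = z" "\<And>z. cmod z \<le> 1 \<Longrightarrow> g (h z) = z"
    using disk_moebius_inverse[OF assms(1)] by metis
  have "h ` geodesic (g p) (g q) \<subseteq> geodesic p q"
    using sub[OF h(1), of "g p" "g q"] disk_moebius_norm(2)[OF assms(1)] h(2) assms(2,3) by simp
  moreover have "g ` h ` geodesic (g p) (g q) = geodesic (g p) (g q)"
  proof -
    have "g ` h ` X = X" if "X \<subseteq> disk" for X
    proof -
      have "\<And>x. x \<in> X \<Longrightarrow> g (h x) = x" using that h(3) by (auto simp: less_imp_le subset_iff)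
      then show ?thesis by (auto simp: image_image)
    qed
    from this[OF geodesic_subset_disk] show ?thesis .
  qed
  ultimately show ?thesis using sub[OF assms] by (metis image_mono subset_antisym)
qed

section \<open>Ping-pong on the circle\<close>

fun idx :: "letter \<Rightarrow> nat" where
  "idx A = 0" | "idx Bbar = 1" | "idx B = 2" | "idx Abar = 3"

text \<open>Strict cyclic order of the arcs; false as soon as two of the letters coincide.\<close>

definition ccw :: "letter \<Rightarrow> letter \<Rightarrow> letter \<Rightarrow> bool" where
  "ccw x y z \<longleftrightarrow> idx x < idx y \<and> idx y < idx z \<or> idx y < idx z \<and> idx z < idx x \<or>
                idx z < idx x \<and> idx x < idx y"

lemma bar_bar [simp]: "bar (bar e) = e"
  by (cases e) auto

lemma bar_eq_iff [simp]: "bar e = bar f \<longleftrightarrow> e = f"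
  by (metis bar_bar)

lemma bar_neq [simp]: "bar e \<noteq> e" "e \<noteq> bar e"
  by (cases e; simp)+

lemma idx_inj: "idx e = idx f \<longleftrightarrow> e = f"
  by (cases e; cases f) auto

lemma third_letter: "\<exists>g. g \<noteq> e \<and> g \<noteq> f" for e f :: letter
  by (cases e; cases f) (metis letter.distinct)+

text \<open>On the circle the half-disk inequality compares the cosine of the angle measured from
  the middle of the arc with the cosine of half the opening, and cos decreases on [0, pi].\<close>

lemma boundary_half_disk:
  assumes "cmod x = 1" "\<alpha> < \<beta>" "\<beta> < \<alpha> + 2 * pi"
    and "cos ((\<beta> - \<alpha>) / 2) \<le> cis ((\<alpha> + \<beta>) / 2) \<bullet> x"
  shows "x \<in> cis ` {\<alpha>..\<beta>}"
proof -
  define h m where "h = (\<beta> - \<alpha>) / 2" and "m = (\<alpha> + \<beta>) / 2"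
  have h: "0 < h" "h < pi" using assms by (auto simp: h_def)
  define y where "y = x * cis (- m)"
  have ny: "cmod y = 1" using assms by (simp add: y_def norm_mult)
  then have "y \<noteq> 0" by auto
  then have y: "y = cis (Arg y)" using Arg_eq[of y] ny by (simp add: cis_conv_exp)
  have "cos (Arg y) = Re y" using y by (metis cis.sel(1))
  also have "\<dots> = cis m \<bullet> x" by (simp add: y_def inner_complex_def)
  finally have le: "cos h \<le> cos (Arg y)" using assms(4) by (simp add: h_def m_def)
  have "\<bar>Arg y\<bar> \<le> h"
  proof (rule ccontr)
    assume "\<not> \<bar>Arg y\<bar> \<le> h"
    then have "cos \<bar>Arg y\<bar> < cos h"
      using h Arg_bounded[of y] by (intro cos_monotone_0_pi) auto
    then show False using le by simp
  qed
  moreover have "x = cis (m + Arg y)"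
  proof -
    have "x = y * cis m" by (simp add: y_def cis_mult mult.assoc)
    then show ?thesis using y by (metis cis_mult add.commute)
  qed
  ultimately show ?thesis unfolding h_def m_def by (intro image_eqI[of _ _ "m + Arg y"]) (auto simp: m_def field_simps abs_le_iff)
qed

lemma tendsto_radial:
  assumes "disk_moebius g" "cmod x = 1"
  shows "((\<lambda>t. g (of_real t * x)) \<longlongrightarrow> g x) (at_left 1)"
proof -
  have "((\<lambda>t. of_real t * x) \<longlongrightarrow> of_real 1 * x) (at_left 1)" by (intro tendsto_intros)
  moreover have "eventually (\<lambda>t::real. cmod (of_real t * x) \<le> 1) (at_left 1)"
    using eventually_at_left_field[of "\<lambda>t::real. cmod (of_real t * x) \<le> 1" 1] assms(2)
    by (auto simp: norm_mult intro!: exI[of _ 0])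
  ultimately show ?thesis using disk_moebius_tendsto[OF assms(1), of "\<lambda>t. of_real t * x" "of_real 1 * x" "at_left 1"] assms(2)
    by simp
qed

lemma disk_moebius_eq_closed:
  assumes "disk_moebius f" "disk_moebius g" "\<And>z. cmod z < 1 \<Longrightarrow> f z = g z" "cmod z \<le> 1"
  shows "f z = g z"
proof (cases "cmod z = 1")
  case True
  have "eventually (\<lambda>t::real. f (of_real t * z) = g (of_real t * z)) (at_left 1)"
    unfolding eventually_at_left_field using assms(3) True
    by (auto simp: norm_mult intro!: exI[of _ 0])
  then have "((\<lambda>t. g (of_real t * z)) \<longlongrightarrow> f z) (at_left 1)"
    using tendsto_radial[OF assms(1) True] by (rule Lim_transform_eventually[rotated])
  then show ?thesis using tendsto_unique[OF _ _ tendsto_radial[OF assms(2) True]] by simp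
qed (use assms in auto)

text \<open>Half-disks consist of points of the open disk, so the boundary statement is a radial
  limit. Off the closed arc the defining inequality fails strictly and keeps failing at
  \<open>t * x\<close> for t near 1, while the target inequality survives the limit.\<close>

lemma half_disk_map_boundary:
  assumes g: "disk_moebius g"
    and map: "\<And>z. cmod z < 1 \<Longrightarrow> z \<notin> half_disk \<alpha> \<beta> \<Longrightarrow> g z \<in> half_disk \<alpha>' \<beta>'"
    and "\<alpha> < \<beta>" "\<beta> < \<alpha> + 2 * pi" "\<alpha>' < \<beta>'" "\<beta>' < \<alpha>' + 2 * pi"
    and x: "cmod x = 1" "x \<notin> cis ` {\<alpha>..\<beta>}"
  shows "g x \<in> cis ` {\<alpha>'..\<beta>'}"
proof (rule boundary_half_disk)
  show nx: "cmod (g x) = 1" using disk_moebius_norm(2)[OF g x(1)] .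
  define c where "c = cos ((\<beta> - \<alpha>) / 2)"
  define u where "u = cis ((\<alpha> + \<beta>) / 2) \<bullet> x"
  have "u < c" using boundary_half_disk[of x \<alpha> \<beta>] assms by (force simp: c_def u_def)
  have "((\<lambda>t. 2 * (t * u) - c * (1 + t\<^sup>2)) \<longlongrightarrow> 2 * (1 * u) - c * (1 + 1\<^sup>2)) (at_left (1::real))"
    by (intro tendsto_intros)
  then have ev1: "eventually (\<lambda>t. 2 * (t * u) - c * (1 + t\<^sup>2) < 0) (at_left (1::real))"
    using \<open>u < c\<close> by (intro order_tendstoD) auto
  have ev2: "eventually (\<lambda>t::real. 0 < t \<and> t < 1) (at_left 1)"
    unfolding eventually_at_left_field by (auto intro!: exI[of _ 0])
  have "eventually (\<lambda>t. g (of_real t * x) \<in> half_disk \<alpha>' \<beta>') (at_left (1::real))"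
    using ev1 ev2
  proof eventually_elim
    case (elim t)
    have "cis ((\<alpha> + \<beta>) / 2) \<bullet> (of_real t * x) = t * u"
      unfolding u_def by (metis inner_scaleR_right scaleR_conv_of_real)
    then have "of_real t * x \<notin> half_disk \<alpha> \<beta>"
      using elim x(1) by (simp add: half_disk_def norm_mult c_def)
    then show ?case using map elim x(1) by (simp add: norm_mult)
  qed
  then have ev: "eventually (\<lambda>t. cos ((\<beta>' - \<alpha>') / 2) * (1 + (cmod (g (of_real t * x)))\<^sup>2) \<le>
      2 * (cis ((\<alpha>' + \<beta>') / 2) \<bullet> g (of_real t * x))) (at_left (1::real))"
    by (rule eventually_mono) (simp add: half_disk_def)
  have "cos ((\<beta>' - \<alpha>') / 2) * (1 + (cmod (g x))\<^sup>2) \<le> 2 * (cis ((\<alpha>' + \<beta>') / 2) \<bullet> g x)"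
    by (rule tendsto_le[OF _ _ _ ev]) (auto intro!: tendsto_intros tendsto_radial[OF g x(1)])
  then show "cos ((\<beta>' - \<alpha>') / 2) \<le> cis ((\<alpha>' + \<beta>') / 2) \<bullet> g x" using nx by simp
qed (use assms in auto)

section \<open>Boundary fixed points and their multipliers\<close>

lemma moebius_fixed_denom_real:
  assumes "cmod \<beta> < cmod \<alpha>" "cmod p = 1" "mob \<alpha> \<beta> p = p"
  shows "cnj \<beta> * p + cnj \<alpha> \<in> \<real>"
proof -
  let ?D = "cnj \<beta> * p + cnj \<alpha>"
  have D: "?D \<noteq> 0" using mob_denom_nonzero assms by simp
  have "p * cnj ?D / ?D = p" using mob_unit[OF assms(2), of \<alpha> \<beta>] assms(3) by simp
  moreover have "p \<noteq> 0" using assms(2) by auto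
  ultimately have "cnj ?D = ?D" using D by (metis mult_cancel_left nonzero_divide_eq_eq)
  then show ?thesis by (simp only: Reals_cnj_iff)
qed

text \<open>The quotient (z - p) / (z - q) is multiplied by the ratio of the denominators at q and
  p. Both are real, which is just the fixed point equation on the circle.\<close>

lemma moebius_two_fixed_points:
  assumes g: "disk_moebius g" and p: "cmod p = 1" "g p = p" and q: "cmod q = 1" "g q = q" and "p \<noteq> q"
  obtains l :: real where "\<And>z. cmod z \<le> 1 \<Longrightarrow> z \<noteq> q \<Longrightarrow> g z \<noteq> q"
    "\<And>z. cmod z \<le> 1 \<Longrightarrow> z \<noteq> q \<Longrightarrow> (g z - p) / (g z - q) = of_real l * ((z - p) / (z - q))"
proof -
  obtain \<alpha> \<beta> where ab: "cmod \<beta> < cmod \<alpha>" and m: "\<And>z. cmod z \<le> 1 \<Longrightarrow> g z = mob \<alpha> \<beta> z"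
    using g unfolding disk_moebius_def by auto
  let ?D = "\<lambda>z. cnj \<beta> * z + cnj \<alpha>"
  have "?D p \<in> \<real>" "?D q \<in> \<real>" using moebius_fixed_denom_real[OF ab] p q m by (metis order_refl)+
  then have "?D q / ?D p \<in> \<real>" by (rule Reals_divide[rotated])
  then obtain l where l: "?D q / ?D p = of_real l" by (metis Reals_cases)
  have e: "complex_of_real ((cmod \<alpha>)\<^sup>2 - (cmod \<beta>)\<^sup>2) \<noteq> 0"
    using det_pos[OF ab] of_real_eq_0_iff by (metis less_irrefl)
  have inj: "g z \<noteq> q" if "cmod z \<le> 1" "z \<noteq> q" for z
    using inj_onD[OF disk_moebius_inj[OF g], of z q] that q by auto
  have "(g z - p) / (g z - q) = of_real l * ((z - p) / (z - q))" if z: "cmod z \<le> 1" "z \<noteq> q" for z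
  proof -
    have nz: "?D z \<noteq> 0" "?D p \<noteq> 0" "?D q \<noteq> 0" using mob_denom_nonzero[OF ab] z p q by auto
    have c: "(e * x / (Z * P)) / (e * y / (Z * Q)) = Q / P * (x / y)"
      if "e \<noteq> 0" "Z \<noteq> 0" "P \<noteq> 0" "Q \<noteq> 0" for e x y Z P Q :: complex
      using that by simp
    have "g z - p = of_real ((cmod \<alpha>)\<^sup>2 - (cmod \<beta>)\<^sup>2) * (z - p) / (?D z * ?D p)"
      using mob_diff[OF ab, of z p] m[of z] m[of p] z p by simp
    moreover have "g z - q = of_real ((cmod \<alpha>)\<^sup>2 - (cmod \<beta>)\<^sup>2) * (z - q) / (?D z * ?D q)"
      using mob_diff[OF ab, of z q] m[of z] m[of q] z q by simp
    ultimately show ?thesis using c[OF e nz] l by simp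
  qed
  then show thesis using that inj by blast
qed

section \<open>Boundary arcs and the action of words on the circle\<close>

context pants
begin

definition arc :: "letter \<Rightarrow> complex set" where
  "arc e = cis ` {lo e..hi e}"

lemma lo_hi: "lo e < hi e" "hi e < lo e + 2 * pi"
  using arcs by (cases e; simp)+

lemma arc_unit: "x \<in> arc e \<Longrightarrow> cmod x = 1"
  by (auto simp: arc_def)

lemma arc_angles:
  assumes "idx e < idx f" "s \<in> {lo e..hi e}" "t \<in> {lo f..hi f}"
  shows "s < t" "t < s + 2 * pi"
  using assms arcs by (cases e; cases f; auto)+

lemma side_arcs_aux:
  assumes "x \<in> arc e" "y \<in> arc f" "z \<in> arc g" "idx e < idx f" "idx f < idx g"
  shows "0 < side x y z"
proof -
  obtain r s t where *: "x = cis r" "y = cis s" "z = cis t" "r \<in> {lo e..hi e}" "s \<in> {lo f..hi f}" "t \<in> {lo g..hi g}"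
    using assms unfolding arc_def by auto
  show ?thesis unfolding *(1-3)
    using arc_angles(1)[OF assms(4) *(4,5)] arc_angles(1)[OF assms(5) *(5,6)]
      arc_angles(2)[OF less_trans[OF assms(4,5)] *(4,6)] by (rule side_cis_pos)
qed

lemma side_arcs_pos:
  assumes "x \<in> arc e" "y \<in> arc f" "z \<in> arc g" "ccw e f g"
  shows "0 < side x y z"
  using assms(4) unfolding ccw_def
  using side_arcs_aux[OF assms(1,2,3)] side_arcs_aux[OF assms(2,3,1)] side_arcs_aux[OF assms(3,1,2)]
    side_rotate[of x y z] side_rotate[of y z x] by auto

text \<open>Here geometry turns into combinatorics: for points in three different arcs the
  orientation depends on the letters only.\<close>

lemma side_arcs:
  assumes "x \<in> arc e" "y \<in> arc f" "z \<in> arc g" "e \<noteq> f" "f \<noteq> g" "e \<noteq> g"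
  shows "0 < side x y z \<longleftrightarrow> ccw e f g"
proof (cases "ccw e f g")
  case False
  have "idx e \<noteq> idx f" "idx f \<noteq> idx g" "idx e \<noteq> idx g" using assms by (simp_all add: idx_inj)
  then have "ccw e g f" using False unfolding ccw_def by linarith
  then have "0 < side x z y" using side_arcs_pos assms by blast
  then show ?thesis using False side_swap[of x y z] by simp
qed (use side_arcs_pos assms in blast)

text \<open>A common point x would give a degenerate triple x, x, z whose orientation had to agree
  with two opposite cyclic orders.\<close>

lemma arc_disjoint:
  assumes "x \<in> arc e" "x \<in> arc f" shows "e = f"
proof (rule ccontr)
  assume ne: "e \<noteq> f"
  obtain g where g: "g \<noteq> e" "g \<noteq> f" using third_letter by blast
  have z: "cis (lo g) \<in> arc g" using lo_hi[of g] by (auto simp: arc_def)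
  have "0 < side x x (cis (lo g)) \<longleftrightarrow> ccw e f g" "0 < side x x (cis (lo g)) \<longleftrightarrow> ccw f e g"
    using side_arcs[OF assms z] side_arcs[OF assms(2,1) z] ne g by auto
  moreover have "ccw e f g \<noteq> ccw f e g"
    using ne g by (cases e; cases f; cases g) (auto simp: ccw_def)
  ultimately show False by simp
qed

lemma letter_map_ext: "\<exists>g. disk_moebius g \<and> (\<forall>z. cmod z < 1 \<longrightarrow> letter_map a b e z = g z)"
proof -
  have inv: "\<exists>g. disk_moebius g \<and> (\<forall>z. cmod z < 1 \<longrightarrow> inv_into disk f z = g z)"
    if f: "hyperbolic_isometry f" for f
  proof -
    obtain g where g: "disk_moebius g" "\<And>z. cmod z < 1 \<Longrightarrow> f z = g z"
      using hyperbolic_isometry_disk_moebius[OF f] by metis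
    obtain h where h: "disk_moebius h" "\<And>z. cmod z \<le> 1 \<Longrightarrow> h (g z) = z" "\<And>z. cmod z \<le> 1 \<Longrightarrow> g (h z) = z"
      using disk_moebius_inverse[OF g(1)] by metis
    have "inv_into disk f z = h z" if z: "cmod z < 1" for z
    proof (rule inv_into_f_eq)
      show "inj_on f disk" using h(2) g(2) by (intro inj_on_inverseI[of _ h]) auto
      show "h z \<in> disk" using disk_moebius_norm(1)[OF h(1) z] by simp
      then show "f (h z) = z" using g(2) h(3) z by simp
    qed
    then show ?thesis using h(1) by blast
  qed
  have fwd: "\<exists>g. disk_moebius g \<and> (\<forall>z. cmod z < 1 \<longrightarrow> f z = g z)" if "hyperbolic_isometry f" for f
    using hyperbolic_isometry_disk_moebius[OF that] by metis
  show ?thesis using inv fwd a_hyperbolic b_hyperbolic by (cases e) auto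
qed

text \<open>The letter maps are meaningful on the open disk only; \<open>ext\<close> extends them to
  a Moebius map that can act on limit points.\<close>

definition ext :: "letter \<Rightarrow> complex \<Rightarrow> complex" where
  "ext e = (SOME g. disk_moebius g \<and> (\<forall>z. cmod z < 1 \<longrightarrow> letter_map a b e z = g z))"

lemma ext: "disk_moebius (ext e)" "cmod z < 1 \<Longrightarrow> letter_map a b e z = ext e z"
  using someI_ex[OF letter_map_ext[of e]] unfolding ext_def by blast+

lemma ext_disk: "cmod z < 1 \<Longrightarrow> cmod (ext e z) < 1"
  using disk_moebius_norm(1)[OF ext(1)] .

lemma isometry_bij:
  assumes "hyperbolic_isometry f" shows "inj_on f disk" "f ` disk = disk"
proof -
  obtain g where g: "disk_moebius g" "\<And>z. cmod z < 1 \<Longrightarrow> f z = g z"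
    using hyperbolic_isometry_disk_moebius[OF assms] by metis
  have "inj_on g disk" using disk_moebius_inj[OF g(1)] by (rule inj_on_subset) auto
  then show "inj_on f disk" using g(2) by (metis (no_types, lifting) dist_0_norm inj_on_cong mem_ball)
qed (use assms hyperbolic_isometry_def in auto)

lemma ext_bar:
  assumes "cmod z \<le> 1" shows "ext e (ext (bar e) z) = z"
proof -
  have "(ext e \<circ> ext (bar e)) z = (\<lambda>z. z) z"
  proof (rule disk_moebius_eq_closed[OF _ disk_moebius_id _ assms])
    show "disk_moebius (ext e \<circ> ext (bar e))" by (intro disk_moebius_comp ext)
    fix z :: complex assume z: "cmod z < 1"
    have inv: "f (inv_into disk f z) = z" "inv_into disk f (f z) = z" if "hyperbolic_isometry f" for f
      using f_inv_into_f[of z f disk] inv_into_f_f[of f disk z] isometry_bij[OF that] z by auto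
    have "(ext e \<circ> ext (bar e)) z = letter_map a b e (letter_map a b (bar e) z)"
      using z ext(2) ext_disk by simp
    also have "\<dots> = z" using inv a_hyperbolic b_hyperbolic by (cases e) auto
    finally show "(ext e \<circ> ext (bar e)) z = z" .
  qed
  then show ?thesis by simp
qed

text \<open>The side pairing says that a letter carries the complement of the half-disk of
  \<open>bar e\<close> into that of \<open>e\<close>; for inverse letters it is read backwards
  through bijectivity. Radial limits give the same for arcs.\<close>

lemma ping_pong:
  assumes "cmod x = 1" "x \<notin> arc (bar e)"
  shows "ext e x \<in> arc e"
proof -
  have fwd: "f z \<in> H" if f: "hyperbolic_isometry f" "f ` K = disk - interior H" "cmod z < 1" "z \<notin> K" "K \<subseteq> disk"
    for f K H z
  proof (rule ccontr)
    assume "f z \<notin> H"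
    then have "f z \<in> disk - interior H" using isometry_bij(2)[OF f(1)] f(3) interior_subset by force
    then have "f z \<in> f ` K" using f(2) by simp
    then show False using isometry_bij(1)[OF f(1)] f(3-5) by (auto dest!: inj_onD)
  qed
  have bwd: "inv_into disk f z \<in> K" if f: "hyperbolic_isometry f" "f ` K = disk - interior H" "cmod z < 1" "z \<notin> H" "K \<subseteq> disk"
    for f K H z
  proof -
    have "z \<in> f ` K" using f(2-4) interior_subset by auto
    then show ?thesis using isometry_bij(1)[OF f(1)] f(5) inv_into_f_f by fastforce
  qed
  have sub: "half_disk \<alpha> \<beta> \<subseteq> disk" for \<alpha> \<beta> by (auto simp: half_disk_def)
  have "letter_map a b e z \<in> half_disk (lo e) (hi e)"
    if "cmod z < 1" "z \<notin> half_disk (lo (bar e)) (hi (bar e))" for z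
    using that fwd[OF a_hyperbolic a_pairing _ _ sub] fwd[OF b_hyperbolic b_pairing _ _ sub]
      bwd[OF a_hyperbolic a_pairing _ _ sub] bwd[OF b_hyperbolic b_pairing _ _ sub]
    by (cases e) auto
  then have "ext e z \<in> half_disk (lo e) (hi e)"
    if "cmod z < 1" "z \<notin> half_disk (lo (bar e)) (hi (bar e))" for z
    using that ext(2)[of z e] by metis
  from half_disk_map_boundary[OF ext(1) this lo_hi lo_hi assms(1)] show ?thesis
    using assms(2) unfolding arc_def by blast
qed

definition wext :: "letter list \<Rightarrow> complex \<Rightarrow> complex" where
  "wext w = foldr (\<lambda>e g. ext e \<circ> g) w id"

lemma wext_simps [simp]: "wext [] = id" "wext (e # w) = ext e \<circ> wext w"
  by (simp_all add: wext_def)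

lemma wext_append: "wext (u @ v) = wext u \<circ> wext v"
  by (induction u) (auto simp: comp_assoc)

lemma wext_moebius: "disk_moebius (wext w)"
proof (induction w)
  case Nil
  then show ?case using disk_moebius_id by (simp add: id_def)
next
  case (Cons e w)
  then show ?case unfolding wext_simps by (rule disk_moebius_comp[OF ext(1)])
qed

lemma word_map_simps: "word_map a b [] = id" "word_map a b (e # w) = letter_map a b e \<circ> word_map a b w"
  by (simp_all add: word_map_def)

lemma word_map_wext: "cmod z < 1 \<Longrightarrow> word_map a b w z = wext w z"
proof (induction w)
  case (Cons e w)
  then show ?case using ext(2) disk_moebius_norm(1)[OF wext_moebius] by (simp add: word_map_simps)
qed (simp add: word_map_simps)

lemma wext_inverse: "cmod z \<le> 1 \<Longrightarrow> wext (rev (map bar w)) (wext w z) = z"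
proof (induction w)
  case (Cons e w)
  have "ext (bar e) (ext e (wext w z)) = wext w z"
    using ext_bar[of "wext w z" "bar e"] disk_moebius_norm(3)[OF wext_moebius Cons.prems] by simp
  then show ?case using Cons by (simp add: wext_append)
qed simp

definition reduced :: "letter list \<Rightarrow> bool" where
  "reduced w \<longleftrightarrow> (\<forall>i. Suc i < length w \<longrightarrow> w ! Suc i \<noteq> bar (w ! i))"

lemma reduced_Cons: "reduced (e # w) \<longleftrightarrow> reduced w \<and> (w \<noteq> [] \<longrightarrow> hd w \<noteq> bar e)"
proof -
  have "(\<forall>i. Suc i < length (e # w) \<longrightarrow> (e # w) ! Suc i \<noteq> bar ((e # w) ! i)) \<longleftrightarrow>
     (w \<noteq> [] \<longrightarrow> hd w \<noteq> bar e) \<and> (\<forall>i. Suc i < length w \<longrightarrow> w ! Suc i \<noteq> bar (w ! i))"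
    (is "?l \<longleftrightarrow> ?r")
  proof
    assume l: ?l
    show ?r using l[rule_format, of 0] l[rule_format, of "Suc _"] by (auto simp: hd_conv_nth)
  next
    assume r: ?r
    show ?l
    proof (intro allI impI)
      fix i assume "Suc i < length (e # w)"
      then show "(e # w) ! Suc i \<noteq> bar ((e # w) ! i)" using r by (cases i) (auto simp: hd_conv_nth)
    qed
  qed
  then show ?thesis unfolding reduced_def by blast
qed

text \<open>Letters act from the last to the first. Each image lies in the arc of the letter just
  applied, and reducedness keeps that arc away from the one forbidden to the next letter.\<close>

lemma word_ping_pong:
  assumes "reduced w" "w \<noteq> []" "cmod x = 1" "x \<notin> arc (bar (last w))"
  shows "wext w x \<in> arc (hd w)"
  using assms(1,2,4)
proof (induction w)
  case (Cons e w)
  show ?case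
  proof (cases "w = []")
    case True
    then show ?thesis using Cons.prems ping_pong[OF assms(3)] by simp
  next
    case False
    then have "wext w x \<in> arc (hd w)" "hd w \<noteq> bar e" using Cons by (auto simp: reduced_Cons)
    then have "wext w x \<notin> arc (bar e)" using arc_disjoint by blast
    then show ?thesis using ping_pong arc_unit[OF \<open>wext w x \<in> arc (hd w)\<close>] by simp
  qed
qed simp

end

section \<open>Limit points of periodic words\<close>

context pants
begin

text \<open>Periodicity is included since limit points are obtained as attracting fixed points of
  the map of one period; the rays of closed geodesics are all of this kind.\<close>

definition per_red :: "(nat \<Rightarrow> letter) \<Rightarrow> bool" where
  "per_red f \<longleftrightarrow> (\<exists>T>0. \<forall>m. f (m + T) = f m) \<and> (\<forall>m. f (Suc m) \<noteq> bar (f m))"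

lemma arc_nontrivial: "\<exists>x\<in>arc e. x \<noteq> p"
proof -
  have "cis (lo e) \<noteq> cis (hi e)"
  proof
    assume "cis (lo e) = cis (hi e)"
    then have "side (cis (lo e)) (cis ((lo e + hi e) / 2)) (cis (hi e)) = 0" by (simp add: side_def)
    moreover have "0 < side (cis (lo e)) (cis ((lo e + hi e) / 2)) (cis (hi e))"
      using lo_hi[of e] by (intro side_cis_pos) auto
    ultimately show False by simp
  qed
  moreover have "cis (lo e) \<in> arc e" "cis (hi e) \<in> arc e" using lo_hi[of e] by (auto simp: arc_def)
  ultimately show ?thesis by metis
qed

lemma arc_compact: "compact (arc e)"
  unfolding arc_def by (intro compact_continuous_image continuous_intros) auto

lemma arc_homeomorphic: "{lo e..hi e} homeomorphic arc e"
proof -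
  have "inj_on cis {lo e..hi e}"
  proof (rule linorder_inj_onI)
    fix s t assume *: "s < t" "s \<in> {lo e..hi e}" "t \<in> {lo e..hi e}"
    then have "0 < side (cis s) (cis ((s + t) / 2)) (cis t)"
      using lo_hi[of e] by (intro side_cis_pos) auto
    moreover have "side (cis t) z (cis t) = 0" for z by (simp add: side_def)
    ultimately show "cis s \<noteq> cis t" by (metis less_irrefl)
  qed auto
  then show ?thesis unfolding arc_def
    using continuous_on_cis[OF continuous_on_id] by (intro homeomorphic_compact) auto
qed

text \<open>Brouwer's theorem on an interval, transported to the arc, produces fixed points from
  ping-pong alone.\<close>

lemma arc_fixed_point:
  assumes "disk_moebius g" "\<And>x. x \<in> arc e \<Longrightarrow> g x \<in> arc e"
  obtains p where "p \<in> arc e" "g p = p"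
proof -
  have "\<forall>f. continuous_on {lo e..hi e} f \<and> f \<in> {lo e..hi e} \<rightarrow> {lo e..hi e} \<longrightarrow> (\<exists>x\<in>{lo e..hi e}. f x = x)"
  proof (intro allI impI)
    fix f assume f: "continuous_on {lo e..hi e} f \<and> f \<in> {lo e..hi e} \<rightarrow> {lo e..hi e}"
    obtain x where "x \<in> {lo e..hi e}" "f x = x"
      by (rule brouwer[of "{lo e..hi e}" f]) (use f lo_hi[of e] in auto)
    then show "\<exists>x\<in>{lo e..hi e}. f x = x" by blast
  qed
  then have "\<forall>f. continuous_on (arc e) f \<and> f \<in> arc e \<rightarrow> arc e \<longrightarrow> (\<exists>x\<in>arc e. f x = x)"
    using homeomorphic_fixpoint_property[OF arc_homeomorphic] by blast
  moreover have "continuous_on (arc e) g"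
    using disk_moebius_cont[OF assms(1)] by (rule continuous_on_subset) (auto simp: arc_unit)
  ultimately show thesis using assms(2) that by blast
qed

lemma reduced_prefix: "per_red f \<Longrightarrow> reduced (map f [0..<m])"
  unfolding reduced_def per_red_def by auto

lemma per_red_shift: "per_red f \<Longrightarrow> per_red (\<lambda>m. f (Suc m))"
  unfolding per_red_def by (metis add_Suc)

lemma reduced_inverse:
  assumes "reduced w" shows "reduced (rev (map bar w))"
  unfolding reduced_def
proof (intro allI impI)
  fix i assume "Suc i < length (rev (map bar w))"
  then have i: "Suc i < length w" by simp
  define k where "k = length w - Suc (Suc i)"
  have k: "Suc k < length w" "length w - Suc i = Suc k" using i by (auto simp: k_def)
  have "w ! Suc k \<noteq> bar (w ! k)" using assms k(1) by (auto simp: reduced_def)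
  then show "rev (map bar w) ! Suc i \<noteq> bar (rev (map bar w) ! i)"
    using i k by (auto simp: rev_nth k_def[symmetric] Suc_diff_Suc)
qed

text \<open>A Moebius map with fixed points \<open>p\<close>, \<open>q\<close> acts on \<open>(z - p) / (z - q)\<close> by a real multiplier;
  the ping-pong dynamics forces the multiplier at the fixed point in \<open>arc (f 0)\<close> to be contracting.\<close>

lemma period_map_contracts:
  assumes f: "per_red f" and T: "T > 0" "\<And>m. f (m + T) = f m"
  obtains p q :: complex and l :: real where "p \<in> arc (f 0)" "cmod q = 1" "\<bar>l\<bar> < 1"
    "\<And>z. cmod z < 1 \<Longrightarrow>
      (wext (map f [0..<T]) z - p) / (wext (map f [0..<T]) z - q) = of_real l * ((z - p) / (z - q))"
proof -
  define w where "w = map f [0..<T]"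
  define g where "g = wext w"
  define e where "e = f (T - 1)"
  have w: "w \<noteq> []" "hd w = f 0" "last w = e" "reduced w"
    using T(1) reduced_prefix[OF f] by (auto simp: w_def e_def hd_map last_map)
  have gm: "disk_moebius g" unfolding g_def by (rule wext_moebius)
  have fe: "f 0 \<noteq> bar e" using f T(2)[of 0] T(1) unfolding per_red_def e_def
    by (metis Suc_pred' add_0)
  have pp: "g x \<in> arc (f 0)" if "cmod x = 1" "x \<notin> arc (bar e)" for x
    using word_ping_pong[OF w(4,1) that(1)] that(2) w(2,3) g_def by simp
  have "g x \<in> arc (f 0)" if "x \<in> arc (f 0)" for x
    using pp arc_unit[OF that] arc_disjoint[OF that, of "bar e"] fe by blast
  then obtain p where p: "p \<in> arc (f 0)" "g p = p" using arc_fixed_point[OF gm] by metis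
  \<comment> \<open>The inverse word maps the arc of \<open>bar e\<close> into itself and so
    supplies the second fixed point of \<open>g\<close>.\<close>
  define w' where "w' = rev (map bar w)"
  have w': "w' \<noteq> []" "hd w' = bar e" "last w' = bar (f 0)" "reduced w'"
    using w reduced_inverse by (auto simp: w'_def hd_rev last_map last_rev hd_map)
  have "wext w' x \<in> arc (bar e)" if "x \<in> arc (bar e)" for x
  proof -
    have "x \<notin> arc (bar (last w'))" using w'(3) fe arc_disjoint[OF that, of "f 0"] by auto
    then show ?thesis using word_ping_pong[OF w'(4,1) arc_unit[OF that]] w'(2) by simp
  qed
  then obtain q where q: "q \<in> arc (bar e)" "wext w' q = q"
    using arc_fixed_point[OF wext_moebius] by metis
  have "wext (rev (map bar w')) (wext w' q) = q" using wext_inverse arc_unit[OF q(1)] by simp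
  moreover have "rev (map bar w') = w" by (simp add: w'_def rev_map comp_def)
  ultimately have gq: "g q = q" using q(2) g_def by simp
  have pu: "cmod p = 1" "cmod q = 1" using p(1) q(1) arc_unit by auto
  have "p \<noteq> q" using p(1) q(1) arc_disjoint fe by blast
  obtain l where l: "\<And>z. cmod z \<le> 1 \<Longrightarrow> z \<noteq> q \<Longrightarrow> g z \<noteq> q"
    "\<And>z. cmod z \<le> 1 \<Longrightarrow> z \<noteq> q \<Longrightarrow> (g z - p) / (g z - q) = of_real l * ((z - p) / (z - q))"
    using moebius_two_fixed_points[OF gm pu(1) p(2) pu(2) gq \<open>p \<noteq> q\<close>] by metis
  define \<phi> where "\<phi> z = (z - p) / (z - q)" for z
  have phi: "\<phi> (g z) = of_real l * \<phi> z" if "cmod z \<le> 1" "z \<noteq> q" for z using l(2)[OF that] by (simp add: \<phi>_def)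
  have qA: "q \<notin> arc (f 0)" using q(1) arc_disjoint fe by blast
  have "\<bar>l\<bar> < 1"
  proof (rule ccontr)
    assume "\<not> \<bar>l\<bar> < 1"
    then consider "\<bar>l\<bar> > 1" | "\<bar>l\<bar> = 1" by linarith
    then show False
    proof cases
      case 1
      \<comment> \<open>Iterating an expansion would make \<phi> unbounded on a compact arc that
        does not contain its pole q.\<close>
      obtain x where x: "x \<in> arc (f 0)" "x \<noteq> p" using arc_nontrivial by blast
      have it: "(g ^^ k) x \<in> arc (f 0) \<and> cmod (\<phi> ((g ^^ k) x)) = \<bar>l\<bar> ^ k * cmod (\<phi> x)" for k
      proof (induction k)
        case (Suc k)
        then have y: "(g ^^ k) x \<in> arc (f 0)" by blast
        then have "(g ^^ k) x \<noteq> q" using qA by metis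
        then have "\<phi> (g ((g ^^ k) x)) = of_real l * \<phi> ((g ^^ k) x)" using phi arc_unit[OF y] by simp
        moreover have "g ((g ^^ k) x) \<in> arc (f 0)"
          using pp arc_unit[OF y] arc_disjoint[OF y, of "bar e"] fe by blast
        ultimately show ?case using Suc by (simp add: norm_mult)
      qed (use x in simp)
      have "continuous_on (arc (f 0)) \<phi>" unfolding \<phi>_def using qA by (intro continuous_intros) auto
      then have "bounded (\<phi> ` arc (f 0))" using arc_compact compact_continuous_image compact_imp_bounded by blast
      then obtain C where C: "\<And>y. y \<in> arc (f 0) \<Longrightarrow> cmod (\<phi> y) \<le> C" by (auto simp: bounded_iff)
      have pos: "cmod (\<phi> x) > 0" using x qA by (auto simp: \<phi>_def)
      obtain k where "C / cmod (\<phi> x) < \<bar>l\<bar> ^ k" using real_arch_pow[OF 1] by blast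
      then have "C < \<bar>l\<bar> ^ k * cmod (\<phi> x)" using pos by (simp add: field_simps)
      then show False using it[of k] C by fastforce
    next
      case 2
      \<comment> \<open>If l is 1 or -1, applying \<open>g\<close> twice preserves \<phi> and hence
        fixes x; but a point in a third arc is carried into the arc of \<open>f 0\<close>.\<close>
      obtain h where h: "h \<noteq> f 0" "h \<noteq> bar e" using third_letter by blast
      obtain x where x: "x \<in> arc h" using arc_nontrivial by blast
      have xq: "x \<noteq> q" using x q(1) h(2) arc_disjoint by blast
      have xe: "x \<notin> arc (bar e)" using x h(2) arc_disjoint by blast
      have y: "g x \<in> arc (f 0)" using pp arc_unit[OF x] xe by blast
      then have z: "g (g x) \<in> arc (f 0)" using pp arc_unit[OF y] arc_disjoint[OF y, of "bar e"] fe by blast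
      have "\<phi> (g (g x)) = of_real l * (of_real l * \<phi> x)"
        using phi[of x] phi[of "g x"] l(1)[of x] arc_unit[OF x] arc_unit[OF y] xq by simp
      also have "\<dots> = \<phi> x" using 2 by (metis abs_mult_self_eq mult.assoc mult_1 of_real_1 of_real_mult)
      finally have eq: "\<phi> (g (g x)) = \<phi> x" .
      have "g (g x) \<noteq> q" using z qA by metis
      have "u = x" if "(u - p) / (u - q) = (x - p) / (x - q)" "u \<noteq> q" for u
      proof -
        have "(u - p) * (x - q) = (x - p) * (u - q)" using that xq by (simp add: frac_eq_eq)
        then have "(u - x) * (p - q) = 0" by (simp add: algebra_simps)
        then show ?thesis using \<open>p \<noteq> q\<close> by simp
      qed
      then have "g (g x) = x" using eq \<open>g (g x) \<noteq> q\<close> by (simp add: \<phi>_def)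
      then show False using z x h(1) arc_disjoint by metis
    qed
  qed
  moreover have "(g z - p) / (g z - q) = of_real l * ((z - p) / (z - q))" if "cmod z < 1" for z
    using l(2)[of z] that pu(2) by fastforce
  ultimately show thesis using that[OF p(1) pu(2)] unfolding g_def w_def by blast
qed

text \<open>Prepending one period multiplies \<phi> by l, so along each residue class modulo T the
  sequence approaches p geometrically; there are only T classes, whence the common constant
  \<open>C\<close>.\<close>

lemma limit_point_tendsto:
  assumes f: "per_red f"
  shows "(\<lambda>m. word_map a b (map f [0..<m]) 0) \<longlonglongrightarrow> limit_point a b f" "limit_point a b f \<in> arc (f 0)"
proof -
  obtain T where T: "T > 0" "\<And>m. f (m + T) = f m" using f unfolding per_red_def by blast
  obtain p q l where p: "p \<in> arc (f 0)" "cmod q = 1" "\<bar>l\<bar> < (1::real)"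
    and l: "\<And>z. cmod z < 1 \<Longrightarrow>
      (wext (map f [0..<T]) z - p) / (wext (map f [0..<T]) z - q) = of_real l * ((z - p) / (z - q))"
    using period_map_contracts[OF f T] by metis
  define y where "y m = wext (map f [0..<m]) 0" for m
  define \<phi> where "\<phi> z = (z - p) / (z - q)" for z
  have y1: "cmod (y m) < 1" for m using disk_moebius_norm(1)[OF wext_moebius] by (simp add: y_def)
  have yT: "y (m + T) = wext (map f [0..<T]) (y m)" for m
  proof -
    have "map f [0..<m + T] = map f [0..<T] @ map f [0..<m]"
      using T(2) by (intro nth_equalityI) (auto simp: nth_append add.commute, metis le_add_diff_inverse2 not_less)
    then show ?thesis by (simp add: y_def wext_append)
  qed
  have step: "\<phi> (y (m + T)) = of_real l * \<phi> (y m)" for m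
    using l[OF y1] unfolding yT \<phi>_def by blast
  define C where "C = (\<Sum>r<T. cmod (\<phi> (y r)))"
  have C0: "C \<ge> 0" unfolding C_def by (intro sum_nonneg) simp
  have bound: "cmod (\<phi> (y m)) \<le> C * \<bar>l\<bar> ^ (m div T)" for m
  proof (induction m rule: less_induct)
    case (less m)
    show ?case
    proof (cases "m < T")
      case True
      then have "cmod (\<phi> (y m)) \<le> C" unfolding C_def by (intro member_le_sum) auto
      then show ?thesis using True by simp
    next
      case False
      then have m: "m = (m - T) + T" "m - T < m" using T(1) by auto
      have "cmod (\<phi> (y m)) = \<bar>l\<bar> * cmod (\<phi> (y (m - T)))" using step[of "m - T"] m(1) by (simp add: norm_mult)
      also have "\<dots> \<le> \<bar>l\<bar> * (C * \<bar>l\<bar> ^ ((m - T) div T))" using less m(2) by (intro mult_left_mono) auto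
      also have "\<dots> = C * \<bar>l\<bar> ^ (m div T)" using le_div_geq[of T m] False T(1) by simp
      finally show ?thesis .
    qed
  qed
  \<comment> \<open>The distance to q is at most 2 in the disk, so a small value of \<phi> means
    closeness to p.\<close>
  have dist: "cmod (y m - p) \<le> 2 * (C * \<bar>l\<bar> ^ (m div T))" for m
  proof -
    have "y m \<noteq> q" using y1[of m] p(2) by auto
    then have "y m - p = \<phi> (y m) * (y m - q)" by (simp add: \<phi>_def)
    then have "cmod (y m - p) = cmod (\<phi> (y m)) * cmod (y m - q)" by (metis norm_mult)
    also have "\<dots> \<le> (C * \<bar>l\<bar> ^ (m div T)) * 2"
      using bound[of m] norm_triangle_ineq4[of "y m" q] y1[of m] p(2) C0 by (intro mult_mono) auto
    finally show ?thesis by simp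
  qed
  have "filterlim (\<lambda>m. m div T) at_top at_top"
    unfolding filterlim_at_top
  proof
    fix N
    show "eventually (\<lambda>m. N \<le> m div T) sequentially"
      using T(1) by (intro eventually_sequentiallyI[of "N * T"]) (simp add: less_eq_div_iff_mult_less_eq)
  qed
  then have "(\<lambda>m. 2 * (C * \<bar>l\<bar> ^ (m div T))) \<longlonglongrightarrow> 2 * (C * 0)"
    using p(3) by (intro tendsto_intros filterlim_compose[OF LIMSEQ_power_zero]) auto
  then have "(\<lambda>m. y m - p) \<longlonglongrightarrow> 0"
    by (intro Lim_null_comparison[of "\<lambda>m. y m - p" "\<lambda>m. 2 * (C * \<bar>l\<bar> ^ (m div T))"]) (simp_all add: dist)
  then have "y \<longlonglongrightarrow> p" by (simp add: LIM_zero_iff)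
  moreover have "y = (\<lambda>m. word_map a b (map f [0..<m]) 0)" using word_map_wext[of 0] by (auto simp: y_def)
  ultimately have lim: "(\<lambda>m. word_map a b (map f [0..<m]) 0) \<longlonglongrightarrow> p" by simp
  then have "limit_point a b f = p" unfolding limit_point_def by (rule limI)
  then show "(\<lambda>m. word_map a b (map f [0..<m]) 0) \<longlonglongrightarrow> limit_point a b f" "limit_point a b f \<in> arc (f 0)"
    using lim p(1) by auto
qed

lemma limit_point_unit: "per_red f \<Longrightarrow> cmod (limit_point a b f) = 1"
  using limit_point_tendsto(2) arc_unit by blast

lemma limit_point_shift:
  assumes f: "per_red f"
  shows "limit_point a b f = ext (f 0) (limit_point a b (\<lambda>m. f (Suc m)))"
proof -
  let ?g = "\<lambda>m. f (Suc m)"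
  have n: "cmod (word_map a b (map ?g [0..<m]) 0) < 1" for m
    using word_map_wext[of 0] disk_moebius_norm(1)[OF wext_moebius, of 0] by simp
  have "map f [0..<Suc m] = f 0 # map ?g [0..<m]" for m
    by (simp add: upt_conv_Cons map_Suc_upt[symmetric] del: upt_Suc)
  then have "word_map a b (map f [0..<Suc m]) 0 = ext (f 0) (word_map a b (map ?g [0..<m]) 0)" for m
    using ext(2) n by (simp add: word_map_simps del: upt_Suc)
  moreover have "(\<lambda>m. ext (f 0) (word_map a b (map ?g [0..<m]) 0)) \<longlonglongrightarrow> ext (f 0) (limit_point a b ?g)"
    using limit_point_tendsto(1)[OF per_red_shift[OF f]] limit_point_unit[OF per_red_shift[OF f]] n
    by (intro disk_moebius_tendsto[OF ext(1)]) (auto simp: less_imp_le)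
  ultimately have "(\<lambda>m. word_map a b (map f [0..<Suc m]) 0) \<longlonglongrightarrow> ext (f 0) (limit_point a b ?g)" by simp
  then have "(\<lambda>m. word_map a b (map f [0..<m]) 0) \<longlonglongrightarrow> ext (f 0) (limit_point a b ?g)"
    by (rule LIMSEQ_imp_Suc)
  then show ?thesis using limit_point_tendsto(1)[OF f] LIMSEQ_unique by blast
qed

lemma limit_point_shift_bar:
  assumes f: "per_red f"
  shows "ext (bar (f 0)) (limit_point a b f) = limit_point a b (\<lambda>m. f (Suc m))"
  using limit_point_shift[OF f] ext_bar[of "limit_point a b (\<lambda>m. f (Suc m))" "bar (f 0)"]
    limit_point_unit[OF per_red_shift[OF f]] by simp

text \<open>The arc containing the limit point reveals the first letter, and the inverse of that
  letter shifts the word by one.\<close>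

lemma limit_point_inj:
  assumes "per_red f" "per_red g" "limit_point a b f = limit_point a b g"
  shows "f = g"
proof
  fix m show "f m = g m" using assms
  proof (induction m arbitrary: f g)
    case 0
    then show ?case using limit_point_tendsto(2) arc_disjoint by metis
  next
    case (Suc m)
    have 0: "f 0 = g 0" using Suc.prems limit_point_tendsto(2) arc_disjoint by metis
    then have "limit_point a b (\<lambda>m. f (Suc m)) = limit_point a b (\<lambda>m. g (Suc m))"
      using limit_point_shift_bar Suc.prems by metis
    then show ?case using Suc.IH[of "\<lambda>m. f (Suc m)" "\<lambda>m. g (Suc m)"] per_red_shift Suc.prems by simp
  qed
qed

text \<open>Undoing the common letters one at a time preserves orientation. After T steps the two
  rays start with different letters, while x has moved into the arc of the inverse of the last
  common letter.\<close>

lemma side_limit_points_overlap: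
  assumes "per_red f" "per_red g" "cmod x = 1" "x \<notin> arc (f 0)"
    and "\<And>t. t < T \<Longrightarrow> f t = g t" "f T \<noteq> g T" "T > 0"
  shows "0 < side x (limit_point a b f) (limit_point a b g) \<longleftrightarrow> ccw (bar (f (T - 1))) (f T) (g T)"
  using assms
proof (induction T arbitrary: f g x)
  case (Suc T)
  let ?f = "\<lambda>m. f (Suc m)" and ?g = "\<lambda>m. g (Suc m)"
  have sh: "per_red ?f" "per_red ?g" using per_red_shift Suc.prems by auto
  have fg: "f 0 = g 0" using Suc.prems(5)[of 0] by simp
  define y where "y = ext (bar (f 0)) x"
  have y: "y \<in> arc (bar (f 0))" unfolding y_def using ping_pong[of x "bar (f 0)"] Suc.prems by simp
  have "0 < side x (limit_point a b f) (limit_point a b g) \<longleftrightarrow> 0 < side y (limit_point a b ?f) (limit_point a b ?g)"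
    using side_disk_moebius_pos_iff[OF ext(1)[of "bar (f 0)"] Suc.prems(3) limit_point_unit[OF Suc.prems(1)] limit_point_unit[OF Suc.prems(2)]]
      limit_point_shift_bar[OF Suc.prems(1)] limit_point_shift_bar[OF Suc.prems(2)] fg by (simp add: y_def)
  also have "\<dots> \<longleftrightarrow> ccw (bar (f T)) (f (Suc T)) (g (Suc T))"
  proof (cases "T = 0")
    case True
    have "f (Suc 0) \<noteq> bar (f 0)" "g (Suc 0) \<noteq> bar (g 0)" using Suc.prems(1,2) unfolding per_red_def by auto
    then show ?thesis using side_arcs[OF y limit_point_tendsto(2)[OF sh(1)] limit_point_tendsto(2)[OF sh(2)]]
        Suc.prems(6) fg True by auto
  next
    case False
    have "?f 0 \<noteq> bar (f 0)" using Suc.prems(1) unfolding per_red_def by auto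
    then have "y \<notin> arc (?f 0)" using arc_disjoint[OF y] by metis
    then show ?thesis using Suc.IH[OF sh arc_unit[OF y]] Suc.prems(5,6) False by simp
  qed
  finally show ?case by simp
qed simp

end

section \<open>Lifts of a primitive closed geodesic\<close>

text \<open>The two-sided periodic word read along a primitive closed geodesic. The pair \<open>(i, True)\<close> is
  the position between the letters \<open>e (i - 1)\<close> and \<open>e i\<close>, read forwards, and \<open>(i, False)\<close> the same
  position read backwards.\<close>

locale prim_word =
  fixes e :: "int \<Rightarrow> letter" and L :: nat
  assumes L_pos: "L > 0"
    and periodic: "e (k + int L) = e k"
    and red: "e (k + 1) \<noteq> bar (e k)"
    and prim: "(\<And>k. e (k + d) = e k) \<Longrightarrow> int L dvd d"
begin

lemma periodic_mult: "e (k + int L * c) = e k"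
proof -
  have n: "e (k + int L * int m) = e k" for k m
  proof (induction m)
    case (Suc m)
    then show ?case using periodic[of "k + int L * int m"] by (simp add: algebra_simps)
  qed simp
  show ?thesis
  proof (cases "c \<ge> 0")
    case True
    then show ?thesis using n[of k "nat c"] by simp
  next
    case False
    then show ?thesis using n[of "k + int L * c" "nat (- c)"] by simp
  qed
qed

lemma e_mod: "e (k mod int L) = e k"
  using periodic_mult[of "k mod int L" "k div int L"] by (simp add: mod_mult_div_eq add.commute)

lemma e_mod_prev: "e (k mod int L - 1) = e (k - 1)"
  using e_mod[of "k mod int L - 1"] e_mod[of "k - 1"] by (simp add: mod_diff_left_eq)

lemma dvd_small: "int L dvd x \<Longrightarrow> \<bar>x\<bar> < int L \<Longrightarrow> x = 0"
  using zdvd_imp_le[of "int L" "\<bar>x\<bar>"] by fastforce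

lemma e_cong: "int L dvd (i - j) \<Longrightarrow> e (i + k) = e (j + k)"
  using periodic_mult[of "j + k"] by (auto elim!: dvdE simp: algebra_simps)

lemma red': "e k \<noteq> bar (e (k - 1))" "e k \<noteq> bar (e (k + 1))" "e (k - 1) \<noteq> bar (e k)"
proof -
  show 1: "e k \<noteq> bar (e (k - 1))" for k using red[of "k - 1"] by simp
  show "e k \<noteq> bar (e (k + 1))" using red[of k] by (metis bar_bar)
  show "e (k - 1) \<noteq> bar (e k)" using 1[of k] by (metis bar_bar)
qed

fun nxt :: "int \<times> bool \<Rightarrow> letter" where
  "nxt (i, True) = e i" | "nxt (i, False) = bar (e (i - 1))"

fun adv :: "int \<times> bool \<Rightarrow> int \<times> bool" where
  "adv (i, True) = (i + 1, True)" | "adv (i, False) = (i - 1, False)"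

fun flip :: "int \<times> bool \<Rightarrow> int \<times> bool" where
  "flip (i, d) = (i, \<not> d)"

text \<open>The letter passed just before the position, in its own reading direction;
  \<open>bar\<close> compensates for the reversal by \<open>flip\<close>.\<close>

definition prv :: "int \<times> bool \<Rightarrow> letter" where
  "prv x = bar (nxt (flip x))"

definition ray :: "int \<times> bool \<Rightarrow> nat \<Rightarrow> letter" where
  "ray x m = nxt ((adv ^^ m) x)"

lemma adv_pow: "(adv ^^ m) (i, True) = (i + int m, True)" "(adv ^^ m) (i, False) = (i - int m, False)"
  by (induction m) auto

lemma ray_simps: "ray (i, True) m = e (i + int m)" "ray (i, False) m = bar (e (i - 1 - int m))"
  by (simp_all add: ray_def adv_pow algebra_simps)

lemma ray_0: "ray x 0 = nxt x"
  by (simp add: ray_def)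

lemma ray_adv: "(\<lambda>m. ray x (Suc m)) = ray (adv x)"
  by (simp add: ray_def fun_eq_iff funpow_swap1)

lemma nxt_flip_adv: "nxt (flip (adv x)) = bar (nxt x)"
  by (cases x rule: adv.cases) auto

lemma adv_flip_adv: "adv (flip (adv x)) = flip x"
  by (cases x rule: adv.cases) auto

lemma flip_flip [simp]: "flip (flip x) = x"
  by (cases x) auto

lemma prv_flip: "prv (flip x) = bar (nxt x)"
  by (simp add: prv_def)

lemma nxt_adv_neq: "nxt (adv x) \<noteq> bar (nxt x)"
  using red[of "fst x"] red'(1)[of "fst x - 1"] red'(3)[of "fst x - 1"] by (cases x rule: adv.cases) auto

lemma all_ints_periodic:
  assumes "\<And>m::nat. Q (int m)" "\<And>m. Q (m mod int L) \<Longrightarrow> Q m" shows "Q m"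
proof -
  have "Q (m mod int L)" using assms(1)[of "nat (m mod int L)"] L_pos by simp
  then show ?thesis using assms(2) by blast
qed

text \<open>Rays of opposite directions cannot agree: the reflection of indices either fixes an
  index, where a letter would be its own inverse, or exchanges two neighbours, where the word would
  not be reduced. For equal directions the shift is a period and primitivity applies.\<close>

lemma ray_eq_imp:
  assumes "ray x = ray y" shows "snd x = snd y" "int L dvd (fst x - fst y)"
proof -
  obtain i c j d where xy: "x = (i, c)" "y = (j, d)" by (cases x; cases y)
  have em: "e (k + m mod int L) = e (k + m)" "e (k - m mod int L) = e (k - m)" for k m
    using e_mod[of "k + m mod int L"] e_mod[of "k + m"] e_mod[of "k - m mod int L"] e_mod[of "k - m"]
    by (simp_all add: mod_add_right_eq mod_diff_right_eq)
  have opp: False if "ray (i, True) = ray (j, False)" for i j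
  proof -
    have "e (i + int m) = bar (e (j - 1 - int m))" for m using fun_cong[OF that, of m] by (simp add: ray_simps)
    then have *: "e (i + m) = bar (e (j - 1 - m))" for m
      by (rule all_ints_periodic) (simp add: em)
    show False
    proof (cases "even (j - 1 - i)")
      case True
      then obtain k where "j - 1 - i = 2 * k" by (rule evenE)
      then have "j - 1 - k = i + k" by simp
      then show False using *[of k] by (metis bar_neq(2))
    next
      case False
      then obtain k where "j - 1 - i = 2 * k + 1" by (rule oddE)
      then have "j - 1 - k = i + k + 1" by simp
      then show False using *[of k] red'(2)[of "i + k"] by metis
    qed
  qed
  show sd: "snd x = snd y" using opp[of i j] opp[of j i] assms unfolding xy by (cases c; cases d) auto
  have "int L dvd (j - i)"
  proof (cases c)
    case True
    then have "e (i + int m) = e (j + int m)" for m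
      using fun_cong[OF assms, of m] sd by (simp add: xy ray_simps)
    then have *: "e (i + m) = e (j + m)" for m by (rule all_ints_periodic) (simp add: em)
    have "e (k + (j - i)) = e k" for k using *[of "k - i"] by (simp add: algebra_simps)
    then show ?thesis by (rule prim)
  next
    case False
    then have "e (i - 1 - int m) = e (j - 1 - int m)" for m
      using fun_cong[OF assms, of m] sd by (simp add: xy ray_simps)
    then have *: "e (i - 1 - m) = e (j - 1 - m)" for m by (rule all_ints_periodic) (simp add: em)
    have "e (k + (j - i)) = e k" for k using *[of "i - 1 - k"] by (simp add: algebra_simps)
    then show ?thesis by (rule prim)
  qed
  then show "int L dvd (fst x - fst y)" using xy by (simp add: dvd_diff_commute)
qed

end

locale pants_word = pants + prim_word
begin

lemma per_red_ray: "per_red (ray x)"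
proof -
  have "ray x (m + L) = ray x m" for m
    using periodic_mult[of "fst x + int m" 1] periodic_mult[of "fst x - 1 - int m" "-1"]
    by (cases x rule: adv.cases) (simp_all add: ray_simps algebra_simps)
  moreover have "ray x (Suc m) \<noteq> bar (ray x m)" for m
    using nxt_adv_neq[of "(adv ^^ m) x"] by (simp add: ray_def)
  ultimately show ?thesis unfolding per_red_def using L_pos by blast
qed

definition end_pt :: "int \<times> bool \<Rightarrow> complex" where
  "end_pt x = limit_point a b (ray x)"

definition line :: "int \<Rightarrow> complex set" where
  "line i = geodesic (end_pt (i, False)) (end_pt (i, True))"

lemma end_pt_unit: "cmod (end_pt x) = 1"
  using limit_point_unit[OF per_red_ray] by (simp add: end_pt_def)

lemma end_pt_arc: "end_pt x \<in> arc (nxt x)"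
  using limit_point_tendsto(2)[OF per_red_ray[of x]] by (simp add: end_pt_def ray_0)

lemma end_pt_arc': "end_pt (i, True) \<in> arc (e i)" "end_pt (i, False) \<in> arc (bar (e (i - 1)))"
  using end_pt_arc[of "(i, True)"] end_pt_arc[of "(i, False)"] by simp_all

lemma end_pt_adv: "ext (bar (nxt x)) (end_pt x) = end_pt (adv x)"
  using limit_point_shift_bar[OF per_red_ray[of x]] by (simp add: end_pt_def ray_0 ray_adv)

lemma end_pt_flip_adv: "ext (bar (nxt x)) (end_pt (flip x)) = end_pt (flip (adv x))"
  using limit_point_shift[OF per_red_ray[of "flip (adv x)"]]
  by (simp add: end_pt_def ray_0 ray_adv nxt_flip_adv adv_flip_adv)

lemma end_pt_eq_imp: "end_pt x = end_pt y \<Longrightarrow> snd x = snd y \<and> int L dvd (fst x - fst y)"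
  using limit_point_inj[OF per_red_ray per_red_ray] ray_eq_imp unfolding end_pt_def by blast

lemma end_pts_neq: "end_pt (i, False) \<noteq> end_pt (j, True)"
  using end_pt_eq_imp by force

lemma line_subset: "line i \<subseteq> disk"
  unfolding line_def by (rule geodesic_subset_disk)

text \<open>Translating by the inverse of the letter about to be read brings the next copy of the
  fundamental domain met by the lift back to the central one.\<close>

lemma line_adv: "ext (bar (nxt x)) ` line (fst x) = line (fst (adv x))"
proof (cases x rule: adv.cases)
  case (1 i)
  then show ?thesis unfolding line_def
    using disk_moebius_image_geodesic[OF ext(1) end_pt_unit end_pt_unit] end_pt_adv[of x] end_pt_flip_adv[of x] by simp
next
  case (2 i)
  then show ?thesis unfolding line_def
    using disk_moebius_image_geodesic[OF ext(1) end_pt_unit end_pt_unit] end_pt_adv[of x] end_pt_flip_adv[of x] by simp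
qed

lemma end_pt_mod: "int L dvd (i - j) \<Longrightarrow> end_pt (i, d) = end_pt (j, d)"
proof -
  assume *: "int L dvd (i - j)"
  have "ray (i, d) = ray (j, d)"
  proof
    fix m show "ray (i, d) m = ray (j, d) m"
      using e_cong[OF *, of "int m"] e_cong[OF *, of "- 1 - int m"] by (cases d) (simp_all add: ray_simps algebra_simps)
  qed
  then show ?thesis by (simp add: end_pt_def)
qed

text \<open>Equal point sets have equal unordered pairs of endpoints. A positive and a negative
  endpoint never coincide, so the orientations match and the coding is injective modulo the
  period.\<close>

lemma line_eq_iff: "line i = line j \<longleftrightarrow> int L dvd (i - j)"
proof
  assume "line i = line j"
  then have "{end_pt (i, False), end_pt (i, True)} = {end_pt (j, False), end_pt (j, True)}"
    unfolding line_def using geodesic_eq_imp end_pt_unit end_pts_neq by blast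
  then have "end_pt (i, True) = end_pt (j, True)" using end_pts_neq by (metis doubleton_eq_iff)
  then show "int L dvd (i - j)" using end_pt_eq_imp by fastforce
qed (simp add: line_def end_pt_mod)

lemma line_mod: "line (i mod int L) = line i"
  unfolding line_eq_iff by (simp add: mod_eq_dvd_iff[symmetric])

text \<open>Otherwise neither endpoint lies in the arc that ping-pong excludes, and both are sent
  into the arc of the first letter of \<open>v\<close>. But the two ends of \<open>line i'\<close>
  lie in different arcs, the periodic word being reduced.\<close>

lemma wext_line_last:
  assumes "reduced v" "v \<noteq> []" "wext v ` line i = line i'"
  shows "last v = bar (e i) \<or> last v = e (i - 1)"
proof (rule ccontr)
  assume no: "\<not> ?thesis"
  have "end_pt (i, d) \<notin> arc (bar (last v))" for d
    using no end_pt_arc[of "(i, d)"] arc_disjoint by (cases d) (auto, metis bar_bar, metis bar_bar)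
  then have in_arc: "wext v (end_pt (i, d)) \<in> arc (hd v)" for d
    using word_ping_pong[OF assms(1,2) end_pt_unit] by blast
  have "geodesic (wext v (end_pt (i, False))) (wext v (end_pt (i, True))) = line i'"
    using disk_moebius_image_geodesic[OF wext_moebius end_pt_unit end_pt_unit] assms(3) unfolding line_def by simp
  moreover have "wext v (end_pt (i, False)) \<noteq> wext v (end_pt (i, True))"
    using inj_onD[OF disk_moebius_inj[OF wext_moebius]] end_pts_neq end_pt_unit
    by (metis dist_0_norm mem_cball order_refl)
  ultimately have "{wext v (end_pt (i, False)), wext v (end_pt (i, True))} = {end_pt (i', False), end_pt (i', True)}"
    unfolding line_def using geodesic_eq_imp end_pt_unit end_pts_neq disk_moebius_norm(2)[OF wext_moebius] by blast
  then have "end_pt (i', False) \<in> arc (hd v)" "end_pt (i', True) \<in> arc (hd v)" using in_arc by (metis doubleton_eq_iff)+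
  then have "bar (e (i' - 1)) = e i'" using end_pt_arc' arc_disjoint by metis
  then show False using red' by metis
qed

section \<open>Equivalent pairs of lifts as walks on pairs of indices\<close>

lemma wext_reduce: "\<exists>v'. reduced v' \<and> (\<forall>z. cmod z \<le> 1 \<longrightarrow> wext v z = wext v' z)"
proof (induction v)
  case Nil
  show ?case by (intro exI[of _ "[]"]) (simp add: reduced_def)
next
  case (Cons c v)
  then obtain v' where v': "reduced v'" "\<And>z. cmod z \<le> 1 \<Longrightarrow> wext v z = wext v' z" by blast
  show ?case
  proof (cases "v' \<noteq> [] \<and> hd v' = bar c")
    case False
    then show ?thesis using v' by (intro exI[of _ "c # v'"]) (auto simp: reduced_Cons)
  next
    case True
    then obtain u where u: "v' = bar c # u" by (cases v') auto
    have "wext (c # v) z = wext u z" if "cmod z \<le> 1" for z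
      using v'(2)[OF that] u ext_bar[of "wext u z" c] disk_moebius_norm(3)[OF wext_moebius that] by simp
    then show ?thesis using v'(1) u by (intro exI[of _ u]) (auto simp: reduced_Cons)
  qed
qed

definition moves :: "letter \<Rightarrow> int \<Rightarrow> int \<Rightarrow> bool" where
  "moves c i i' \<longleftrightarrow> c = bar (e i) \<and> i' = i + 1 \<or> c = e (i - 1) \<and> i' = i - 1"

text \<open>One letter acts on both lifts at once; it may advance along one and go back along the
  other.\<close>

definition pair_step :: "((int \<times> int) \<times> (int \<times> int)) set" where
  "pair_step = {((i, j), (i', j')). \<exists>c. moves c i i' \<and> moves c j j'}"

lemma moves_line: "moves c i i' \<Longrightarrow> ext c ` line i = line i'"
  using line_adv[of "(i, True)"] line_adv[of "(i, False)"] by (auto simp: moves_def)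

text \<open>The last letter acts first. By \<open>wext_line_last\<close> it moves each of the two
  lifts one position along itself, and the rest of the word takes over.\<close>

lemma wext_pair_path:
  assumes "reduced v" "wext v ` line i = line i'" "wext v ` line j = line j'"
  shows "\<exists>i'' j''. ((i, j), (i'', j'')) \<in> pair_step\<^sup>* \<and> line i'' = line i' \<and> line j'' = line j'"
  using assms
proof (induction v arbitrary: i j rule: rev_induct)
  case Nil
  then show ?case by auto
next
  case (snoc c v)
  have red_v: "reduced v" using snoc.prems(1) unfolding reduced_def
    by (metis (no_types, lifting) Suc_lessD length_append_singleton less_SucI nth_append_left)
  obtain i1 where i1: "moves c i i1"
    using wext_line_last[OF snoc.prems(1) _ snoc.prems(2)] by (auto simp: moves_def)
  obtain j1 where j1: "moves c j j1"
    using wext_line_last[OF snoc.prems(1) _ snoc.prems(3)] by (auto simp: moves_def)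
  have "wext v ` line i1 = line i'" "wext v ` line j1 = line j'"
    using snoc.prems(2,3) unfolding moves_line[OF i1, symmetric] moves_line[OF j1, symmetric]
    by (simp_all add: wext_append image_image)
  then obtain i'' j'' where "((i1, j1), (i'', j'')) \<in> pair_step\<^sup>*" "line i'' = line i'" "line j'' = line j'"
    using snoc.IH[OF red_v] by blast
  moreover have "((i, j), (i1, j1)) \<in> pair_step" using i1 j1 by (auto simp: pair_step_def)
  ultimately show ?case by (meson converse_rtrancl_into_rtrancl)
qed

text \<open>The common part of the lifts at positions \<open>i\<close> and \<open>j\<close>, if any, starts there and is traversed by both forwards.\<close>

definition anchor :: "int \<Rightarrow> int \<Rightarrow> bool" where
  "anchor i j \<longleftrightarrow> e (i - 1) \<noteq> e (j - 1) \<and> (e i = e j \<or> e i \<noteq> bar (e (j - 1)) \<and> e j \<noteq> bar (e (i - 1)))"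

text \<open>On the common part no letter advances one lift while going back on the other
  (\<open>nomix\<close>), and going back beyond the anchor is blocked by the different preceding
  letters. So the walk stays on the common part.\<close>

lemma anchor_path:
  assumes an: "anchor i j" and path: "((i, j), (i', j')) \<in> pair_step\<^sup>*"
  shows "\<exists>t::nat. i' = i + int t \<and> j' = j + int t \<and> (\<forall>s<t. e (i + int s) = e (j + int s))"
  using path
proof (induction "(i', j')" arbitrary: i' j' rule: rtrancl_induct)
  case base
  then show ?case by (intro exI[of _ 0]) auto
next
  case (step y)
  obtain i1 j1 where y: "y = (i1, j1)" by (cases y)
  obtain t :: nat where t: "i1 = i + int t" "j1 = j + int t" "\<forall>s<t. e (i + int s) = e (j + int s)"
    using step(3)[OF y] by blast
  obtain c where c: "moves c i1 i'" "moves c j1 j'" using step(2) by (auto simp: pair_step_def y)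
  have last: "e (i1 - 1) = e (j1 - 1)" if "t > 0"
    using t(3)[rule_format, of "t - 1"] t(1,2) that by (simp add: of_nat_diff algebra_simps)
  have ij0: "i1 = i" "j1 = j" if "\<not> t > 0" using t that by auto
  have nomix: "\<not> (c = bar (e i1) \<and> c = e (j1 - 1))" "\<not> (c = e (i1 - 1) \<and> c = bar (e j1))"
  proof -
    show "\<not> (c = bar (e i1) \<and> c = e (j1 - 1))"
    proof (cases "t > 0")
      case True then show ?thesis using last red'(3)[of i1] by auto
    next
      case False then show ?thesis using ij0 an red'(3)[of j] unfolding anchor_def by (metis bar_bar)
    qed
    show "\<not> (c = e (i1 - 1) \<and> c = bar (e j1))"
    proof (cases "t > 0")
      case True then show ?thesis using last red'(3)[of j1] by auto
    next
      case False then show ?thesis using ij0 an red'(3)[of i] unfolding anchor_def by (metis bar_bar)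
    qed
  qed
  from c nomix consider "c = bar (e i1)" "i' = i1 + 1" "c = bar (e j1)" "j' = j1 + 1"
    | "c = e (i1 - 1)" "i' = i1 - 1" "c = e (j1 - 1)" "j' = j1 - 1"
    unfolding moves_def by blast
  then show ?case
  proof cases
    case 1
    then have "e (i + int t) = e (j + int t)" using t by auto
    then have "\<forall>s<Suc t. e (i + int s) = e (j + int s)" using t(3) less_Suc_eq by auto
    then show ?thesis using t 1 by (intro exI[of _ "Suc t"]) auto
  next
    case 2
    then have "t > 0" using ij0 an unfolding anchor_def by metis
    then show ?thesis using t 2 by (intro exI[of _ "t - 1"]) (auto simp: of_nat_diff)
  qed
qed

lemma anchor_path_unique:
  assumes "anchor i j" "((i, j), (i', j')) \<in> pair_step\<^sup>*" "e (i' - 1) \<noteq> e (j' - 1)"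
  shows "i' = i \<and> j' = j"
proof -
  obtain t where t: "i' = i + int t" "j' = j + int t" "\<forall>s<t. e (i + int s) = e (j + int s)"
    using anchor_path[OF assms(1,2)] by blast
  have "t = 0"
  proof (rule ccontr)
    assume "t \<noteq> 0"
    then show False using t(3)[rule_format, of "t - 1"] t(1,2) assms(3) by (simp add: of_nat_diff algebra_simps)
  qed
  then show ?thesis using t by simp
qed

text \<open>The negative end of the second lift is located by its arc, the positive one by stripping
  the common letters. Equal orientation of the two branchings puts them on opposite sides, because
  \<open>link\<close> lists the letters at the left end in swapped order.\<close>

lemma linked_intersect:
  assumes ne: "e (i - 1) \<noteq> e (j - 1)" and T: "T > 0" "\<And>t. t < T \<Longrightarrow> e (i + int t) = e (j + int t)"
      "e (i + int T) \<noteq> e (j + int T)"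
    and link: "ccw (e i) (bar (e (i - 1))) (bar (e (j - 1))) \<longleftrightarrow>
      ccw (bar (e (i + int T - 1))) (e (i + int T)) (e (j + int T))"
  shows "line i \<inter> line j \<noteq> {}"
proof -
  let ?p = "end_pt (i, False)" and ?q = "end_pt (i, True)" and ?r = "end_pt (j, False)" and ?s = "end_pt (j, True)"
  have eij: "e i = e j" using T(2)[of 0] T(1) by simp
  have "\<not> int L dvd (i - j)" using e_cong[of i j "-1"] ne by (metis add.commute diff_conv_add_uminus)
  then have qs: "?s \<noteq> ?q" "?r \<noteq> ?p" using end_pt_eq_imp by (metis dvd_diff_commute fst_conv)+
  have A: "?p \<in> arc (bar (e (i - 1)))" "?q \<in> arc (e i)" "?r \<in> arc (bar (e (j - 1)))"
    using end_pt_arc' by auto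
  have d: "bar (e (i - 1)) \<noteq> e i" "e i \<noteq> bar (e (j - 1))" "bar (e (i - 1)) \<noteq> bar (e (j - 1))"
    using red'(1)[of i] red'(1)[of j] eij ne by auto
  have 1: "0 < side ?p ?q ?r \<longleftrightarrow> ccw (bar (e (i - 1))) (e i) (bar (e (j - 1)))"
    using side_arcs[OF A d] .
  have sw: "ccw x y z \<longleftrightarrow> \<not> ccw y x z" if "x \<noteq> y" "y \<noteq> z" "x \<noteq> z" for x y z
    using that by (cases x; cases y; cases z) (auto simp: ccw_def)
  have "?p \<notin> arc (ray (i, True) 0)" using A(1) d(1) arc_disjoint by (auto simp: ray_0)
  then have 2: "0 < side ?p ?q ?s \<longleftrightarrow> ccw (bar (e (i + int T - 1))) (e (i + int T)) (e (j + int T))"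
    unfolding end_pt_def[of "(i, True)"] end_pt_def[of "(j, True)"]
    using side_limit_points_overlap[OF per_red_ray per_red_ray end_pt_unit, of "(i, False)" "(i, True)" T "(j, True)"] T
    by (simp add: ray_simps of_nat_diff algebra_simps)
  have "0 < side ?p ?q ?r \<longleftrightarrow> \<not> 0 < side ?p ?q ?s" using 1 2 link sw[OF d] by blast
  then show ?thesis unfolding line_def
    using geodesics_intersect_iff[OF end_pt_unit end_pt_unit end_pt_unit end_pt_unit] end_pts_neq qs by metis
qed

text \<open>By the hypotheses and reducedness the four endpoints lie in four different arcs, so the
  letters alone decide.\<close>

lemma crossing_letters_intersect_iff:
  assumes "e i \<noteq> e j" "e (i - 1) \<noteq> e (j - 1)" "e i \<noteq> bar (e (j - 1))" "e j \<noteq> bar (e (i - 1))"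
  shows "line i \<inter> line j \<noteq> {} \<longleftrightarrow>
    (ccw (bar (e (i - 1))) (e i) (bar (e (j - 1))) \<longleftrightarrow> \<not> ccw (bar (e (i - 1))) (e i) (e j))"
proof -
  let ?p = "end_pt (i, False)" and ?q = "end_pt (i, True)" and ?r = "end_pt (j, False)" and ?s = "end_pt (j, True)"
  have A: "?p \<in> arc (bar (e (i - 1)))" "?q \<in> arc (e i)" "?r \<in> arc (bar (e (j - 1)))" "?s \<in> arc (e j)"
    using end_pt_arc' by auto
  have d: "bar (e (i - 1)) \<noteq> e i" "e i \<noteq> bar (e (j - 1))" "bar (e (i - 1)) \<noteq> bar (e (j - 1))"
     "e i \<noteq> e j" "bar (e (i - 1)) \<noteq> e j"
    using red'(1)[of i] red'(1)[of j] assms by auto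
  have qs: "?s \<noteq> ?q" "?r \<noteq> ?p" using A d arc_disjoint by metis+
  show ?thesis unfolding line_def
    using geodesics_intersect_iff[OF end_pt_unit end_pt_unit end_pt_unit end_pt_unit, of "(i, False)" "(i, True)" "(j, False)" "(j, True)"]
      end_pts_neq qs side_arcs[OF A(1,2,3) d(1,2,3)] side_arcs[OF A(1,2,4) d(1,4,5)] by metis
qed

end

section \<open>Classes of crossings\<close>

context prim_word
begin

text \<open>Through the fundamental domain a lift runs from side \<open>a\<close> to side \<open>b\<close>, in either direction, at an upper turn, and between
  the sides \<open>\<bar>a\<close> and \<open>\<bar>b\<close> at a lower turn.\<close>

definition upper_turns :: "int set" where
  "upper_turns = {i \<in> {0..<int L}. (e (i - 1), e i) \<in> {(Abar, B), (Bbar, A)}}"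

definition lower_turns :: "int set" where
  "lower_turns = {i \<in> {0..<int L}. (e (i - 1), e i) \<in> {(A, Bbar), (B, Abar)}}"

end

locale pants_cyclic_word = pants_word a b lo hi "cyc_nth w" "length w"
  for a b lo hi w
begin

abbreviation "e \<equiv> cyc_nth w"
abbreviation "L \<equiv> length w"
abbreviation "IP \<equiv> intersecting_pairs a b w"
abbreviation "PE \<equiv> pair_equiv a b w"

lemma lift_eq_line: "lift a b w i = line (int i)"
  by (simp add: lift_def line_def end_pt_def ray_simps[abs_def] ray_def[abs_def] adv_pow algebra_simps)

lemma intersecting_pairsE:
  assumes "X \<in> IP"
  obtains i j where "X = {line i, line j}" "\<not> int L dvd (i - j)" "line i \<inter> line j \<noteq> {}"
proof -
  obtain i j where ij: "X = {line (int i), line (int j)}" "i < L" "j < L" "i \<noteq> j" "line (int i) \<inter> line (int j) \<noteq> {}"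
    using assms unfolding intersecting_pairs_def lift_eq_line by blast
  have "int i mod int L \<noteq> int j mod int L" using ij by simp
  then have "\<not> int L dvd (int i - int j)" by (simp add: mod_eq_dvd_iff)
  then show thesis using that ij by blast
qed

lemma intersecting_pairsI:
  assumes "\<not> int L dvd (i - j)" "line i \<inter> line j \<noteq> {}"
  shows "{line i, line j} \<in> IP"
proof -
  define i' j' where "i' = nat (i mod int L)" and "j' = nat (j mod int L)"
  have l: "i' < L" "j' < L" "int i' = i mod int L" "int j' = j mod int L"
    using L_pos by (auto simp: i'_def j'_def nat_less_iff)
  have "line (int i') = line i" "line (int j') = line j" using line_mod l by metis+
  moreover have "i' \<noteq> j'" using assms(1) l(3,4) by (metis mod_eq_dvd_iff)
  ultimately show ?thesis using l(1,2) assms(2) unfolding intersecting_pairs_def lift_eq_line by blast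
qed

section \<open>Finiteness and equivalence of intersecting pairs\<close>

lemma finite_IP: "finite IP"
proof -
  have "IP \<subseteq> (\<lambda>(i, j). {lift a b w i, lift a b w j}) ` ({..<L} \<times> {..<L})"
    unfolding intersecting_pairs_def by auto
  then show ?thesis by (rule finite_subset) auto
qed

lemma PE_subset: "PE \<subseteq> IP \<times> IP"
  unfolding pair_equiv_def by auto

lemma word_map_line: "word_map a b v ` line i = wext v ` line i"
  using line_subset[of i] by (intro image_cong) (auto intro!: word_map_wext)

lemma word_map_pair: "X \<in> IP \<Longrightarrow> (\<lambda>l. word_map a b v ` l) ` X = (\<lambda>l. wext v ` l) ` X"
  by (elim intersecting_pairsE) (simp add: word_map_line)

lemma PE_iff: "(X, Y) \<in> PE \<longleftrightarrow> X \<in> IP \<and> Y \<in> IP \<and> (\<exists>v. (\<lambda>l. wext v ` l) ` X = Y)"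
proof -
  have "(\<exists>g\<in>range (word_map a b). (\<lambda>l. g ` l) ` X = Y) \<longleftrightarrow> (\<exists>v. (\<lambda>l. wext v ` l) ` X = Y)" if "X \<in> IP"
    using word_map_pair[OF that] by simp
  then show ?thesis unfolding pair_equiv_def Gam_def by auto
qed

lemma PE_refl: "X \<in> IP \<Longrightarrow> (X, X) \<in> PE"
  unfolding PE_iff by (intro conjI exI[of _ "[]"]) auto

lemma PE_sym: assumes "(X, Y) \<in> PE" shows "(Y, X) \<in> PE"
proof -
  obtain v where v: "X \<in> IP" "Y \<in> IP" "(\<lambda>l. wext v ` l) ` X = Y" using assms unfolding PE_iff by auto
  obtain i j where X: "X = {line i, line j}" using v(1) by (elim intersecting_pairsE) blast
  have "wext (rev (map bar v)) ` wext v ` line k = line k" for k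
  proof -
    have "wext (rev (map bar v)) (wext v z) = z" if "z \<in> line k" for z
      using wext_inverse[of z v] line_subset[of k] that by (auto simp: less_imp_le subset_iff)
    then show ?thesis by (simp add: image_image)
  qed
  then have "(\<lambda>l. wext (rev (map bar v)) ` l) ` Y = X" unfolding v(3)[symmetric] X by simp
  then show ?thesis using v(1,2) unfolding PE_iff by auto
qed

lemma PE_trans: assumes "(X, Y) \<in> PE" "(Y, Z) \<in> PE" shows "(X, Z) \<in> PE"
proof -
  obtain u v where *: "X \<in> IP" "Z \<in> IP" "(\<lambda>l. wext u ` l) ` X = Y" "(\<lambda>l. wext v ` l) ` Y = Z"
    using assms unfolding PE_iff by auto
  have "(\<lambda>l. wext (v @ u) ` l) ` X = Z"
    unfolding *(4)[symmetric] *(3)[symmetric] by (simp add: image_image wext_append)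
  then show ?thesis using *(1,2) unfolding PE_iff by auto
qed

lemma class_eq: "(X, Y) \<in> PE \<Longrightarrow> PE `` {X} = PE `` {Y}"
  using PE_sym PE_trans by blast

lemma finite_quotient: "finite (IP // PE)"
  using finite_IP PE_subset by (rule Equiv_Relations.finite_quotient)

text \<open>The pairs are unordered, so the group element may match the lines in two ways; it is
  first replaced by a reduced word.\<close>

lemma equiv_pairs_path:
  assumes "({line i, line j}, {line i', line j'}) \<in> PE"
  shows "\<exists>i'' j''. ((i, j), (i'', j'')) \<in> pair_step\<^sup>* \<and>
    (line i'' = line i' \<and> line j'' = line j' \<or> line i'' = line j' \<and> line j'' = line i')"
proof -
  obtain v0 where "(\<lambda>l. wext v0 ` l) ` {line i, line j} = {line i', line j'}" using assms unfolding PE_iff by auto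
  moreover obtain v where v: "reduced v" "\<And>z. cmod z \<le> 1 \<Longrightarrow> wext v0 z = wext v z"
    using wext_reduce by blast
  have "wext v0 ` line k = wext v ` line k" for k
    using line_subset[of k] by (intro image_cong) (auto intro!: v(2) simp: less_imp_le)
  ultimately have "{wext v ` line i, wext v ` line j} = {line i', line j'}" by simp
  then consider "wext v ` line i = line i'" "wext v ` line j = line j'"
    | "wext v ` line i = line j'" "wext v ` line j = line i'" by (metis doubleton_eq_iff)
  then show ?thesis
  proof cases
    case 1
    then show ?thesis using wext_pair_path[OF v(1) 1] by blast
  next
    case 2
    then show ?thesis using wext_pair_path[OF v(1) 2] by blast
  qed
qed

text \<open>Equivalent pairs are joined by a walk starting at an anchor. Its final pair again has
  different preceding letters, so by \<open>anchor_path_unique\<close> the walk is trivial, and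
  \<open>sep\<close> gives equality.\<close>

lemma card_le_primitive_self_int:
  assumes anchors: "\<And>i j. (i, j) \<in> W \<Longrightarrow> anchor i j \<and> line i \<inter> line j \<noteq> {}"
    and sep: "\<And>i j i' j'. (i, j) \<in> W \<Longrightarrow> (i', j') \<in> W \<Longrightarrow>
      int L dvd (i - i') \<and> int L dvd (j - j') \<or> int L dvd (i - j') \<and> int L dvd (j - i') \<Longrightarrow>
      i = i' \<and> j = j'"
  shows "card W \<le> primitive_self_int a b w"
proof -
  have ne: "\<not> int L dvd (i - j)" if "anchor i j" for i j
  proof
    assume "int L dvd (i - j)"
    then have "e (i - 1) = e (j - 1)" using e_cong[of i j "-1"] by simp
    then show False using that by (simp add: anchor_def)
  qed
  have IP: "{line i, line j} \<in> IP" if "(i, j) \<in> W" for i j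
    using intersecting_pairsI anchors[OF that] ne by blast
  define F where "F = (\<lambda>(i, j). PE `` {{line i, line j}})"
  have "inj_on F W"
  proof (rule inj_onI, clarify)
    fix i j i' j' assume W: "(i, j) \<in> W" "(i', j') \<in> W" and F: "F (i, j) = F (i', j')"
    have "({line i, line j}, {line i', line j'}) \<in> PE"
      using F PE_refl[OF IP[OF W(2)]] unfolding F_def prod.case by (metis Image_singleton_iff)
    then obtain i'' j'' where p: "((i, j), (i'', j'')) \<in> pair_step\<^sup>*"
      and l: "line i'' = line i' \<and> line j'' = line j' \<or> line i'' = line j' \<and> line j'' = line i'"
      using equiv_pairs_path by blast
    have l': "int L dvd (i'' - i') \<and> int L dvd (j'' - j') \<or> int L dvd (i'' - j') \<and> int L dvd (j'' - i')"
      using l by (simp add: line_eq_iff)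
    then have "e (i'' - 1) = e (i' - 1) \<and> e (j'' - 1) = e (j' - 1) \<or> e (i'' - 1) = e (j' - 1) \<and> e (j'' - 1) = e (i' - 1)"
      using e_cong[of _ _ "-1"] by (metis diff_conv_add_uminus)
    moreover have "e (i' - 1) \<noteq> e (j' - 1)" using anchors[OF W(2)] by (simp add: anchor_def)
    ultimately have "e (i'' - 1) \<noteq> e (j'' - 1)" by auto
    then have "i'' = i" "j'' = j" using anchor_path_unique[OF _ p] anchors[OF W(1)] by auto
    then show "i = i' \<and> j = j'" using sep[OF W] l' by simp
  qed
  moreover have "F ` W \<subseteq> IP // PE" using IP by (auto simp: F_def intro!: quotientI)
  ultimately show ?thesis unfolding primitive_self_int_def
    by (metis card_image card_mono finite_quotient)
qed

section \<open>Upper estimate for the number of crossing classes\<close>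

definition positions :: "(int \<times> bool) set" where
  "positions = {0..<int L} \<times> UNIV"

text \<open>Two readings that have just merged: one end of a common part, both positions facing into
  it. Pairs are ordered and include those of lifts that do not cross, so they give only an upper
  estimate.\<close>

definition branches :: "((int \<times> bool) \<times> (int \<times> bool)) set" where
  "branches = {(x, y) \<in> positions \<times> positions. nxt x = nxt y \<and> prv x \<noteq> prv y}"

lemma finite_branches: "finite branches"
proof (rule finite_subset)
  show "branches \<subseteq> positions \<times> positions" unfolding branches_def by blast
  show "finite (positions \<times> positions)" unfolding positions_def by simp
qed

fun md :: "int \<times> bool \<Rightarrow> int \<times> bool" where
  "md (i, d) = (i mod int L, d)"

lemma md_props: "nxt (md x) = nxt x" "prv (md x) = prv x" "line (fst (md x)) = line (fst x)"
  "md x \<in> positions" "snd (md x) = snd x"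
proof -
  show "nxt (md x) = nxt x" using e_mod_prev e_mod by (cases x rule: adv.cases) auto
  show "prv (md x) = prv x" using e_mod_prev e_mod by (cases x rule: adv.cases) (auto simp: prv_def)
  show "line (fst (md x)) = line (fst x)" using line_mod by (cases x) auto
  show "md x \<in> positions" using L_pos by (cases x) (auto simp: positions_def)
  show "snd (md x) = snd x" by (cases x) auto
qed

lemma nxt_pow_md: "md x = md y \<Longrightarrow> nxt ((adv ^^ t) x) = nxt ((adv ^^ t) y)"
proof -
  assume *: "md x = md y"
  obtain i j d where xy: "x = (i, d)" "y = (j, d)" using * by (cases x; cases y) auto
  have "int L dvd (i - j)" using * xy by (simp add: mod_eq_dvd_iff)
  then show ?thesis using e_cong[of i j "int t"] e_cong[of i j "- int t - 1"] xy
    by (cases d) (simp_all add: adv_pow algebra_simps)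
qed

lemma line_adv_pow:
  assumes "\<And>s. s < t \<Longrightarrow> nxt ((adv ^^ s) x) = nxt ((adv ^^ s) y)"
  shows "\<exists>v. wext v ` line (fst x) = line (fst ((adv ^^ t) x)) \<and> wext v ` line (fst y) = line (fst ((adv ^^ t) y))"
  using assms
proof (induction t)
  case 0
  then show ?case by (intro exI[of _ "[]"]) simp
next
  case (Suc t)
  then obtain v where v: "wext v ` line (fst x) = line (fst ((adv ^^ t) x))"
    "wext v ` line (fst y) = line (fst ((adv ^^ t) y))" by force
  let ?c = "bar (nxt ((adv ^^ t) x))"
  have "?c = bar (nxt ((adv ^^ t) y))" using Suc.prems by simp
  then have "ext ?c ` wext v ` line (fst x) = line (fst ((adv ^^ Suc t) x))"
    "ext ?c ` wext v ` line (fst y) = line (fst ((adv ^^ Suc t) y))"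
    using line_adv[of "(adv ^^ t) x"] line_adv[of "(adv ^^ t) y"] v by simp_all
  then show ?case by (intro exI[of _ "?c # v"]) (simp add: image_comp)
qed

definition pos_class :: "(int \<times> bool) \<times> (int \<times> bool) \<Rightarrow> complex set set set" where
  "pos_class = (\<lambda>(x, y). PE `` {{line (fst x), line (fst y)}})"

text \<open>Different lines cannot agree forever, so advancing along equal letters reaches a first
  disagreement. Facing back from there, the positions form a branching, and the crossing has only
  been translated by \<Gamma>.\<close>

lemma slide_to_branch:
  assumes nxt: "nxt x = nxt y" and IP: "{line (fst x), line (fst y)} \<in> IP" and ne: "line (fst x) \<noteq> line (fst y)"
  obtains T where "T > 0" "\<And>s. s < T \<Longrightarrow> nxt ((adv ^^ s) x) = nxt ((adv ^^ s) y)"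
    "nxt (flip ((adv ^^ T) x)) = nxt (flip ((adv ^^ T) y))" "prv (flip ((adv ^^ T) x)) \<noteq> prv (flip ((adv ^^ T) y))"
    "{line (fst ((adv ^^ T) x)), line (fst ((adv ^^ T) y))} \<in> IP"
    "line (fst ((adv ^^ T) x)) \<noteq> line (fst ((adv ^^ T) y))"
    "pos_class ((adv ^^ T) x, (adv ^^ T) y) = pos_class (x, y)"
proof -
  have "\<exists>t. nxt ((adv ^^ t) x) \<noteq> nxt ((adv ^^ t) y)"
  proof (rule ccontr)
    assume "\<not> ?thesis"
    then have "ray x = ray y" by (auto simp: ray_def)
    then show False using ray_eq_imp(2)[of x y] ne by (simp add: line_eq_iff)
  qed
  then obtain T where T: "nxt ((adv ^^ T) x) \<noteq> nxt ((adv ^^ T) y)"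
    "\<And>s. s < T \<Longrightarrow> nxt ((adv ^^ s) x) = nxt ((adv ^^ s) y)"
    using exists_least_iff[of "\<lambda>t. nxt ((adv ^^ t) x) \<noteq> nxt ((adv ^^ t) y)"] by blast
  have T0: "T > 0" using T(1) nxt by (cases T) auto
  then obtain T' where T': "T = Suc T'" by (cases T) auto
  obtain v where v: "wext v ` line (fst x) = line (fst ((adv ^^ T) x))" "wext v ` line (fst y) = line (fst ((adv ^^ T) y))"
    using line_adv_pow[OF T(2)] by blast
  have inj: "inj_on (wext v) disk"
    using disk_moebius_inj[OF wext_moebius] by (rule inj_on_subset) auto
  have ne': "line (fst ((adv ^^ T) x)) \<noteq> line (fst ((adv ^^ T) y))"
    unfolding v[symmetric] using ne inj_on_image_eq_iff[OF inj line_subset line_subset] by blast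
  have "line (fst x) \<inter> line (fst y) \<noteq> {}"
    using IP ne by (elim intersecting_pairsE) (metis Int_commute doubleton_eq_iff)
  then have "wext v ` (line (fst x) \<inter> line (fst y)) \<noteq> {}" by simp
  then have "line (fst ((adv ^^ T) x)) \<inter> line (fst ((adv ^^ T) y)) \<noteq> {}" unfolding v[symmetric] by blast
  then have IP': "{line (fst ((adv ^^ T) x)), line (fst ((adv ^^ T) y))} \<in> IP"
    using intersecting_pairsI ne' line_eq_iff by blast
  have "({line (fst x), line (fst y)}, {line (fst ((adv ^^ T) x)), line (fst ((adv ^^ T) y))}) \<in> PE"
    unfolding PE_iff using IP IP' v by (intro conjI exI[of _ v]) auto
  then have "pos_class ((adv ^^ T) x, (adv ^^ T) y) = pos_class (x, y)"
    using class_eq by (auto simp: pos_class_def)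
  moreover have "nxt (flip ((adv ^^ T) x)) = nxt (flip ((adv ^^ T) y))"
    using T(2)[of T'] by (simp add: T' nxt_flip_adv)
  moreover have "prv (flip ((adv ^^ T) x)) \<noteq> prv (flip ((adv ^^ T) y))"
    using T(1) by (simp add: prv_flip)
  ultimately show thesis using that T0 T(2) IP' ne' by blast
qed

text \<open>If the far position on \<open>x\<close>, facing back, coincided with the near position
  on \<open>y\<close>, the common word would equal its own inverse. Its middle letter would be its
  own inverse, or its two middle letters would cancel.\<close>

lemma no_self_reversal:
  assumes "T > 0" "\<And>s. s < T \<Longrightarrow> nxt ((adv ^^ s) x) = nxt ((adv ^^ s) y)"
  shows "md y \<noteq> md (flip ((adv ^^ T) x))"
proof
  assume *: "md y = md (flip ((adv ^^ T) x))"
  have bk: "(adv ^^ s) (flip ((adv ^^ T) x)) = flip ((adv ^^ (T - s)) x)" if "s \<le> T" for s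
    using that
  proof (induction s)
    case (Suc s)
    have "T - s = Suc (T - Suc s)" using Suc.prems by simp
    moreover have "(adv ^^ Suc s) (flip ((adv ^^ T) x)) = adv (flip ((adv ^^ (T - s)) x))"
      using Suc by simp
    ultimately have "(adv ^^ Suc s) (flip ((adv ^^ T) x)) = adv (flip (adv ((adv ^^ (T - Suc s)) x)))"
      by simp
    then show ?case by (simp only: adv_flip_adv)
  qed simp
  have r: "ray x s = bar (ray x (T - Suc s))" if "s < T" for s
  proof -
    have "ray x s = nxt ((adv ^^ s) (flip ((adv ^^ T) x)))"
      using assms(2)[OF that] nxt_pow_md[OF *, of s] by (simp add: ray_def)
    also have "\<dots> = nxt (flip (adv ((adv ^^ (T - Suc s)) x)))"
    proof -
      have "T - s = Suc (T - Suc s)" using that by simp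
      then show ?thesis using bk[of s] that by simp
    qed
    finally show ?thesis by (simp add: nxt_flip_adv ray_def)
  qed
  show False
  proof (cases "even T")
    case True
    then obtain k where k: "T = 2 * k" "k > 0" using assms(1) by (auto elim: evenE)
    have "T - Suc (k - 1) = Suc (k - 1)" using k by simp
    then have "ray x (k - 1) = bar (ray x (Suc (k - 1)))" using r[of "k - 1"] k by simp
    then show False using per_red_ray[of x] unfolding per_red_def by (metis bar_bar)
  next
    case False
    then obtain k where k: "T = 2 * k + 1" by (auto elim: oddE)
    then show False using r[of k] by simp
  qed
qed

text \<open>A crossing whose lines share an edge of the tree has two ends where the lines branch, and either end
  yields two ordered pairs of positions.\<close>

lemma four_branches:
  assumes nxt: "nxt x = nxt y" and IP: "{line (fst x), line (fst y)} \<in> IP" and ne: "line (fst x) \<noteq> line (fst y)"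
  shows "4 \<le> card {p \<in> branches. pos_class p = pos_class (x, y)}"
proof -
  obtain S where S: "nxt (flip ((adv ^^ S) x)) = nxt (flip ((adv ^^ S) y))" "prv (flip ((adv ^^ S) x)) \<noteq> prv (flip ((adv ^^ S) y))"
    "{line (fst ((adv ^^ S) x)), line (fst ((adv ^^ S) y))} \<in> IP"
    "line (fst ((adv ^^ S) x)) \<noteq> line (fst ((adv ^^ S) y))"
    "pos_class ((adv ^^ S) x, (adv ^^ S) y) = pos_class (x, y)"
    using slide_to_branch[OF assms] by metis
  \<comment> \<open>The given positions need not be at an end of the common part. The first slide
    finds one end; the second starts there, facing back, and finds the other.\<close>
  define x0 y0 where "x0 = flip ((adv ^^ S) x)" and "y0 = flip ((adv ^^ S) y)"
  have ff: "fst (flip z) = fst z" "snd (flip z) = (\<not> snd z)" for z by (cases z; simp)+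
  have 0: "nxt x0 = nxt y0" "prv x0 \<noteq> prv y0" "{line (fst x0), line (fst y0)} \<in> IP" "line (fst x0) \<noteq> line (fst y0)"
    "pos_class (x0, y0) = pos_class (x, y)"
    using S by (auto simp: x0_def y0_def ff pos_class_def)
  obtain T where T: "T > 0" "\<And>s. s < T \<Longrightarrow> nxt ((adv ^^ s) x0) = nxt ((adv ^^ s) y0)"
    "nxt (flip ((adv ^^ T) x0)) = nxt (flip ((adv ^^ T) y0))" "prv (flip ((adv ^^ T) x0)) \<noteq> prv (flip ((adv ^^ T) y0))"
    "{line (fst ((adv ^^ T) x0)), line (fst ((adv ^^ T) y0))} \<in> IP"
    "line (fst ((adv ^^ T) x0)) \<noteq> line (fst ((adv ^^ T) y0))"
    "pos_class ((adv ^^ T) x0, (adv ^^ T) y0) = pos_class (x0, y0)"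
    using slide_to_branch[OF 0(1,3,4)] by metis
  define x1 y1 where "x1 = flip ((adv ^^ T) x0)" and "y1 = flip ((adv ^^ T) y0)"
  have 1: "nxt x1 = nxt y1" "prv x1 \<noteq> prv y1" "line (fst x1) \<noteq> line (fst y1)"
    "pos_class (x1, y1) = pos_class (x, y)"
    using T(3-7) 0(5) by (auto simp: x1_def y1_def ff pos_class_def)
  have sw: "pos_class (v, u) = pos_class (u, v)" for u v by (simp add: pos_class_def insert_commute)
  have pm: "pos_class (md u, md v) = pos_class (u, v)" for u v by (simp add: pos_class_def md_props)
  have snd_adv: "snd ((adv ^^ t) u) = snd u" for t u by (cases u rule: adv.cases) (simp_all add: adv_pow)
  define F where "F = {(md x0, md y0), (md y0, md x0), (md x1, md y1), (md y1, md x1)}"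
  have sub: "F \<subseteq> {p \<in> branches. pos_class p = pos_class (x, y)}"
    unfolding F_def branches_def using 0 1 sw pm by (auto simp: md_props)
  have n0: "md x0 \<noteq> md y0" "md x1 \<noteq> md y1" using 0(4) 1(3) md_props(3) by metis+
  \<comment> \<open>At the two ends, positions on the same reading have opposite directions. Across
    the two readings this need not help, and \<open>no_self_reversal\<close> is required.\<close>
  have n1: "md x0 \<noteq> md x1" using md_props(5)[of x0] md_props(5)[of x1] by (auto simp: x1_def ff snd_adv)
  have n2: "md y0 \<noteq> md x1" unfolding x1_def by (rule no_self_reversal[OF T(1,2)])
  have "card F = 4" unfolding F_def using n0 n1 n2 by auto
  moreover have "finite {p \<in> branches. pos_class p = pos_class (x, y)}"
    using finite_branches by simp
  ultimately show ?thesis using card_mono[OF _ sub] by (simp del: insert_absorb)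
qed

text \<open>The arcs come in the cyclic order A, Bbar, B, Abar, so four ends in four arcs are linked
  exactly when one lift joins A with B and the other Abar with Bbar.\<close>

lemma crossing_turns:
  assumes "e i \<noteq> e j" "e (i - 1) \<noteq> e (j - 1)" "e i \<noteq> bar (e (j - 1))" "e j \<noteq> bar (e (i - 1))"
  shows "line i \<inter> line j \<noteq> {} \<longleftrightarrow>
    (e (i - 1), e i) \<in> {(Abar, B), (Bbar, A)} \<and> (e (j - 1), e j) \<in> {(A, Bbar), (B, Abar)} \<or>
    (e (j - 1), e j) \<in> {(Abar, B), (Bbar, A)} \<and> (e (i - 1), e i) \<in> {(A, Bbar), (B, Abar)}"
  unfolding crossing_letters_intersect_iff[OF assms]
  using assms red'(1)[of i] red'(1)[of j]
  by (cases "e (i - 1)"; cases "e i"; cases "e (j - 1)"; cases "e j") (simp_all add: ccw_def)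

text \<open>A class with a common edge is charged to at least four branchings, in disjoint fibres of
  \<open>pos_class\<close>. Every other class comes from a pair of turns, so those classes number at
  most the product.\<close>

lemma primitive_self_int_upper:
  "4 * primitive_self_int a b w \<le> card branches + 4 * (card upper_turns * card lower_turns)"
proof -
  define Q1 where "Q1 = {C \<in> IP // PE. \<exists>x y. nxt x = nxt y \<and> {line (fst x), line (fst y)} \<in> IP \<and>
      line (fst x) \<noteq> line (fst y) \<and> C = pos_class (x, y)}"
  have finQ: "finite (IP // PE)" by (rule finite_quotient)
  note finB = finite_branches
  have "4 * card Q1 = (\<Sum>C\<in>Q1. 4)" by simp
  also have "\<dots> \<le> (\<Sum>C\<in>Q1. card {p \<in> branches. pos_class p = C})"
  proof (rule sum_mono)
    fix C assume "C \<in> Q1"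
    then obtain x y where "nxt x = nxt y" "{line (fst x), line (fst y)} \<in> IP" "line (fst x) \<noteq> line (fst y)"
      "C = pos_class (x, y)" unfolding Q1_def by blast
    then show "4 \<le> card {p \<in> branches. pos_class p = C}" using four_branches[of x y] by simp
  qed
  also have "\<dots> = card (\<Union>C\<in>Q1. {p \<in> branches. pos_class p = C})"
    using finQ finB by (intro card_UN_disjoint[symmetric]) (auto simp: Q1_def)
  also have "\<dots> \<le> card branches" using finB by (intro card_mono) auto
  finally have 1: "4 * card Q1 \<le> card branches" .
  have "(IP // PE) - Q1 \<subseteq> (\<lambda>(i, j). PE `` {{line i, line j}}) ` (upper_turns \<times> lower_turns)"
  proof
    fix C assume C: "C \<in> (IP // PE) - Q1"
    then obtain X where X: "X \<in> IP" "C = PE `` {X}" by (auto elim: quotientE)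
    obtain i j where ij: "X = {line i, line j}" "\<not> int L dvd (i - j)" "line i \<inter> line j \<noteq> {}"
      using X(1) by (elim intersecting_pairsE)
    have ne: "line i \<noteq> line j" using ij(2) line_eq_iff by blast
    have no: "nxt (i, c) \<noteq> nxt (j, d)" for c d
    proof
      assume "nxt (i, c) = nxt (j, d)"
      then have "C \<in> Q1" unfolding Q1_def using C X ij ne
        by (auto simp: pos_class_def intro!: exI[of _ "(i, c)"] exI[of _ "(j, d)"])
      then show False using C by blast
    qed
    have "e i \<noteq> e j" "e (i - 1) \<noteq> e (j - 1)" "e i \<noteq> bar (e (j - 1))" "e j \<noteq> bar (e (i - 1))"
      using no[of True True] no[of False False] no[of True False] no[of False True] by auto
    from crossing_turns[OF this] ij(3) have t:
      "(e (i - 1), e i) \<in> {(Abar, B), (Bbar, A)} \<and> (e (j - 1), e j) \<in> {(A, Bbar), (B, Abar)} \<or>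
       (e (j - 1), e j) \<in> {(Abar, B), (Bbar, A)} \<and> (e (i - 1), e i) \<in> {(A, Bbar), (B, Abar)}" by blast
    have mem: "(e (k - 1), e k) \<in> {(Abar, B), (Bbar, A)} \<Longrightarrow> k mod int L \<in> upper_turns"
      "(e (k - 1), e k) \<in> {(A, Bbar), (B, Abar)} \<Longrightarrow> k mod int L \<in> lower_turns" for k
      unfolding upper_turns_def lower_turns_def using e_mod_prev e_mod L_pos by auto
    from t show "C \<in> (\<lambda>(i, j). PE `` {{line i, line j}}) ` (upper_turns \<times> lower_turns)"
    proof
      assume "(e (i - 1), e i) \<in> {(Abar, B), (Bbar, A)} \<and> (e (j - 1), e j) \<in> {(A, Bbar), (B, Abar)}"
      then show ?thesis using mem X(2) ij(1) line_mod
        by (intro image_eqI[of _ _ "(i mod int L, j mod int L)"]) auto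
    next
      assume "(e (j - 1), e j) \<in> {(Abar, B), (Bbar, A)} \<and> (e (i - 1), e i) \<in> {(A, Bbar), (B, Abar)}"
      then show ?thesis using mem X(2) ij(1) line_mod
        by (intro image_eqI[of _ _ "(j mod int L, i mod int L)"]) (auto simp: insert_commute)
    qed
  qed
  moreover have fT: "finite (upper_turns \<times> lower_turns)"
  proof (rule finite_subset)
    show "upper_turns \<times> lower_turns \<subseteq> {0..<int L} \<times> {0..<int L}"
      unfolding upper_turns_def lower_turns_def by blast
  qed simp
  ultimately have 2: "card ((IP // PE) - Q1) \<le> card upper_turns * card lower_turns"
    by (metis card_cartesian_product surj_card_le)
  have sub: "Q1 \<subseteq> IP // PE" unfolding Q1_def by blast
  have "card (IP // PE) = card Q1 + card ((IP // PE) - Q1)"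
    using card_Diff_subset[OF finite_subset[OF sub finQ] sub] card_mono[OF finQ sub] by linarith
  then show ?thesis using 1 2 unfolding primitive_self_int_def by linarith
qed

end

section \<open>The upper bound\<close>

lemma UNIV_letter: "UNIV = {A, Abar, B, Bbar}"
  using letter.exhaust by auto

instance letter :: finite
  by standard (simp add: UNIV_letter)

lemma sum_UNIV_letter: "(\<Sum>x\<in>UNIV. f x) = f A + f Abar + f B + f Bbar" for f :: "letter \<Rightarrow> nat"
  by (simp add: UNIV_letter)

lemma UNIV_letter_diff: "UNIV - {A} = {Abar, B, Bbar}" "UNIV - {Abar} = {A, B, Bbar}"
  "UNIV - {B} = {A, Abar, Bbar}" "UNIV - {Bbar} = {A, Abar, B}"
  by (auto simp: UNIV_letter)

context prim_word
begin

lemma finite_window [simp]: "finite {i. 0 \<le> i \<and> i < int L \<and> P i}"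
  by (rule finite_subset[of _ "{0..<int L}"]) auto

definition cnt :: "letter \<Rightarrow> letter \<Rightarrow> nat" where
  "cnt x y = card {i \<in> {0..<int L}. e (i - 1) = x \<and> e i = y}"

text \<open>The number of block pairs in one period, that is, the n of the theorem for the primitive
  root.\<close>

definition switches :: nat where
  "switches = card {i \<in> {0..<int L}. e (i - 1) \<in> {A, Abar} \<and> e i \<in> {B, Bbar}}"

lemma card_pairs: "card {i \<in> {0..<int L}. R (e (i - 1)) (e i)} = (\<Sum>(x, y)\<in>{(x, y). R x y}. cnt x y)"
proof -
  have "{i \<in> {0..<int L}. R (e (i - 1)) (e i)} =
     (\<Union>p\<in>{(x, y). R x y}. {i \<in> {0..<int L}. e (i - 1) = fst p \<and> e i = snd p})" by auto
  moreover have "card (\<Union>p\<in>{(x, y). R x y}. {i \<in> {0..<int L}. e (i - 1) = fst p \<and> e i = snd p}) =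
     (\<Sum>p\<in>{(x, y). R x y}. card {i \<in> {0..<int L}. e (i - 1) = fst p \<and> e i = snd p})"
    by (rule card_UN_disjoint) auto
  ultimately show ?thesis by (simp add: cnt_def case_prod_beta)
qed

lemma card_shift: "card {i \<in> {0..<int L}. P (e (i - 1))} = card {i \<in> {0..<int L}. P (e i)}"
proof -
  have "bij_betw (\<lambda>i. (i - 1) mod int L) {i \<in> {0..<int L}. P (e (i - 1))} {i \<in> {0..<int L}. P (e i)}"
    by (rule bij_betw_byWitness[where f' = "\<lambda>i. (i + 1) mod int L"])
      (use L_pos in \<open>auto simp: e_mod e_mod_prev mod_simps\<close>)
  then show ?thesis by (rule bij_betw_same_card)
qed

lemma cnt_bar: "cnt x (bar x) = 0"
proof -
  have "{i \<in> {0..<int L}. e (i - 1) = x \<and> e i = bar x} = {}" using red'(1) by auto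
  then show ?thesis unfolding cnt_def by (simp only: card.empty)
qed

lemma cnt_zero: "cnt A Abar = 0" "cnt Abar A = 0" "cnt B Bbar = 0" "cnt Bbar B = 0"
  using cnt_bar[of A] cnt_bar[of Abar] cnt_bar[of B] cnt_bar[of Bbar] by simp_all

text \<open>Going once around, every letter is entered as often as it is left.\<close>

lemma flow: "(\<Sum>y\<in>UNIV. cnt x y) = (\<Sum>y\<in>UNIV. cnt y x)"
proof -
  have "{(x', y). x' = x} = {x} \<times> (UNIV :: letter set)" "{(y, x'). x' = x} = (UNIV :: letter set) \<times> {x}" by auto
  then show ?thesis
    using card_shift[of "\<lambda>l. l = x"] card_pairs[of "\<lambda>x' y. x' = x"] card_pairs[of "\<lambda>y x'. x' = x"]
    by (simp flip: sum.cartesian_product)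
qed

lemma flows:
  "cnt A B + cnt A Bbar = cnt B A + cnt Bbar A"
  "cnt Abar B + cnt Abar Bbar = cnt B Abar + cnt Bbar Abar"
  "cnt B A + cnt B Abar = cnt A B + cnt Abar B"
  "cnt Bbar A + cnt Bbar Abar = cnt A Bbar + cnt Abar Bbar"
  using flow[of A] flow[of Abar] flow[of B] flow[of Bbar] by (simp_all add: UNIV_letter cnt_zero)

lemma L_cnt: "L = (cnt A A + cnt Abar Abar) + (cnt B B + cnt Bbar Bbar) + 2 * switches"
  and switches_cnt: "switches = cnt A B + cnt A Bbar + cnt Abar B + cnt Abar Bbar"
proof -
  have "{(x, y). x \<in> {A, Abar} \<and> y \<in> {B, Bbar}} = {A, Abar} \<times> {B, Bbar}" by auto
  then show sw: "switches = cnt A B + cnt A Bbar + cnt Abar B + cnt Abar Bbar"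
    unfolding switches_def using card_pairs[of "\<lambda>x y. x \<in> {A, Abar} \<and> y \<in> {B, Bbar}"]
    by (simp flip: sum.cartesian_product)
  have L_full: "card {i \<in> {0..<int L}. True} = L" by (simp flip: atLeastLessThan_iff)
  have "{(x, y). True} = (UNIV :: letter set) \<times> (UNIV :: letter set)" by auto
  then have "L = (\<Sum>x\<in>UNIV. \<Sum>y\<in>UNIV. cnt x y)"
    using card_pairs[of "\<lambda>x y. True"] L_full by (simp only: sum.cartesian_product)
  then show "L = (cnt A A + cnt Abar Abar) + (cnt B B + cnt Bbar Bbar) + 2 * switches"
    using flows sw by (simp add: UNIV_letter cnt_zero)
qed

lemma turns_cnt: "card upper_turns = cnt Abar B + cnt Bbar A" "card lower_turns = cnt A Bbar + cnt B Abar"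
proof -
  have S: "{(x, y). (x, y) \<in> S} = S" for S :: "(letter \<times> letter) set" by auto
  show "card upper_turns = cnt Abar B + cnt Bbar A" "card lower_turns = cnt A Bbar + cnt B Abar"
    unfolding upper_turns_def lower_turns_def
      card_pairs[of "\<lambda>x y. (x, y) \<in> {(Abar, B), (Bbar, A)}"] card_pairs[of "\<lambda>x y. (x, y) \<in> {(A, Bbar), (B, Abar)}"]
    unfolding S by simp_all
qed

end

context pants_cyclic_word
begin

lemma card_positions: "card {z \<in> positions. prv z = x \<and> nxt z = y} = cnt x y + cnt (bar y) (bar x)"
proof -
  have "{z \<in> positions. prv z = x \<and> nxt z = y} =
     (\<lambda>i. (i, True)) ` {i \<in> {0..<int L}. e (i - 1) = x \<and> e i = y} \<union>
     (\<lambda>i. (i, False)) ` {i \<in> {0..<int L}. e (i - 1) = bar y \<and> e i = bar x}"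
  proof (intro set_eqI iffI)
    fix z assume "z \<in> {z \<in> positions. prv z = x \<and> nxt z = y}"
    then show "z \<in> (\<lambda>i. (i, True)) ` {i \<in> {0..<int L}. e (i - 1) = x \<and> e i = y} \<union>
       (\<lambda>i. (i, False)) ` {i \<in> {0..<int L}. e (i - 1) = bar y \<and> e i = bar x}"
      by (cases z rule: adv.cases) (auto simp: positions_def prv_def)
  qed (auto simp: positions_def prv_def)
  moreover have "card ((\<lambda>i. (i, True)) ` {i \<in> {0..<int L}. e (i - 1) = x \<and> e i = y} \<union>
     (\<lambda>i. (i, False)) ` {i \<in> {0..<int L}. e (i - 1) = bar y \<and> e i = bar x}) = cnt x y + cnt (bar y) (bar x)"
    unfolding cnt_def by (subst card_Un_disjoint) (auto simp: card_image inj_on_def)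
  ultimately show ?thesis by simp
qed

lemma card_branches:
  "card branches = (\<Sum>y\<in>UNIV. \<Sum>x\<in>UNIV. \<Sum>x'\<in>UNIV - {x}.
      (cnt x y + cnt (bar y) (bar x)) * (cnt x' y + cnt (bar y) (bar x')))"
proof -
  define S where "S x y = {z \<in> positions. prv z = x \<and> nxt z = y}" for x y
  have fin: "finite (S x y)" for x y unfolding S_def positions_def by simp
  have dis: "z \<in> S x y \<Longrightarrow> prv z = x \<and> nxt z = y" for z x y by (simp add: S_def)
  have "branches = (\<Union>y\<in>UNIV. \<Union>x\<in>UNIV. \<Union>x'\<in>UNIV - {x}. S x y \<times> S x' y)"
    unfolding branches_def S_def by auto
  also have "card \<dots> = (\<Sum>y\<in>UNIV. card (\<Union>x\<in>UNIV. \<Union>x'\<in>UNIV - {x}. S x y \<times> S x' y))"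
    by (rule card_UN_disjoint) (use fin in simp, use fin in simp, use dis in blast)
  also have "\<dots> = (\<Sum>y\<in>UNIV. \<Sum>x\<in>UNIV. card (\<Union>x'\<in>UNIV - {x}. S x y \<times> S x' y))"
    by (rule sum.cong[OF refl], rule card_UN_disjoint) (use fin in simp, use fin in simp, use dis in blast)
  also have "\<dots> = (\<Sum>y\<in>UNIV. \<Sum>x\<in>UNIV. \<Sum>x'\<in>UNIV - {x}. card (S x y \<times> S x' y))"
    by (rule sum.cong[OF refl], rule sum.cong[OF refl], rule card_UN_disjoint) (use fin in simp, use fin in simp, use dis in blast)
  finally show ?thesis by (simp add: card_cartesian_product S_def card_positions)
qed

text \<open>The flow relations leave four numbers: the repeated letters \<open>M1\<close> and
  \<open>M2\<close> of the two types, the upper turns \<open>p\<close> and the block pairs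
  \<open>n\<close>. The branch count is a polynomial in them, with slack the square of n -
  p.\<close>

lemma primitive_upper_bound: "int (primitive_self_int a b w) \<le> int switches * int L - (int switches)\<^sup>2"
proof -
  define M1 M2 p n where "M1 = int (cnt A A + cnt Abar Abar)" and "M2 = int (cnt B B + cnt Bbar Bbar)"
    and "p = int (cnt Abar B + cnt Bbar A)" and "n = int switches"
  have r: "int (cnt A Bbar + cnt B Abar) = p" "int (cnt B A + cnt Abar Bbar) = n - p"
    "int (cnt A B + cnt Bbar Abar) = n - p" "int L = M1 + M2 + 2 * n"
    using flows L_cnt switches_cnt unfolding M1_def M2_def p_def n_def by linarith+
  have "card branches =
     2 * ((cnt A A + cnt Abar Abar) * (cnt B A + cnt Abar Bbar) + (cnt A A + cnt Abar Abar) * (cnt Abar B + cnt Bbar A)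
        + (cnt B A + cnt Abar Bbar) * (cnt Abar B + cnt Bbar A)) +
     2 * ((cnt A A + cnt Abar Abar) * (cnt A Bbar + cnt B Abar) + (cnt A A + cnt Abar Abar) * (cnt A B + cnt Bbar Abar)
        + (cnt A Bbar + cnt B Abar) * (cnt A B + cnt Bbar Abar)) +
     2 * ((cnt B B + cnt Bbar Bbar) * (cnt A B + cnt Bbar Abar) + (cnt B B + cnt Bbar Bbar) * (cnt Abar B + cnt Bbar A)
        + (cnt A B + cnt Bbar Abar) * (cnt Abar B + cnt Bbar A)) +
     2 * ((cnt B B + cnt Bbar Bbar) * (cnt A Bbar + cnt B Abar) + (cnt B B + cnt Bbar Bbar) * (cnt B A + cnt Abar Bbar)
        + (cnt A Bbar + cnt B Abar) * (cnt B A + cnt Abar Bbar))"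
    unfolding card_branches sum_UNIV_letter UNIV_letter_diff by (simp add: cnt_zero) (simp add: algebra_simps)
  then have "int (card branches) =
     2 * (M1 * (n - p) + M1 * p + (n - p) * p) + 2 * (M1 * p + M1 * (n - p) + p * (n - p)) +
     2 * (M2 * (n - p) + M2 * p + (n - p) * p) + 2 * (M2 * p + M2 * (n - p) + p * (n - p))"
    by (simp only: of_nat_add of_nat_mult of_nat_numeral r[unfolded of_nat_add] M1_def[unfolded of_nat_add, symmetric]
        M2_def[unfolded of_nat_add, symmetric] p_def[unfolded of_nat_add, symmetric])
  also have "\<dots> = 4 * (n * (M1 + M2)) + 8 * (p * (n - p))" by (simp add: algebra_simps)
  finally have br: "int (card branches) = 4 * (n * (M1 + M2)) + 8 * (p * (n - p))" .
  have "4 * int (primitive_self_int a b w) \<le> int (card branches) + 4 * (p * p)"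
  proof -
    have "int (4 * primitive_self_int a b w) \<le> int (card branches + 4 * (card upper_turns * card lower_turns))"
      using primitive_self_int_upper by (simp only: of_nat_le_iff)
    moreover have "int (card upper_turns) = p" "int (card lower_turns) = p"
      using r(1) by (simp_all add: turns_cnt p_def)
    ultimately show ?thesis by simp
  qed
  moreover define q where "q = (n - p) * (n - p)"
  moreover have "int (card branches) + 4 * (p * p) + 4 * q = 4 * (n * int L - n\<^sup>2)"
    unfolding br r(4) q_def by (simp add: power2_eq_square algebra_simps)
  moreover have "q \<ge> 0" by (simp add: q_def)
  ultimately have "4 * int (primitive_self_int a b w) \<le> 4 * (n * int L - n\<^sup>2)" by linarith
  then show ?thesis unfolding n_def by simp
qed

end

section \<open>Blocks of equal letters\<close>

fun horizontal :: "letter \<Rightarrow> bool" where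
  "horizontal A = True" | "horizontal Abar = True" | "horizontal B = False" | "horizontal Bbar = False"

fun pos :: "letter \<Rightarrow> bool" where
  "pos A = True" | "pos Abar = False" | "pos B = True" | "pos Bbar = False"

lemma letter_eqI: "horizontal x = horizontal y \<Longrightarrow> pos x = pos y \<Longrightarrow> x = y"
  by (cases x; cases y) auto

lemma neq_horizontal: "x \<noteq> y \<Longrightarrow> y \<noteq> bar x \<Longrightarrow> horizontal x \<noteq> horizontal y"
  by (cases x; cases y) auto

text \<open>With blocks of opposite sign regarded as infinitely long, the hypotheses say that the
  first lift has the longer block at the left end. The side on which it branches off then depends
  only on the sign of \<open>c\<close>.\<close>

lemma ccw_left:
  assumes "horizontal p2 \<noteq> horizontal c" "p1 = c \<or> horizontal p1 \<noteq> horizontal c \<and> pos p1 \<noteq> pos c \<and> pos p2 = pos c"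
  shows "ccw c (bar p1) (bar p2) \<longleftrightarrow> \<not> pos c"
  using assms by (cases c; cases p1; cases p2) (auto simp: ccw_def)

text \<open>Mirror image at the right end, where the first lift has the shorter block. A longer
  block on the left and a shorter one on the right therefore make a crossing.\<close>

lemma ccw_right:
  assumes "horizontal y1 \<noteq> horizontal c" "y2 = c \<or> horizontal y2 \<noteq> horizontal c \<and> pos y1 = pos c \<and> pos y2 \<noteq> pos c"
  shows "ccw (bar c) y1 y2 \<longleftrightarrow> \<not> pos c"
  using assms by (cases c; cases y1; cases y2) (auto simp: ccw_def)

text \<open>Take the first ascent after the given descent, then the last descent before it; strictly
  between them neither occurs, so the values agree.\<close>

lemma last_descent_before_ascent:
  fixes V :: "nat \<Rightarrow> 'a :: linorder"
  assumes "V a0 > V (a0 + d)" "V a1 < V (a1 + d)" "a0 < a1"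
  obtains K q where "a0 \<le> K" "K + q \<le> a1" "q > 0" "V K > V (K + d)" "V (K + q) < V (K + q + d)"
    "\<And>t. 0 < t \<Longrightarrow> t < q \<Longrightarrow> V (K + t) = V (K + t + d)"
proof -
  define b where "b = (LEAST b. a0 < b \<and> V b < V (b + d))"
  have b: "a0 < b" "V b < V (b + d)" "b \<le> a1"
    using LeastI[of "\<lambda>b. a0 < b \<and> V b < V (b + d)" a1] Least_le[of "\<lambda>b. a0 < b \<and> V b < V (b + d)" a1] assms
    unfolding b_def by auto
  have bmin: "\<not> V c < V (c + d)" if "a0 < c" "c < b" for c
    using not_less_Least[of c "\<lambda>b. a0 < b \<and> V b < V (b + d)"] that unfolding b_def by auto
  define D where "D = {a. a0 \<le> a \<and> a < b \<and> V a > V (a + d)}"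
  have D: "finite D" "D \<noteq> {}" using assms(1) b(1) by (auto simp: D_def intro: finite_subset[of _ "{..<b}"])
  define K where "K = Max D"
  have K: "a0 \<le> K" "K < b" "V K > V (K + d)" using Max_in[OF D] by (auto simp: K_def D_def)
  have "V (K + t) = V (K + t + d)" if "0 < t" "t < b - K" for t
  proof -
    have "K + t \<notin> D" using Max_ge[OF D(1), of "K + t"] that by (auto simp: K_def)
    then have "\<not> V (K + t) > V (K + t + d)" using K(1) that by (auto simp: D_def)
    moreover have "\<not> V (K + t) < V (K + t + d)" using bmin[of "K + t"] K(1) that by auto
    ultimately show ?thesis by auto
  qed
  then show thesis using that[of K "b - K"] K b by auto
qed

context prim_word
begin

text \<open>The lifts at \<open>i\<close> and \<open>j\<close> branch apart before these positions and after \<open>T\<close> common letters; the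
  branches at the two ends have the same cyclic orientation, seen from the common part, iff the lifts cross.\<close>

definition linked :: "int \<Rightarrow> int \<Rightarrow> bool" where
  "linked i j \<longleftrightarrow> e (i - 1) \<noteq> e (j - 1) \<and> (\<exists>T>0. (\<forall>t<T. e (i + int t) = e (j + int t)) \<and>
     e (i + int T) \<noteq> e (j + int T) \<and>
     (ccw (e i) (bar (e (i - 1))) (bar (e (j - 1))) \<longleftrightarrow>
      ccw (bar (e (i + int T - 1))) (e (i + int T)) (e (j + int T))))"

text \<open>Natural indices allow the blocks to be enumerated; other positions are reached by
  periodicity. Block 0 has no indexed predecessor, which explains conditions such as
  \<open>k0 > 0\<close> below.\<close>

definition starts :: "nat set" where
  "starts = {i. e (int i - 1) \<noteq> e (int i)}"

definition bs :: "nat \<Rightarrow> int" where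
  "bs k = int (enumerate starts k)"

definition bl :: "nat \<Rightarrow> letter" where
  "bl k = e (bs k)"

definition ex :: "nat \<Rightarrow> nat" where
  "ex k = nat (bs (Suc k) - bs k)"

lemma image_filter_aux: "f ` S = T \<Longrightarrow> (\<And>i. P (f i) \<longleftrightarrow> Q i) \<Longrightarrow> f ` {i \<in> S. Q i} = {i \<in> T. P i}"
  by auto

lemma card_window:
  "card {i \<in> {m..<m + int L}. R (e (i - 1)) (e i)} = card {i \<in> {0..<int L}. R (e (i - 1)) (e i)}"
proof -
  have inj: "inj_on (\<lambda>i. i mod int L) {m..<m + int L}"
  proof (rule inj_onI)
    fix x y assume *: "x \<in> {m..<m + int L}" "y \<in> {m..<m + int L}" "x mod int L = y mod int L"
    then have "int L dvd (x - y)" by (simp add: mod_eq_dvd_iff)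
    moreover have "\<bar>x - y\<bar> < int L" using * by auto
    ultimately show "x = y" using dvd_small[of "x - y"] by simp
  qed
  have "(\<lambda>i. i mod int L) ` {m..<m + int L} = {0..<int L}"
  proof (rule card_subset_eq)
    show "(\<lambda>i. i mod int L) ` {m..<m + int L} \<subseteq> {0..<int L}" using L_pos by auto
    show "card ((\<lambda>i. i mod int L) ` {m..<m + int L}) = card {0..<int L}" using card_image[OF inj] by simp
  qed simp
  moreover have "R (e (i mod int L - 1)) (e (i mod int L)) \<longleftrightarrow> R (e (i - 1)) (e i)" for i
    by (simp only: e_mod_prev e_mod)
  ultimately have im: "(\<lambda>i. i mod int L) ` {i \<in> {m..<m + int L}. R (e (i - 1)) (e i)} = {i \<in> {0..<int L}. R (e (i - 1)) (e i)}"
    by (rule image_filter_aux[where P = "\<lambda>i. R (e (i - 1)) (e i)"])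
  have "inj_on (\<lambda>i. i mod int L) {i \<in> {m..<m + int L}. R (e (i - 1)) (e i)}"
    using inj by (rule inj_on_subset) blast
  from card_image[OF this] show ?thesis unfolding im by (rule sym)
qed

lemma card_starts: "card {i \<in> {m..<m + int L}. e (i - 1) \<noteq> e i} = 2 * switches"
proof -
  have "{(x, y). x \<noteq> y} = Sigma (UNIV :: letter set) (\<lambda>x. UNIV - {x})" by auto
  then have "card {i \<in> {m..<m + int L}. e (i - 1) \<noteq> e i} = (\<Sum>x\<in>UNIV. \<Sum>y\<in>UNIV - {x}. cnt x y)"
    unfolding card_window[of m "\<lambda>x y. x \<noteq> y"] card_pairs[of "\<lambda>x y. x \<noteq> y"]
    by (simp add: sum.Sigma)
  then show ?thesis unfolding sum_UNIV_letter UNIV_letter_diff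
    using flows switches_cnt by (simp add: cnt_zero)
qed

end

locale switching_word = prim_word +
  assumes switches_pos: "switches > 0"
begin

abbreviation "N \<equiv> 2 * switches"

lemma start_shift: "e (i - 1 + int L * c) \<noteq> e (i + int L * c) \<longleftrightarrow> e (i - 1) \<noteq> e i"
  using periodic_mult by simp

lemma infinite_starts: "infinite starts"
proof -
  have "{i \<in> {0..<0 + int L}. e (i - 1) \<noteq> e i} \<noteq> {}"
  proof
    assume "{i \<in> {0..<0 + int L}. e (i - 1) \<noteq> e i} = {}"
    then show False using card_starts[of 0] switches_pos by (simp only: card.empty)
  qed
  then obtain i where i: "0 \<le> i" "i < int L" "e (i - 1) \<noteq> e i" by auto
  have "nat i + L * m \<in> starts" for m
    using start_shift[of i "int m"] i by (simp add: starts_def algebra_simps)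
  then have "range (\<lambda>m. nat i + L * m) \<subseteq> starts" by blast
  moreover have "infinite (range (\<lambda>m. nat i + L * m))"
    using L_pos by (intro range_inj_infinite) (auto simp: inj_def)
  ultimately show ?thesis using infinite_super by blast
qed

lemma bs_less: "k < l \<Longrightarrow> bs k < bs l"
  using strict_mono_enumerate[OF infinite_starts] by (simp add: bs_def strict_mono_def)

lemma bs_less_iff: "bs k < bs l \<longleftrightarrow> k < l"
  by (metis bs_less linorder_neq_iff order_less_asym)

lemma bs_le_iff: "bs k \<le> bs l \<longleftrightarrow> k \<le> l"
  using bs_less_iff[of l k] by (simp add: not_less[symmetric])

lemma bs_eq_iff: "bs k = bs l \<longleftrightarrow> k = l"
  using bs_le_iff[of k l] bs_le_iff[of l k] by auto

lemma bs_nonneg: "bs k \<ge> 0"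
  by (simp add: bs_def)

lemma bs_start: "e (bs k - 1) \<noteq> e (bs k)"
  using enumerate_in_set[OF infinite_starts, of k] by (simp add: starts_def bs_def)

lemma start_bs: "0 \<le> i \<Longrightarrow> e (i - 1) \<noteq> e i \<Longrightarrow> \<exists>k. i = bs k"
proof -
  assume "0 \<le> i" "e (i - 1) \<noteq> e i"
  then have "nat i \<in> starts" by (simp add: starts_def)
  then obtain k where "enumerate starts k = nat i" using enumerate_Ex[OF infinite_starts] by blast
  then have "i = bs k" using \<open>0 \<le> i\<close> by (simp add: bs_def)
  then show ?thesis by blast
qed

lemma ex: "bs (Suc k) = bs k + int (ex k)" "ex k > 0"
  using bs_less[of k "Suc k"] by (auto simp: ex_def)

lemma block_const:
  assumes "bs k \<le> i" "i < bs (Suc k)" shows "e i = bl k"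
proof -
  have "e (bs k + int m) = bl k" if "bs k + int m < bs (Suc k)" for m
    using that
  proof (induction m)
    case (Suc m)
    show ?case
    proof (rule ccontr)
      assume "e (bs k + int (Suc m)) \<noteq> bl k"
      then have "e (bs k + int (Suc m) - 1) \<noteq> e (bs k + int (Suc m))" using Suc by auto
      then obtain l where l: "bs k + int (Suc m) = bs l" using start_bs bs_nonneg[of k] by (metis add_nonneg_nonneg of_nat_0_le_iff)
      then have "bs k < bs l" "bs l < bs (Suc k)" using Suc.prems by linarith+
      then show False using bs_less_iff by auto
    qed
  qed (simp add: bl_def)
  from this[of "nat (i - bs k)"] show ?thesis using assms by simp
qed

lemma bs_prev: "e (bs (Suc k) - 1) = bl k"
  using block_const[of k "bs (Suc k) - 1"] bs_less[of k "Suc k"] by simp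

lemma horizontal_Suc: "horizontal (bl (Suc k)) \<noteq> horizontal (bl k)"
  using neq_horizontal[of "bl k" "bl (Suc k)"] bs_start[of "Suc k"] red'(1)[of "bs (Suc k)"]
  unfolding bs_prev bl_def[of "Suc k", symmetric] by auto

lemma horizontal_add: "horizontal (bl (k + d)) = horizontal (bl k) \<longleftrightarrow> even d"
  by (induction d) (use horizontal_Suc in auto)

lemma bs_period: "bs (k + N) = bs k + int L"
proof -
  have "e (bs k + int L - 1) \<noteq> e (bs k + int L)" using start_shift[of "bs k" 1] bs_start[of k] by (simp add: algebra_simps)
  then obtain k' where k': "bs k + int L = bs k'" using start_bs bs_nonneg[of k] by (metis add_nonneg_nonneg of_nat_0_le_iff)
  have "{i \<in> {bs k..<bs k + int L}. e (i - 1) \<noteq> e i} = bs ` {k..<k'}"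
  proof (intro set_eqI iffI)
    fix i assume i: "i \<in> {i \<in> {bs k..<bs k + int L}. e (i - 1) \<noteq> e i}"
    then obtain l where l: "i = bs l" using start_bs[of i] bs_nonneg[of k] by auto
    then have "k \<le> l" "l < k'" using i k' bs_le_iff[of k l] bs_less_iff[of l k'] by auto
    then show "i \<in> bs ` {k..<k'}" using l by auto
  next
    fix i assume "i \<in> bs ` {k..<k'}"
    then show "i \<in> {i \<in> {bs k..<bs k + int L}. e (i - 1) \<noteq> e i}"
      using bs_start bs_le_iff bs_less_iff k' by auto
  qed
  then have "card (bs ` {k..<k'}) = N" using card_starts[of "bs k"] by simp
  moreover have "inj_on bs {k..<k'}" by (simp add: inj_on_def bs_eq_iff)
  ultimately have "k' - k = N" by (simp add: card_image)
  moreover have "k \<le> k'" using k' bs_le_iff[of k k'] by linarith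
  ultimately have "k' = k + N" by linarith
  then show ?thesis using k' by simp
qed

lemma bl_period: "bl (k + N) = bl k"
  using periodic[of "bs k"] by (simp add: bl_def bs_period)

lemma ex_period: "ex (k + N) = ex k"
  using bs_period[of k] bs_period[of "Suc k"] by (simp add: ex_def)

text \<open>The right end of the overlap of the lifts at the starts of blocks \<open>k\<close> and
  \<open>l\<close>. Equal blocks are passed one by one until the block of the second lift is longer
  or has the wrong sign; then \<open>ccw_right\<close> applies. An empty overlap occurs only if
  \<open>bl l\<close> already has the wrong sign.\<close>

lemma right_comparison:
  assumes "\<And>t. t < q \<Longrightarrow> bl (k + t) = bl (l + t) \<and> ex (k + t) = ex (l + t) \<and> pos (bl (k + t)) = \<sigma>"
    and "horizontal (bl k) = horizontal (bl l)"
    and "pos (bl l) = \<sigma> \<or> e (bs k - 1) = e (bs l - 1) \<and> pos (e (bs k - 1)) = \<sigma> \<and> horizontal (e (bs k - 1)) \<noteq> horizontal (bl k)"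
    and "pos (bl (k + q)) = \<sigma>" "pos (bl (l + q)) \<noteq> \<sigma> \<or> ex (k + q) < ex (l + q)"
  shows "\<exists>T. (\<forall>t<T. e (bs k + int t) = e (bs l + int t)) \<and> e (bs k + int T) \<noteq> e (bs l + int T) \<and>
    (ccw (bar (e (bs k + int T - 1))) (e (bs k + int T)) (e (bs l + int T)) \<longleftrightarrow> \<not> \<sigma>) \<and> (T > 0 \<or> pos (bl l) \<noteq> \<sigma>)"
  using assms
proof (induction q arbitrary: k l)
  case 0
  show ?case
  proof (cases "pos (bl l) = \<sigma>")
    case True
    then have lt: "ex k < ex l" using "0.prems" by simp
    have blk: "bl k = bl l" using letter_eqI[of "bl k" "bl l"] "0.prems" True by simp
    have eq: "e (bs k + int t) = e (bs l + int t)" if "t < ex k" for t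
      using block_const[of k "bs k + int t"] block_const[of l "bs l + int t"] that lt ex(1)[of k] ex(1)[of l] blk by simp
    have 1: "e (bs k + int (ex k) - 1) = bl k" "e (bs k + int (ex k)) = bl (Suc k)"
      using bs_prev[of k] by (simp_all add: ex(1)[symmetric] bl_def)
    have 2: "e (bs l + int (ex k)) = bl k"
      using block_const[of l "bs l + int (ex k)"] lt ex(1)[of l] blk by simp
    have "bl (Suc k) \<noteq> bl k" using horizontal_Suc[of k] by auto
    moreover have "ccw (bar (bl k)) (bl (Suc k)) (bl k) \<longleftrightarrow> \<not> \<sigma>"
      using ccw_right[of "bl (Suc k)" "bl k" "bl k"] horizontal_Suc[of k] "0.prems" by simp
    ultimately show ?thesis using eq 1 2 ex(2)[of k] by (intro exI[of _ "ex k"]) simp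
  next
    case False
    then have prev: "pos (e (bs k - 1)) = \<sigma>" "horizontal (e (bs k - 1)) \<noteq> horizontal (bl k)"
      using "0.prems" by auto
    have "ccw (bar (e (bs k - 1))) (bl k) (bl l) \<longleftrightarrow> \<not> \<sigma>"
      using ccw_right[of "bl k" "e (bs k - 1)" "bl l"] prev "0.prems" False by auto
    moreover have "bl k \<noteq> bl l" using "0.prems" False by auto
    ultimately show ?thesis using False by (intro exI[of _ 0]) (simp add: bl_def)
  qed
next
  case (Suc q)
  have h: "bl k = bl l" "ex k = ex l" "pos (bl k) = \<sigma>" using Suc.prems(1)[of 0] by auto
  have "\<exists>T. (\<forall>t<T. e (bs (Suc k) + int t) = e (bs (Suc l) + int t)) \<and> e (bs (Suc k) + int T) \<noteq> e (bs (Suc l) + int T) \<and>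
    (ccw (bar (e (bs (Suc k) + int T - 1))) (e (bs (Suc k) + int T)) (e (bs (Suc l) + int T)) \<longleftrightarrow> \<not> \<sigma>) \<and>
    (T > 0 \<or> pos (bl (Suc l)) \<noteq> \<sigma>)"
  proof (rule Suc.IH)
    show "bl (Suc k + t) = bl (Suc l + t) \<and> ex (Suc k + t) = ex (Suc l + t) \<and> pos (bl (Suc k + t)) = \<sigma>" if "t < q" for t
      using Suc.prems(1)[of "Suc t"] that by auto
    show "horizontal (bl (Suc k)) = horizontal (bl (Suc l))" using horizontal_Suc[of k] horizontal_Suc[of l] h by auto
    show "pos (bl (Suc l)) = \<sigma> \<or> e (bs (Suc k) - 1) = e (bs (Suc l) - 1) \<and> pos (e (bs (Suc k) - 1)) = \<sigma> \<and>
        horizontal (e (bs (Suc k) - 1)) \<noteq> horizontal (bl (Suc k))"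
      using h horizontal_Suc[of k] by (simp add: bs_prev)
  qed (use Suc.prems in auto)
  then obtain T where T: "\<forall>t<T. e (bs (Suc k) + int t) = e (bs (Suc l) + int t)" "e (bs (Suc k) + int T) \<noteq> e (bs (Suc l) + int T)"
    "ccw (bar (e (bs (Suc k) + int T - 1))) (e (bs (Suc k) + int T)) (e (bs (Suc l) + int T)) \<longleftrightarrow> \<not> \<sigma>" by blast
  have sh: "bs (Suc k) = bs k + int (ex k)" "bs (Suc l) = bs l + int (ex k)" using ex(1) h by auto
  have "e (bs k + int t) = e (bs l + int t)" if "t < ex k + T" for t
  proof (cases "t < ex k")
    case True
    then show ?thesis
      using block_const[of k "bs k + int t"] block_const[of l "bs l + int t"] ex(1)[of k] ex(1)[of l] h by simp
  next
    case False
    then have "t - ex k < T" using that by simp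
    then show ?thesis using T(1)[rule_format, of "t - ex k"] False unfolding sh by (simp add: of_nat_diff)
  qed
  then show ?case using T(2,3) ex(2)[of k] unfolding sh
    by (intro exI[of _ "ex k + T"]) (simp add: algebra_simps)
qed

text \<open>The first lift is still inside its block at the left end and leaves it first at the
  right end. With \<open>l = k\<close> this gives the crossings of a block with itself.\<close>

lemma linked_interior_long:
  assumes "bs k < i" "i < bs (Suc k)" "bl l = bl k" "bs (Suc k) - i < int (ex l)"
    and "horizontal (e (bs l - 1)) \<noteq> horizontal (bl l)"
  shows "linked i (bs l)"
proof -
  define m where "m = nat (bs (Suc k) - i)"
  have m: "m > 0" "int m = bs (Suc k) - i" "int m < int (ex l)" using assms by (auto simp: m_def)
  have c: "e i = bl k" "e (i - 1) = bl k" using block_const[of k] assms by auto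
  have eq: "e (i + int t) = e (bs l + int t)" if "t < m" for t
    using block_const[of k "i + int t"] block_const[of l "bs l + int t"] assms m that ex(1)[of l] by simp
  have 1: "e (i + int m - 1) = bl k" "e (i + int m) = bl (Suc k)" "e (bs l + int m) = bl k"
    using m bs_prev[of k] block_const[of l "bs l + int m"] ex(1)[of l] assms(3) by (simp_all add: bl_def)
  have "ccw (bl k) (bar (bl k)) (bar (e (bs l - 1))) \<longleftrightarrow> \<not> pos (bl k)"
    using assms(3,5) by (intro ccw_left) auto
  moreover have "ccw (bar (bl k)) (bl (Suc k)) (bl k) \<longleftrightarrow> \<not> pos (bl k)"
    using horizontal_Suc by (intro ccw_right) auto
  moreover have "bl (Suc k) \<noteq> bl k" using horizontal_Suc[of k] by auto
  moreover have "bl k \<noteq> e (bs l - 1)" using assms(3,5) by auto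
  ultimately show ?thesis unfolding linked_def using c 1 eq m(1) by (auto intro!: exI[of _ m])
qed

text \<open>Here the rest of block \<open>k\<close> is as long as block \<open>l\<close>, so both
  end together and the blocks that follow decide, by \<open>right_comparison\<close>.\<close>

lemma linked_interior_equal:
  assumes "bs k < i" "i < bs (Suc k)" "bl l = bl k" "bs (Suc k) - i = int (ex l)" "pos (bl k) = \<sigma>"
    and "horizontal (e (bs l - 1)) \<noteq> horizontal (bl l)"
    and q: "\<And>t. t < q \<Longrightarrow> bl (Suc k + t) = bl (Suc l + t) \<and> ex (Suc k + t) = ex (Suc l + t) \<and> pos (bl (Suc k + t)) = \<sigma>"
    "pos (bl (Suc k + q)) = \<sigma>" "pos (bl (Suc l + q)) \<noteq> \<sigma> \<or> ex (Suc k + q) < ex (Suc l + q)"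
  shows "linked i (bs l)"
proof -
  define m where "m = ex l"
  have m: "m > 0" "int m = bs (Suc k) - i" using assms ex(2)[of l] by (auto simp: m_def)
  have c: "e i = bl k" "e (i - 1) = bl k" using block_const[of k] assms by auto
  have "horizontal (bl (Suc k)) = horizontal (bl (Suc l))" using horizontal_Suc[of k] horizontal_Suc[of l] assms(3) by auto
  moreover have "e (bs (Suc k) - 1) = e (bs (Suc l) - 1) \<and> pos (e (bs (Suc k) - 1)) = \<sigma> \<and>
      horizontal (e (bs (Suc k) - 1)) \<noteq> horizontal (bl (Suc k))"
    using assms(3,5) horizontal_Suc[of k] by (simp add: bs_prev)
  ultimately obtain T where T: "\<forall>t<T. e (bs (Suc k) + int t) = e (bs (Suc l) + int t)" "e (bs (Suc k) + int T) \<noteq> e (bs (Suc l) + int T)"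
    "ccw (bar (e (bs (Suc k) + int T - 1))) (e (bs (Suc k) + int T)) (e (bs (Suc l) + int T)) \<longleftrightarrow> \<not> \<sigma>"
    using right_comparison[of q "Suc k" "Suc l" \<sigma>] q by blast
  have sh: "bs (Suc k) = i + int m" "bs (Suc l) = bs l + int m" using m ex(1)[of l] by (auto simp: m_def)
  have eq: "e (i + int t) = e (bs l + int t)" if "t < m + T" for t
  proof (cases "t < m")
    case True
    then show ?thesis
      using block_const[of k "i + int t"] block_const[of l "bs l + int t"] assms(1,3) sh by simp
  next
    case False
    then have "t - m < T" using that by simp
    then show ?thesis using T(1)[rule_format, of "t - m"] False unfolding sh by (simp add: of_nat_diff)
  qed
  have "ccw (bl k) (bar (bl k)) (bar (e (bs l - 1))) \<longleftrightarrow> \<not> \<sigma>"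
    using assms(3,5,6) ccw_left[of "e (bs l - 1)" "bl k" "bl k"] by auto
  moreover have "bl k \<noteq> e (bs l - 1)" using assms(3,6) by auto
  ultimately show ?thesis unfolding linked_def using c eq m(1) T(2,3) unfolding sh
    by (intro conjI exI[of _ "m + T"]) (auto simp: algebra_simps)
qed

text \<open>The branching at the left end comes from a change of sign before block
  \<open>Suc k\<close> without counterpart before block \<open>Suc l\<close>.\<close>

lemma linked_starts:
  assumes "pos (bl (Suc k)) = \<sigma>" "pos (bl k) \<noteq> \<sigma>" "pos (bl (Suc l)) = \<sigma>" "pos (bl l) = \<sigma>" "horizontal (bl k) = horizontal (bl l)"
    and q: "\<And>t. t < q \<Longrightarrow> bl (Suc k + t) = bl (Suc l + t) \<and> ex (Suc k + t) = ex (Suc l + t) \<and> pos (bl (Suc k + t)) = \<sigma>"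
    "pos (bl (Suc k + q)) = \<sigma>" "pos (bl (Suc l + q)) \<noteq> \<sigma> \<or> ex (Suc k + q) < ex (Suc l + q)"
  shows "linked (bs (Suc k)) (bs (Suc l))"
proof -
  have h: "horizontal (bl (Suc k)) = horizontal (bl (Suc l))" using horizontal_Suc[of k] horizontal_Suc[of l] assms(5) by auto
  obtain T where T: "\<forall>t<T. e (bs (Suc k) + int t) = e (bs (Suc l) + int t)" "e (bs (Suc k) + int T) \<noteq> e (bs (Suc l) + int T)"
    "ccw (bar (e (bs (Suc k) + int T - 1))) (e (bs (Suc k) + int T)) (e (bs (Suc l) + int T)) \<longleftrightarrow> \<not> \<sigma>" "T > 0"
    using right_comparison[of q "Suc k" "Suc l" \<sigma>] q h assms(3) by blast
  have "ccw (bl (Suc k)) (bar (bl k)) (bar (bl l)) \<longleftrightarrow> \<not> \<sigma>"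
    using ccw_left[of "bl l" "bl (Suc k)" "bl k"] assms horizontal_Suc[of k] by auto
  moreover have "bl k \<noteq> bl l" using assms by auto
  ultimately show ?thesis unfolding linked_def bs_prev using T by (auto simp: bl_def[symmetric])
qed

end

section \<open>The lower bound\<close>

context switching_word
begin

text \<open>Blocks of the opposite sign count as infinitely long, so that the ends of a run of equal signs behave
  like a descent and an ascent.\<close>

definition V :: "bool \<Rightarrow> nat \<Rightarrow> enat" where
  "V \<sigma> k = (if pos (bl k) = \<sigma> then enat (ex k) else \<infinity>)"

lemma horizontal_bs_prev: "k > 0 \<Longrightarrow> horizontal (e (bs k - 1)) \<noteq> horizontal (bl k)"
  using bs_prev[of "k - 1"] horizontal_Suc[of "k - 1"] by simp

text \<open>As \<open>d\<close> is even, blocks \<open>K\<close> and \<open>K + d\<close> are of the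
  same type. If block \<open>K\<close> has sign \<sigma>, the overlap begins inside it, where as
  many letters remain as block \<open>K + d\<close> has. If not, \<open>K\<close> is the last block
  before a run of sign \<sigma>, and the overlap begins with that run.\<close>

lemma descent_ascent_linked:
  assumes d: "even d" and q: "q > 0"
    and desc: "V \<sigma> (K + d) < V \<sigma> K" and asc: "V \<sigma> (K + q) < V \<sigma> (K + q + d)"
    and eq: "\<And>t. 0 < t \<Longrightarrow> t < q \<Longrightarrow> V \<sigma> (K + t) = V \<sigma> (K + t + d) \<and> V \<sigma> (K + t) \<noteq> \<infinity>"
    and d0: "d > 0"
  shows "pos (bl K) = \<sigma> \<Longrightarrow> \<exists>i. bs K < i \<and> i < bs (Suc K) \<and> linked i (bs (K + d))"
    and "pos (bl K) \<noteq> \<sigma> \<Longrightarrow> pos (bl (Suc K + d)) = \<sigma> \<Longrightarrow> linked (bs (Suc K)) (bs (Suc K + d))"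
proof -
  have pKd: "pos (bl (K + d)) = \<sigma>" using desc by (auto simp: V_def split: if_splits)
  have mid: "bl (Suc K + t) = bl (Suc (K + d) + t) \<and> ex (Suc K + t) = ex (Suc (K + d) + t) \<and> pos (bl (Suc K + t)) = \<sigma>"
    if "t < q - 1" for t
  proof -
    have "V \<sigma> (K + Suc t) = V \<sigma> (K + Suc t + d) \<and> V \<sigma> (K + Suc t) \<noteq> \<infinity>"
      using that by (intro eq) auto
    moreover have "Suc K + t = K + Suc t" by simp
    ultimately have v: "V \<sigma> (Suc K + t) = V \<sigma> (Suc K + t + d)" "V \<sigma> (Suc K + t) \<noteq> \<infinity>"
      by (metis, metis)
    then have p: "pos (bl (Suc K + t)) = \<sigma>" "pos (bl (Suc K + t + d)) = \<sigma>" "ex (Suc K + t) = ex (Suc K + t + d)"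
      by (auto simp: V_def split: if_splits)
    have "bl (Suc K + t + d) = bl (Suc K + t)"
      using horizontal_add[of "Suc K + t" d] d p by (intro letter_eqI) auto
    then show ?thesis using p by (simp add: add.commute add.left_commute)
  qed
  have pq: "pos (bl (Suc K + (q - 1))) = \<sigma>" using asc q by (auto simp: V_def split: if_splits)
  have aq: "pos (bl (Suc (K + d) + (q - 1))) \<noteq> \<sigma> \<or> ex (Suc K + (q - 1)) < ex (Suc (K + d) + (q - 1))"
  proof -
    have s: "Suc K + (q - 1) = K + q" "Suc (K + d) + (q - 1) = K + q + d" using q by auto
    show ?thesis unfolding s using asc pq[unfolded s] by (auto simp: V_def split: if_splits)
  qed
  have hz: "horizontal (bl (K + d)) = horizontal (bl K)" using horizontal_add d by blast
  show "\<exists>i. bs K < i \<and> i < bs (Suc K) \<and> linked i (bs (K + d))" if pK: "pos (bl K) = \<sigma>"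
  proof -
    have lt: "ex (K + d) < ex K" using desc pK pKd by (simp add: V_def)
    define i where "i = bs (Suc K) - int (ex (K + d))"
    have i: "bs K < i" "i < bs (Suc K)" "bs (Suc K) - i = int (ex (K + d))"
      using lt ex(1)[of K] ex(2)[of "K + d"] by (auto simp: i_def)
    have "bl (K + d) = bl K" using hz pK pKd by (intro letter_eqI) auto
    then have "linked i (bs (K + d))"
      using linked_interior_equal[OF i(1,2) _ i(3) pK horizontal_bs_prev, of "q - 1"] mid pq aq d0 by blast
    then show ?thesis using i by blast
  qed
  show "linked (bs (Suc K)) (bs (Suc K + d))" if "pos (bl K) \<noteq> \<sigma>" "pos (bl (Suc K + d)) = \<sigma>"
  proof -
    have "pos (bl (Suc K)) = \<sigma>"
    proof (cases "q = 1")
      case False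
      then have "0 < q - 1" using q by simp
      then show ?thesis using mid[of 0] by (metis add_0_right)
    qed (use pq in simp)
    moreover have "pos (bl (Suc (K + d))) = \<sigma>" using that(2) by simp
    ultimately have "linked (bs (Suc K)) (bs (Suc (K + d)))"
      using that(1) pKd hz[symmetric] mid pq aq by (intro linked_starts[of K \<sigma> "K + d" "q - 1"])
    then show ?thesis by simp
  qed
qed

lemma block_unique:
  assumes "bs K \<le> i" "i < bs (Suc K)" "bs K' \<le> i" "i < bs (Suc K')" shows "K = K'"
proof -
  have "bs K < bs (Suc K')" "bs K' < bs (Suc K)" using assms by linarith+
  then show ?thesis unfolding bs_less_iff by simp
qed

lemma bs_period_mult: "bs (k + N * c) = bs k + int L * int c"
proof (induction c)
  case (Suc c)
  then show ?case using bs_period[of "k + N * c"] by (simp add: algebra_simps)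
qed simp

lemma block_cong:
  assumes "int L dvd (i - i')" "bs K \<le> i" "i < bs (Suc K)" "bs K' \<le> i'" "i' < bs (Suc K')"
  shows "K mod N = K' mod N"
proof -
  have aux: "K = K' + N * c"
    if "i = i' + int L * int c" "bs K \<le> i" "i < bs (Suc K)" "bs K' \<le> i'" "i' < bs (Suc K')" for i i' K K' c
    using block_unique[of K i "K' + N * c"] that bs_period_mult[of K' c] bs_period_mult[of "Suc K'" c] by simp
  obtain c where c: "i - i' = int L * c" using assms(1) by (elim dvdE)
  show ?thesis
  proof (cases "c \<ge> 0")
    case True
    then have "K = K' + N * nat c" using aux[of i i' "nat c" K K'] c assms by simp
    then show ?thesis by simp
  next
    case False
    then have "K' = K + N * nat (- c)" using aux[of i' i "nat (- c)" K' K] c assms by simp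
    then show ?thesis by simp
  qed
qed

text \<open>The first index lies strictly inside a block and the second at its start; this asymmetry
  helps to exclude that two chosen pairs agree after an exchange.\<close>

definition self_pairs :: "nat \<Rightarrow> (int \<times> int) set" where
  "self_pairs k0 = (\<lambda>(K, i). (i, bs K)) ` (SIGMA K:{k0..<k0 + N}. {bs K<..<bs (Suc K)})"

lemma self_pairsE:
  assumes "(i, j) \<in> self_pairs k0"
  obtains K where "K \<in> {k0..<k0 + N}" "bs K < i" "i < bs (Suc K)" "j = bs K"
  using assms unfolding self_pairs_def by auto

lemma sum_ex: "(\<Sum>K = k0..<k0 + m. int (ex K)) = bs (k0 + m) - bs k0"
  by (induction m) (simp_all add: ex(1))

lemma card_self_pairs: "card (self_pairs k0) = L - N" and finite_self_pairs: "finite (self_pairs k0)"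
proof -
  have "inj_on (\<lambda>(K, i). (i, bs K)) (SIGMA K:{k0..<k0 + N}. {bs K<..<bs (Suc K)})"
    by (auto simp: inj_on_def bs_eq_iff)
  then have "card (self_pairs k0) = card (SIGMA K:{k0..<k0 + N}. {bs K<..<bs (Suc K)})"
    unfolding self_pairs_def by (rule card_image)
  also have "\<dots> = (\<Sum>K = k0..<k0 + N. ex K - 1)"
  proof -
    have "card {bs K<..<bs (Suc K)} = ex K - 1" for K using ex(1)[of K] by simp
    then show ?thesis by simp
  qed
  finally have "int (card (self_pairs k0)) = (\<Sum>K = k0..<k0 + N. int (ex K - 1))" by simp
  also have "\<dots> = (\<Sum>K = k0..<k0 + N. int (ex K) - 1)"
    using ex(2) by (intro sum.cong) (auto simp: of_nat_diff Suc_leI)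
  also have "\<dots> = int L - int N" by (simp add: sum_subtractf sum_ex bs_period)
  finally show "card (self_pairs k0) = L - N" by linarith
  show "finite (self_pairs k0)" unfolding self_pairs_def by auto
qed

lemma interior_letter: "bs K < i \<Longrightarrow> i < bs (Suc K) \<Longrightarrow> e (i - 1) = e i"
  using block_const[of K i] block_const[of K "i - 1"] by simp

lemma self_pairs_linked:
  assumes "(i, j) \<in> self_pairs k0" "k0 > 0" shows "linked i j"
proof -
  obtain K where K: "K \<in> {k0..<k0 + N}" "bs K < i" "i < bs (Suc K)" "j = bs K"
    using self_pairsE[OF assms(1)] by blast
  have "horizontal (e (bs K - 1)) \<noteq> horizontal (bl K)" using horizontal_bs_prev[of K] K(1) assms(2) by auto
  then show ?thesis using linked_interior_long[OF K(2,3) refl] K ex(1)[of K] by simp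
qed

lemma linked_cong_letter: "int L dvd (i - j) \<Longrightarrow> e i = e j \<and> e (i - 1) = e (j - 1)"
  using e_cong[of i j 0] e_cong[of i j "-1"] by simp

text \<open>If the block lengths were invariant under the shift, so would be the letters, as
  \<open>d\<close> is even and the sign constant, and the whole word would have the period \<delta>,
  which is shorter than L.\<close>

lemma shift_not_invariant:
  assumes sign: "\<And>k. pos (bl k) = \<sigma>" and d: "even d" "0 < d" "d < N"
  shows "\<exists>k. ex k \<noteq> ex (k + d)"
proof (rule ccontr)
  assume "\<not> ?thesis"
  then have eqd: "ex (k + d) = ex k" for k by auto
  have bld: "bl (k + d) = bl k" for k using horizontal_add d sign by (intro letter_eqI) auto
  define \<delta> where "\<delta> = bs d - bs 0"
  have bsd: "bs (k + d) = bs k + \<delta>" for k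
    by (induction k) (simp_all add: \<delta>_def ex(1) eqd)
  have "e (i + \<delta>) = e i" for i
  proof -
    \<comment> \<open>A translate of i by a multiple of the period, far enough to the right to lie
      in an enumerated block.\<close>
    define i' where "i' = i + int L * (\<bar>i\<bar> + bs 0)"
    have "1 * (\<bar>i\<bar> + bs 0) \<le> int L * (\<bar>i\<bar> + bs 0)"
      using L_pos bs_nonneg[of 0] by (intro mult_right_mono) auto
    then have "bs 0 \<le> i'" by (simp add: i'_def)
    define k where "k = (GREATEST k. bs k \<le> i')"
    have bnd: "bs m \<le> i' \<Longrightarrow> m \<le> nat i'" for m
    proof -
      have "int m \<le> bs m"
      proof (induction m)
        case (Suc m)
        then show ?case using ex[of m] by simp
      qed (simp add: bs_nonneg)
      then show "bs m \<le> i' \<Longrightarrow> m \<le> nat i'" by linarith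
    qed
    have k: "bs k \<le> i'" "i' < bs (Suc k)"
      using GreatestI_nat[of "\<lambda>k. bs k \<le> i'" 0 "nat i'"] bnd \<open>bs 0 \<le> i'\<close>
        Greatest_le_nat[of "\<lambda>k. bs k \<le> i'" "Suc k" "nat i'"] unfolding k_def[symmetric]
      by (auto simp: not_le[symmetric])
    have "e (i' + \<delta>) = bl (k + d)"
      using k bsd[of k] bsd[of "Suc k"] by (intro block_const) auto
    also have "\<dots> = e i'" using block_const[OF k] bld by simp
    finally have "e (i' + \<delta>) = e i'" .
    then show ?thesis using periodic_mult[of "i + \<delta>" "\<bar>i\<bar> + bs 0"] periodic_mult[of i "\<bar>i\<bar> + bs 0"]
      by (simp add: i'_def algebra_simps)
  qed
  then have "int L dvd \<delta>" by (rule prim)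
  moreover have "0 < \<delta>" "\<delta> < int L"
    using bs_less[of 0 d] bs_less[of d N] d bs_period[of 0] by (auto simp: \<delta>_def)
  ultimately show False using zdvd_imp_le by fastforce
qed

text \<open>The lengths and their shift have the same sum over a period but differ, so both a
  descent and an ascent occur; periodicity moves the ascent behind the descent.\<close>

lemma shift_linked:
  assumes sign: "\<And>k. pos (bl k) = \<sigma>" and d: "even d" "0 < d" "d < N"
  shows "\<exists>K i. bs K < i \<and> i < bs (Suc K) \<and> linked i (bs (K + d))"
proof -
  have exN: "ex (k + N * m) = ex k" for k m
  proof (induction m)
    case (Suc m)
    then show ?case using ex_period[of "k + N * m"] by (simp add: algebra_simps)
  qed simp
  have sums: "(\<Sum>k = 0..<N. int (ex (k + d))) = (\<Sum>k = 0..<N. int (ex k))"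
  proof -
    have "(\<Sum>k = 0..<N. int (ex (k + d))) = (\<Sum>k = d..<d + N. int (ex k))"
      using sum.shift_bounds_nat_ivl[of "\<lambda>k. int (ex k)" 0 d N] by (simp add: add.commute)
    then show ?thesis using sum_ex[of d N] sum_ex[of 0 N] bs_period[of d] bs_period[of 0] by simp
  qed
  have redN: "ex (k mod N) = ex k \<and> ex (k mod N + d) = ex (k + d)" for k
  proof -
    have "k = k mod N + N * (k div N)" by simp
    then show ?thesis using exN[of "k mod N" "k div N"] exN[of "k mod N + d" "k div N"]
      by (metis add.commute add.left_commute)
  qed
  obtain k1 where k1: "k1 < N" "ex k1 \<noteq> ex (k1 + d)"
    using shift_not_invariant[OF assms] redN switches_pos by (metis mod_less_divisor nat_0_less_mult_iff zero_less_numeral)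
  have both: "(\<exists>k. f k < g k) \<and> (\<exists>k. g k < f k)"
    if "(\<Sum>k = 0..<N. f k) = (\<Sum>k = 0..<N. g k)" "f k1 \<noteq> g k1" for f g :: "nat \<Rightarrow> int"
  proof -
    have one: "\<exists>k. f k < g k" if "(\<Sum>k = 0..<N. f k) = (\<Sum>k = 0..<N. g k)" "f k1 \<noteq> g k1" for f g :: "nat \<Rightarrow> int"
    proof (rule ccontr)
      assume no: "\<nexists>k. f k < g k"
      then have "g k1 < f k1" using that(2) by (meson linorder_neq_iff)
      then have "(\<Sum>k = 0..<N. g k) < (\<Sum>k = 0..<N. f k)"
        using k1(1) no by (intro sum_strict_mono_ex1) (auto simp: not_less)
      then show False using that(1) by simp
    qed
    show ?thesis using one[OF that] one[OF that(1)[symmetric] that(2)[symmetric]] by blast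
  qed
  have "int (ex (k1 + d)) \<noteq> int (ex k1)" using k1 by simp
  from both[of "\<lambda>k. int (ex (k + d))" "\<lambda>k. int (ex k)", OF sums this]
  obtain a0 a1 where a: "ex (a0 + d) < ex a0" "ex a1 < ex (a1 + d)" by auto
  define b where "b = a1 + N * (a0 + 1)"
  have "1 * (a0 + 1) \<le> N * (a0 + 1)" using switches_pos by (intro mult_right_mono) auto
  then have "a0 < b" by (simp add: b_def)
  have b: "ex b < ex (b + d)" using a(2) exN[of a1 "a0 + 1"] exN[of "a1 + d" "a0 + 1"] by (simp add: b_def ac_simps)
  have v: "V \<sigma> k = enat (ex k)" for k using sign by (simp add: V_def)
  have va: "V \<sigma> (a0 + d) < V \<sigma> a0" "V \<sigma> b < V \<sigma> (b + d)" using a(1) b by (simp_all add: v)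
  obtain K q where K: "q > 0" "V \<sigma> (K + d) < V \<sigma> K" "V \<sigma> (K + q) < V \<sigma> (K + q + d)"
    "\<And>t. 0 < t \<Longrightarrow> t < q \<Longrightarrow> V \<sigma> (K + t) = V \<sigma> (K + t + d)"
    using last_descent_before_ascent[of "V \<sigma>" a0 d b, OF va(1) va(2) \<open>a0 < b\<close>] by metis
  show ?thesis using descent_ascent_linked(1)[OF d(1) K(1,2,3) _ d(2) sign] K(4) v by auto
qed

lemma mod_N_add:
  assumes "K mod N = K' mod N" "(K + d) mod N = (K' + d') mod N" "d < N" "d' < N"
  shows "d = d'"
proof -
  have "int K mod int N = int K' mod int N" "int (K + d) mod int N = int (K' + d') mod int N"
    using assms(1,2) by (metis zmod_int)+
  then have "int N dvd (int K - int K')" "int N dvd (int (K + d) - int (K' + d'))"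
    unfolding mod_eq_dvd_iff by blast+
  then have "int N dvd ((int (K + d) - int (K' + d')) - (int K - int K'))" by (rule dvd_diff[rotated])
  then have "int N dvd (int d - int d')" by (simp add: algebra_simps)
  moreover have "\<bar>int d - int d'\<bar> < int N" using assms(3,4) by auto
  ultimately show ?thesis using zdvd_imp_le[of "int N" "\<bar>int d - int d'\<bar>"] by fastforce
qed

text \<open>Distinctness as unordered pairs of lifts, indices being taken modulo L; the form needed
  by \<open>card_le_primitive_self_int\<close>.\<close>

definition separated :: "(int \<times> int) set \<Rightarrow> bool" where
  "separated W \<longleftrightarrow> (\<forall>i j i' j'. (i, j) \<in> W \<longrightarrow> (i', j') \<in> W \<longrightarrow>
     int L dvd (i - i') \<and> int L dvd (j - j') \<or> int L dvd (i - j') \<and> int L dvd (j - i') \<longrightarrow> i = i' \<and> j = j')"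

text \<open>The crossing attached to m joins blocks at distance 2m, a number that can be recovered
  from the indices modulo L; self-crossings of blocks have distance 0. With n for
  \<open>switches\<close>, this makes (L - 2n) + (n - 1) pairs.\<close>

lemma lower_constant_sign:
  assumes sign: "\<And>k. pos (bl k) = \<sigma>"
  shows "\<exists>W. (\<forall>(i, j)\<in>W. linked i j) \<and>
    separated W \<and> int L - int switches - 1 \<le> int (card W)"
proof -
  have "\<forall>m\<in>{1..<switches}. \<exists>p. \<exists>K. bs K < fst p \<and> fst p < bs (Suc K) \<and> snd p = bs (K + 2 * m) \<and> linked (fst p) (snd p)"
  proof
    fix m assume "m \<in> {1..<switches}"
    then show "\<exists>p. \<exists>K. bs K < fst p \<and> fst p < bs (Suc K) \<and> snd p = bs (K + 2 * m) \<and> linked (fst p) (snd p)"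
      using shift_linked[of \<sigma> "2 * m"] sign by force
  qed
  then obtain f where f: "\<And>m. m \<in> {1..<switches} \<Longrightarrow>
      \<exists>K. bs K < fst (f m) \<and> fst (f m) < bs (Suc K) \<and> snd (f m) = bs (K + 2 * m) \<and> linked (fst (f m)) (snd (f m))"
    by metis
  define W where "W = self_pairs 1 \<union> f ` {1..<switches}"
  have W: "\<exists>K d. bs K < i \<and> i < bs (Suc K) \<and> j = bs (K + d) \<and> d < N \<and> linked i j \<and>
      (d = 0 \<and> K \<in> {1..<1 + N} \<or> (\<exists>m\<in>{1..<switches}. d = 2 * m \<and> (i, j) = f m))" if "(i, j) \<in> W" for i j
  proof -
    have "(i, j) \<in> self_pairs 1 \<or> (\<exists>m\<in>{1..<switches}. (i, j) = f m)" using that by (auto simp: W_def)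
    then show ?thesis
    proof
      assume s: "(i, j) \<in> self_pairs 1"
      obtain K where "K \<in> {1..<1 + N}" "bs K < i" "i < bs (Suc K)" "j = bs K" using self_pairsE[OF s] by metis
      then show ?thesis using self_pairs_linked[OF s] switches_pos by (intro exI[of _ K] exI[of _ 0]) auto
    next
      assume "\<exists>m\<in>{1..<switches}. (i, j) = f m"
      then obtain m where m: "m \<in> {1..<switches}" "(i, j) = f m" by blast
      then obtain K where "bs K < i" "i < bs (Suc K)" "j = bs (K + 2 * m)" "linked i j"
        using f[OF m(1)] by (metis fst_conv snd_conv)
      then show ?thesis using m by (intro exI[of _ K] exI[of _ "2 * m"]) auto
    qed
  qed
  have sep: "i = i' \<and> j = j'" if W2: "(i, j) \<in> W" "(i', j') \<in> W"
    and c: "int L dvd (i - i') \<and> int L dvd (j - j') \<or> int L dvd (i - j') \<and> int L dvd (j - i')" for i j i' j'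
  proof -
    obtain K d where K: "bs K < i" "i < bs (Suc K)" "j = bs (K + d)" "d < N"
      "d = 0 \<and> K \<in> {1..<1 + N} \<or> (\<exists>m\<in>{1..<switches}. d = 2 * m \<and> (i, j) = f m)" using W[OF W2(1)] by blast
    obtain K' d' where K': "bs K' < i'" "i' < bs (Suc K')" "j' = bs (K' + d')" "d' < N"
      "d' = 0 \<and> K' \<in> {1..<1 + N} \<or> (\<exists>m\<in>{1..<switches}. d' = 2 * m \<and> (i', j') = f m)" using W[OF W2(2)] by blast
    \<comment> \<open>An index inside a block is never congruent to a block start, so the pairs
      cannot agree after an exchange.\<close>
    have "\<not> int L dvd (i - j')"
      using linked_cong_letter[of i j'] interior_letter[OF K(1,2)] bs_start[of "K' + d'"] K'(3) by auto
    then have c: "int L dvd (i - i')" "int L dvd (j - j')" using c by auto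
    have "K mod N = K' mod N" using block_cong[OF c(1)] K K' by simp
    moreover have "(K + d) mod N = (K' + d') mod N"
      using block_cong[OF c(2), of "K + d" "K' + d'"] K(3) K'(3) bs_less by simp
    ultimately have dd: "d = d'" using K(4) K'(4) by (rule mod_N_add)
    show ?thesis
    proof (cases "d = 0")
      case True
      then have w: "K \<in> {1..<1 + N}" "K' \<in> {1..<1 + N}" using K(5) K'(5) dd by auto
      have "K = K'"
        using w \<open>K mod N = K' mod N\<close> by (cases "K = N"; cases "K' = N") auto
      then have "\<bar>i - i'\<bar> < int L" using K K' bs_period[of K] bs_le_iff[of "Suc K" "K + N"] switches_pos by auto
      then show ?thesis using dvd_small[OF c(1)] K(3) K'(3) dd \<open>K = K'\<close> by simp
    next
      case False
      then show ?thesis using K(5) K'(5) dd by (metis mult_cancel1 Pair_inject zero_neq_numeral)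
    qed
  qed
  have inj: "inj_on f {1..<switches}"
  proof (rule inj_onI)
    fix m m' assume m: "m \<in> {1..<switches}" "m' \<in> {1..<switches}" "f m = f m'"
    obtain K where K: "bs K < fst (f m)" "fst (f m) < bs (Suc K)" "snd (f m) = bs (K + 2 * m)" using f[OF m(1)] by blast
    obtain K' where K': "bs K' < fst (f m)" "fst (f m) < bs (Suc K')" "snd (f m) = bs (K' + 2 * m')" using f[OF m(2)] m(3) by auto
    have "K = K'" using block_unique[of K "fst (f m)" K'] K K' by simp
    then show "m = m'" using K(3) K'(3) by (simp add: bs_eq_iff)
  qed
  have "self_pairs 1 \<inter> f ` {1..<switches} = {}"
  proof -
    have "f m \<notin> self_pairs 1" if m: "m \<in> {1..<switches}" for m
    proof
      assume "f m \<in> self_pairs 1"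
      then obtain K where K: "bs K < fst (f m)" "fst (f m) < bs (Suc K)" "snd (f m) = bs K"
        by (metis prod.collapse self_pairsE)
      obtain K' where K': "bs K' < fst (f m)" "fst (f m) < bs (Suc K')" "snd (f m) = bs (K' + 2 * m)" using f[OF m] by blast
      have "K = K'" using block_unique[of K "fst (f m)" K'] K K' by simp
      then show False using K(3) K'(3) m by (simp add: bs_eq_iff)
    qed
    then show ?thesis by blast
  qed
  moreover have "card (f ` {1..<switches}) = switches - 1" using card_image[OF inj] by simp
  ultimately have "card W = (L - N) + (switches - 1)"
    unfolding W_def using finite_self_pairs[of 1] card_self_pairs[of 1] by (simp add: card_Un_disjoint)
  then have "int L - int switches - 1 \<le> int (card W)" using switches_pos by linarith
  moreover have "\<forall>(i, j)\<in>W. linked i j" using W by blast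
  moreover have "separated W" unfolding separated_def using sep by blast
  ultimately show ?thesis by (intro exI[of _ W] conjI)
qed

end

section \<open>Letters of both signs: runs of blocks of equal sign\<close>

context switching_word
begin

definition sign_change :: "nat \<Rightarrow> bool" where
  "sign_change k \<longleftrightarrow> k > 0 \<and> pos (bl (k - 1)) \<noteq> pos (bl k)"

definition run_start :: "nat \<Rightarrow> nat" where
  "run_start k = (GREATEST s. s \<le> k \<and> sign_change s)"

lemma sign_change_period: "k > 0 \<Longrightarrow> sign_change (k + N) \<longleftrightarrow> sign_change k"
  using bl_period[of "k - 1"] bl_period[of k] by (simp add: sign_change_def)

lemma sign_const:
  assumes "s \<le> k" "\<And>m. s < m \<Longrightarrow> m \<le> k \<Longrightarrow> \<not> sign_change m"
  shows "pos (bl k) = pos (bl s)"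
  using assms
proof (induction k rule: dec_induct)
  case (step k)
  have "\<not> sign_change (Suc k)" using step by simp
  then show ?case using step by (simp add: sign_change_def)
qed simp

lemma run_start:
  assumes "sign_change k0" "k0 \<le> k"
  shows "sign_change (run_start k)" "k0 \<le> run_start k" "run_start k \<le> k"
    "run_start k < m \<Longrightarrow> m \<le> k \<Longrightarrow> \<not> sign_change m"
proof -
  have "run_start k \<le> k \<and> sign_change (run_start k)"
    unfolding run_start_def by (rule GreatestI_nat[of _ k0 k]) (use assms in auto)
  then show "sign_change (run_start k)" "run_start k \<le> k" by auto
  have g: "s \<le> run_start k" if "s \<le> k" "sign_change s" for s
    unfolding run_start_def by (rule Greatest_le_nat[of _ s k]) (use that in auto)
  then show "k0 \<le> run_start k" using assms by blast
  show "run_start k < m \<Longrightarrow> m \<le> k \<Longrightarrow> \<not> sign_change m" using g[of m] by auto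
qed

lemma run_start_eqI:
  assumes "sign_change s" "s \<le> k" "\<And>m. s < m \<Longrightarrow> m \<le> k \<Longrightarrow> \<not> sign_change m"
  shows "run_start k = s"
proof -
  have "s \<le> run_start k" "sign_change (run_start k)" "run_start k \<le> k"
    using run_start[OF assms(1,2)] by auto
  then show ?thesis using assms(3)[of "run_start k"] by fastforce
qed

text \<open>Let the run begin at s and g be the next sign change. The infinite values of
  \<open>V\<close> at s - 1 and at g enforce a descent at s - 1 and an ascent at g - d, whatever the
  lengths are: since k = s + d < g, the blocks compared with these two belong to the run.\<close>

lemma run_linked:
  assumes k0: "sign_change k0" and k: "k0 \<le> k" "k < k0 + N" and d: "d = k - run_start k" "even d" "d > 0"
  shows "\<exists>K i. run_start K = run_start k \<and> k0 \<le> K \<and> K + d < k0 + N \<and> bs K \<le> i \<and> i < bs (Suc K) \<and> linked i (bs (K + d))"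
proof -
  define s where "s = run_start k"
  note rs = run_start[OF k0 k(1), folded s_def]
  have s0: "s > 0" using rs(1) by (simp add: sign_change_def)
  define g where "g = (LEAST g. g > k \<and> sign_change g)"
  have "k0 > 0" using k0 by (simp add: sign_change_def)
  then have "k0 + N > k \<and> sign_change (k0 + N)" using k0 k sign_change_period by simp
  then have g: "g > k" "sign_change g" "g \<le> k0 + N"
    using LeastI[of "\<lambda>g. g > k \<and> sign_change g" "k0 + N"] Least_le[of "\<lambda>g. g > k \<and> sign_change g" "k0 + N"]
    unfolding g_def by auto
  have nog: "\<not> sign_change m" if "s < m" "m < g" for m
    using rs(4)[OF that(1)] not_less_Least[of m "\<lambda>g. g > k \<and> sign_change g"] that(2) unfolding g_def by force
  define \<sigma> where "\<sigma> = pos (bl s)"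
  have sg: "pos (bl m) = \<sigma>" if "s \<le> m" "m < g" for m
    unfolding \<sigma>_def using that nog by (intro sign_const) auto
  have kd: "k = s + d" using d rs(3) by (simp add: s_def)
  have fin: "V \<sigma> m \<noteq> \<infinity>" if "s \<le> m" "m < g" for m using sg[OF that] by (simp add: V_def)
  have inf: "V \<sigma> (s - 1) = \<infinity>" "V \<sigma> g = \<infinity>"
  proof -
    show "V \<sigma> (s - 1) = \<infinity>" using rs(1) by (auto simp: V_def sign_change_def \<sigma>_def)
    have "s \<le> g - 1" "g - 1 < g" using kd g(1) by linarith+
    from sg[OF this] show "V \<sigma> g = \<infinity>" using g(2) by (auto simp: V_def sign_change_def)
  qed
  have v0: "V \<sigma> (s - 1 + d) < V \<sigma> (s - 1)"
  proof -
    have "s \<le> s - 1 + d" "s - 1 + d < g" using kd g(1) d(3) s0 by linarith+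
    from fin[OF this] show ?thesis unfolding inf by simp
  qed
  have v1: "V \<sigma> (g - d) < V \<sigma> (g - d + d)"
  proof -
    have s: "s \<le> g - d" "g - d < g" "g - d + d = g" using kd g(1) d(3) by linarith+
    from fin[OF s(1,2)] show ?thesis unfolding s(3) inf by simp
  qed
  have "s - 1 < g - d" using kd g by linarith
  obtain K q where K: "s - 1 \<le> K" "K + q \<le> g - d" "q > 0" "V \<sigma> (K + d) < V \<sigma> K" "V \<sigma> (K + q) < V \<sigma> (K + q + d)"
    "\<And>t. 0 < t \<Longrightarrow> t < q \<Longrightarrow> V \<sigma> (K + t) = V \<sigma> (K + t + d)"
    using last_descent_before_ascent[of "V \<sigma>", OF v0 v1 \<open>s - 1 < g - d\<close>] by metis
  have mid: "V \<sigma> (K + t) = V \<sigma> (K + t + d) \<and> V \<sigma> (K + t) \<noteq> \<infinity>" if "0 < t" "t < q" for t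
    using K(6)[OF that] fin[of "K + t"] K(1,2) that by auto
  note dl = descent_ascent_linked[OF d(2) K(3,4,5) mid d(3)]
  have rsK: "run_start m = s" if "s \<le> m" "m < g" for m
    using that nog rs(1) by (intro run_start_eqI) auto
  show ?thesis
  proof (cases "s \<le> K")
    case True
    have "K + d < g" using K(2,3) by linarith
    then have "pos (bl K) = \<sigma>" "run_start K = s" using sg rsK True by auto
    then show ?thesis using dl(1) True rs(2) g(3) \<open>K + d < g\<close> unfolding s_def
      by (meson le_trans less_imp_le less_le_trans)
  next
    case False
    then have Ks: "Suc K = s" using K(1) s0 by linarith
    have "pos (bl K) \<noteq> \<sigma>" using inf(1) Ks by (auto simp: V_def split: if_splits)
    moreover have "pos (bl (Suc K + d)) = \<sigma>" using sg[of k] kd Ks g(1) by simp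
    ultimately have "linked (bs s) (bs (s + d))" using dl(2) Ks by metis
    moreover have "run_start s = s" using rsK kd g(1) by simp
    ultimately show ?thesis using rs(2) k(2) kd bs_less[of s "Suc s"] unfolding s_def[symmetric]
      by (intro exI[of _ s] exI[of _ "bs s"]) auto
  qed
qed

text \<open>Inside a block the sign is constant, and two adjacent letters of different signs form an
  upper or a lower turn.\<close>

lemma card_sign_changes:
  assumes "k0 > 0"
  shows "card {k \<in> {k0..<k0 + N}. sign_change k} = card upper_turns + card lower_turns"
proof -
  have "bs ` {k \<in> {k0..<k0 + N}. sign_change k} = {i \<in> {bs k0..<bs k0 + int L}. pos (e (i - 1)) \<noteq> pos (e i)}"
  proof (intro set_eqI iffI)
    fix i assume "i \<in> bs ` {k \<in> {k0..<k0 + N}. sign_change k}"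
    then obtain k where k: "i = bs k" "k0 \<le> k" "k < k0 + N" "sign_change k" by auto
    have "pos (e (i - 1)) \<noteq> pos (e i)" using k(1,4) bs_prev[of "k - 1"] by (simp add: sign_change_def bl_def)
    then show "i \<in> {i \<in> {bs k0..<bs k0 + int L}. pos (e (i - 1)) \<noteq> pos (e i)}"
      using k bs_le_iff[of k0 k] bs_less_iff[of k "k0 + N"] bs_period[of k0] by simp
  next
    fix i assume i: "i \<in> {i \<in> {bs k0..<bs k0 + int L}. pos (e (i - 1)) \<noteq> pos (e i)}"
    then have "e (i - 1) \<noteq> e i" by auto
    then obtain k where k: "i = bs k" using start_bs[of i] i bs_nonneg[of k0] by auto
    then have "k0 \<le> k" "k < k0 + N" using i bs_le_iff[of k0 k] bs_less_iff[of k "k0 + N"] bs_period[of k0] by auto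
    moreover have "sign_change k" using i k bs_prev[of "k - 1"] \<open>k0 \<le> k\<close> assms by (simp add: sign_change_def bl_def)
    ultimately show "i \<in> bs ` {k \<in> {k0..<k0 + N}. sign_change k}" unfolding k by (intro imageI) simp
  qed
  then have "card {k \<in> {k0..<k0 + N}. sign_change k} = card {i \<in> {bs k0..<bs k0 + int L}. pos (e (i - 1)) \<noteq> pos (e i)}"
    using card_image[of bs "{k \<in> {k0..<k0 + N}. sign_change k}"] by (simp add: inj_on_def bs_eq_iff)
  also have "\<dots> = (\<Sum>(x, y)\<in>{(x, y). pos x \<noteq> pos y}. cnt x y)"
    unfolding card_window[of _ "\<lambda>x y. pos x \<noteq> pos y"] card_pairs[of "\<lambda>x y. pos x \<noteq> pos y"] ..
  also have "{(x, y). pos x \<noteq> pos y} = {A, B} \<times> {Abar, Bbar} \<union> {Abar, Bbar} \<times> {A, B}"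
  proof -
    have "pos x \<longleftrightarrow> x \<in> {A, B}" "\<not> pos x \<longleftrightarrow> x \<in> {Abar, Bbar}" for x by (cases x; simp)+
    then show ?thesis by blast
  qed
  also have "(\<Sum>(x, y)\<in>{A, B} \<times> {Abar, Bbar} \<union> {Abar, Bbar} \<times> {A, B}. cnt x y) =
      (\<Sum>x\<in>{A, B}. \<Sum>y\<in>{Abar, Bbar}. cnt x y) + (\<Sum>x\<in>{Abar, Bbar}. \<Sum>y\<in>{A, B}. cnt x y)"
    unfolding sum.cartesian_product by (rule sum.union_disjoint) auto
  also have "\<dots> = card upper_turns + card lower_turns" by (simp add: turns_cnt cnt_zero)
  finally show ?thesis .
qed

lemma turns_balanced: "card upper_turns = card lower_turns"
  using flows by (simp add: turns_cnt)

text \<open>A block at odd distance from the start of its run has its predecessor in the same run at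
  even distance, so at least half of the N blocks are at even distance.\<close>

lemma card_even_run_positions:
  assumes k0: "sign_change k0"
  shows "switches \<le> card {k \<in> {k0..<k0 + N}. even (k - run_start k)}"
proof -
  let ?E = "{k \<in> {k0..<k0 + N}. even (k - run_start k)}" and ?O = "{k \<in> {k0..<k0 + N}. odd (k - run_start k)}"
  have "(\<lambda>k. k - 1) ` ?O \<subseteq> ?E"
  proof
    fix m assume "m \<in> (\<lambda>k. k - 1) ` ?O"
    then obtain k where k: "m = k - 1" "k0 \<le> k" "k < k0 + N" "odd (k - run_start k)" by auto
    note rs = run_start[OF k0 k(2)]
    have lt: "run_start k < k" using k(4) rs(3) by (cases "run_start k = k") auto
    have "run_start m = run_start k" unfolding k(1) using rs lt by (intro run_start_eqI) auto
    moreover have "k - run_start k = Suc (m - run_start k)" using lt k(1) by simp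
    ultimately show "m \<in> ?E" using k lt rs(2) by auto
  qed
  moreover have "inj_on (\<lambda>k. k - 1) ?O"
    using k0 by (auto simp: inj_on_def sign_change_def)
  moreover have "finite ?E" by simp
  ultimately have "card ?O \<le> card ?E" by (metis (no_types, lifting) card_inj_on_le)
  moreover have "card ?E + card ?O = card (?E \<union> ?O)" by (intro card_Un_disjoint[symmetric]) auto
  moreover have "?E \<union> ?O = {k0..<k0 + N}" by auto
  ultimately show ?thesis by simp
qed

text \<open>Each block k at positive even distance from the start of its run yields a crossing of
  two blocks at that distance, the first of them in the same run. Run and distance give k back, so
  the crossings differ. Pairs of turns are told apart from them by the signs of their
  letters.\<close>

lemma lower_sign_change:
  assumes k0: "sign_change k0"
  shows "\<exists>W. (\<forall>(i, j)\<in>W. linked i j \<or> i \<in> upper_turns \<and> j \<in> lower_turns) \<and>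
    separated W \<and> int L - int switches - 1 \<le> int (card W)"
proof -
  have k0p: "k0 > 0" using k0 by (simp add: sign_change_def)
  \<comment> \<open>The window of N blocks begins at a sign change, so neither of its ends cuts a
    run.\<close>
  define I where "I = {k \<in> {k0..<k0 + N}. even (k - run_start k) \<and> \<not> sign_change k}"
  have Ipos: "k - run_start k > 0 \<and> even (k - run_start k) \<and> k0 \<le> k \<and> k < k0 + N" if "k \<in> I" for k
    using that run_start[OF k0, of k] by (cases "run_start k = k") (auto simp: I_def)
  have "\<forall>k\<in>I. \<exists>p. \<exists>K. run_start K = run_start k \<and> k0 \<le> K \<and> K + (k - run_start k) < k0 + N \<and>
      bs K \<le> fst p \<and> fst p < bs (Suc K) \<and> snd p = bs (K + (k - run_start k)) \<and> linked (fst p) (snd p)"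
  proof
    fix k assume "k \<in> I"
    then have "\<exists>K i. run_start K = run_start k \<and> k0 \<le> K \<and> K + (k - run_start k) < k0 + N \<and> bs K \<le> i \<and> i < bs (Suc K) \<and>
       linked i (bs (K + (k - run_start k)))"
      using Ipos by (intro run_linked[OF k0 _ _ refl]) auto
    then obtain K i where
      "run_start K = run_start k \<and> k0 \<le> K \<and> K + (k - run_start k) < k0 + N \<and> bs K \<le> i \<and> i < bs (Suc K) \<and>
       linked i (bs (K + (k - run_start k)))" by blast
    then show "\<exists>p. \<exists>K. run_start K = run_start k \<and> k0 \<le> K \<and> K + (k - run_start k) < k0 + N \<and>
      bs K \<le> fst p \<and> fst p < bs (Suc K) \<and> snd p = bs (K + (k - run_start k)) \<and> linked (fst p) (snd p)"
      by (intro exI[of _ "(i, bs (K + (k - run_start k)))"] exI[of _ K]) simp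
  qed
  then obtain f where f: "\<And>k. k \<in> I \<Longrightarrow> \<exists>K. run_start K = run_start k \<and> k0 \<le> K \<and> K + (k - run_start k) < k0 + N \<and>
      bs K \<le> fst (f k) \<and> fst (f k) < bs (Suc K) \<and> snd (f k) = bs (K + (k - run_start k)) \<and> linked (fst (f k)) (snd (f k))"
    by metis
  define W1 where "W1 = self_pairs k0 \<union> f ` I"
  have W1: "\<exists>K d. k0 \<le> K \<and> K + d < k0 + N \<and> bs K \<le> i \<and> i < bs (Suc K) \<and> j = bs (K + d) \<and> linked i j \<and>
      (d = 0 \<and> bs K < i \<or> d > 0 \<and> (\<exists>k\<in>I. d = k - run_start k \<and> run_start K = run_start k \<and> (i, j) = f k))"
    if "(i, j) \<in> W1" for i j
  proof -
    have "(i, j) \<in> self_pairs k0 \<or> (\<exists>k\<in>I. (i, j) = f k)" using that by (auto simp: W1_def)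
    then show ?thesis
    proof
      assume s: "(i, j) \<in> self_pairs k0"
      obtain K where "K \<in> {k0..<k0 + N}" "bs K < i" "i < bs (Suc K)" "j = bs K" using self_pairsE[OF s] by metis
      then show ?thesis using self_pairs_linked[OF s k0p] by (intro exI[of _ K] exI[of _ 0]) auto
    next
      assume "\<exists>k\<in>I. (i, j) = f k"
      then obtain k where k: "k \<in> I" "(i, j) = f k" by blast
      have ff: "fst (f k) = i" "snd (f k) = j" using k(2) by (metis fst_conv, metis snd_conv)
      from f[OF k(1)] ff obtain K where "run_start K = run_start k" "k0 \<le> K" "K + (k - run_start k) < k0 + N"
        "bs K \<le> i" "i < bs (Suc K)" "j = bs (K + (k - run_start k))" "linked i j" by auto
      then show ?thesis using k Ipos[OF k(1)] by (intro exI[of _ K] exI[of _ "k - run_start k"]) auto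
    qed
  qed
  have modeq: "K = K'" if "K mod N = K' mod N" "k0 \<le> K" "K < k0 + N" "k0 \<le> K'" "K' < k0 + N" for K K'
  proof -
    have "int K mod int N = int K' mod int N" using that(1) by (metis zmod_int)
    then have "int N dvd (int K - int K')" by (simp only: mod_eq_dvd_iff)
    moreover have "\<bar>int K - int K'\<bar> < int N" using that by auto
    ultimately show ?thesis using zdvd_imp_le[of "int N" "\<bar>int K - int K'\<bar>"] by fastforce
  qed
  have Idiff: "k = k'" if "k \<in> I" "k' \<in> I" "k - run_start k = k' - run_start k'" "run_start k = run_start k'" for k k'
    using that Ipos[OF that(1)] Ipos[OF that(2)] by linarith
  have sep1: "i = i' \<and> j = j'" if W2: "(i, j) \<in> W1" "(i', j') \<in> W1"
    and c: "int L dvd (i - i') \<and> int L dvd (j - j') \<or> int L dvd (i - j') \<and> int L dvd (j - i')" for i j i' j'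
  proof -
    obtain K d where K: "k0 \<le> K" "K + d < k0 + N" "bs K \<le> i" "i < bs (Suc K)" "j = bs (K + d)"
      "d = 0 \<and> bs K < i \<or> d > 0 \<and> (\<exists>k\<in>I. d = k - run_start k \<and> run_start K = run_start k \<and> (i, j) = f k)"
      using W1[OF W2(1)] by blast
    obtain K' d' where K': "k0 \<le> K'" "K' + d' < k0 + N" "bs K' \<le> i'" "i' < bs (Suc K')" "j' = bs (K' + d')"
      "d' = 0 \<and> bs K' < i' \<or> d' > 0 \<and> (\<exists>k\<in>I. d' = k - run_start k \<and> run_start K' = run_start k \<and> (i', j') = f k)"
      using W1[OF W2(2)] by blast
    have j: "bs (K + d) \<le> j" "j < bs (Suc (K + d))" "bs (K' + d') \<le> j'" "j' < bs (Suc (K' + d'))"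
      using K(5) K'(5) bs_less by auto
    from c show ?thesis
    proof
      assume c: "int L dvd (i - i') \<and> int L dvd (j - j')"
      have KK: "K = K'" using modeq[OF block_cong[OF _ K(3,4) K'(3,4)]] c K(1,2) K'(1,2) by simp
      have "K + d = K' + d'" using modeq[OF block_cong[OF _ j]] c K(1,2) K'(1,2) by simp
      then have dd: "d = d'" using KK by simp
      show ?thesis
      proof (cases "d = 0")
        case True
        have "\<bar>i - i'\<bar> < int L" using K(3,4) K'(3,4) KK bs_period[of K] bs_le_iff[of "Suc K" "K + N"] switches_pos by auto
        then show ?thesis using dvd_small[of "i - i'"] c K(5) K'(5) dd KK by simp
      next
        case False
        then have "\<exists>k\<in>I. d = k - run_start k \<and> run_start K = run_start k \<and> (i, j) = f k" using K(6) by simp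
        then obtain k where k: "k \<in> I" "d = k - run_start k" "run_start K = run_start k" "(i, j) = f k" by blast
        have "\<exists>k\<in>I. d' = k - run_start k \<and> run_start K' = run_start k \<and> (i', j') = f k" using K'(6) False dd by simp
        then obtain k' where k': "k' \<in> I" "d' = k' - run_start k'" "run_start K' = run_start k'" "(i', j') = f k'" by blast
        have "k - run_start k = k' - run_start k'" using k(2) k'(2) dd by argo
        moreover have "run_start k = run_start k'" using k(3) k'(3) KK by argo
        ultimately have "k = k'" by (rule Idiff[OF k(1) k'(1)])
        then show ?thesis using k(4) k'(4) by (metis Pair_inject)
      qed
    next
      \<comment> \<open>An exchange would force the distance to vanish, and then a position inside a
        block would be congruent to a block start.\<close>
      assume c: "int L dvd (i - j') \<and> int L dvd (j - i')"
      have "K = K' + d'" using modeq[OF block_cong[OF _ K(3,4) j(3,4)]] c K(1,2) K'(1,2) by simp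
      moreover have "K + d = K'" using modeq[OF block_cong[OF _ j(1,2) K'(3,4)]] c K(1,2) K'(1,2) by simp
      ultimately have "d = 0" by simp
      then have "bs K < i" using K(6) by auto
      then have "e (i - 1) = e i" using interior_letter K(4) by blast
      then have "e (j' - 1) = e j'" using linked_cong_letter[of i j'] c by auto
      then show ?thesis using bs_start[of "K' + d'"] K'(5) by simp
    qed
  qed
  have turn: "i \<in> {0..<int L} \<and> j \<in> {0..<int L} \<and> e i \<noteq> e j \<and> pos (e i) \<and> \<not> pos (e j)"
    if "i \<in> upper_turns" "j \<in> lower_turns" for i j
    using that unfolding upper_turns_def lower_turns_def by auto
  have lk: "e i = e j" if "linked i j" for i j
    using that unfolding linked_def by (metis add.right_neutral of_nat_0)
  have small: "i = i'" if "int L dvd (i - i')" "i \<in> {0..<int L}" "i' \<in> {0..<int L}" for i i'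
    using dvd_small[OF that(1)] that(2,3) by auto
  define W where "W = W1 \<union> upper_turns \<times> lower_turns"
  have W: "(i, j) \<in> W1 \<and> linked i j \<and> e i = e j \<or> i \<in> upper_turns \<and> j \<in> lower_turns" if "(i, j) \<in> W" for i j
  proof -
    have "(i, j) \<in> W1 \<or> i \<in> upper_turns \<and> j \<in> lower_turns" using that by (auto simp: W_def)
    then show ?thesis using W1[of i j] lk[of i j] by blast
  qed
  have sep: "i = i' \<and> j = j'" if W2: "(i, j) \<in> W" "(i', j') \<in> W"
    and c: "int L dvd (i - i') \<and> int L dvd (j - j') \<or> int L dvd (i - j') \<and> int L dvd (j - i')" for i j i' j'
  proof -
    have ec: "e i = e i' \<and> e j = e j' \<or> e i = e j' \<and> e j = e i'" using c linked_cong_letter by blast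
    consider (1) "(i, j) \<in> W1" "(i', j') \<in> W1" | (2) "e i = e j" "i' \<in> upper_turns \<and> j' \<in> lower_turns"
      | (3) "i \<in> upper_turns \<and> j \<in> lower_turns" "e i' = e j'"
      | (4) "i \<in> upper_turns \<and> j \<in> lower_turns" "i' \<in> upper_turns \<and> j' \<in> lower_turns"
      using W[OF W2(1)] W[OF W2(2)] by blast
    then show ?thesis
    proof cases
      case 1 then show ?thesis using sep1 c by blast
    next
      case 2 then show ?thesis using turn[of i' j'] ec by metis
    next
      case 3 then show ?thesis using turn[of i j] ec by metis
    next
      case 4
      have t: "i \<in> {0..<int L}" "j \<in> {0..<int L}" "i' \<in> {0..<int L}" "j' \<in> {0..<int L}"
        "pos (e i)" "\<not> pos (e j')" using turn[of i j] turn[of i' j'] 4 by blast+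
      have "e i \<noteq> e j'" using t(5,6) by auto
      then have "\<not> int L dvd (i - j')" using linked_cong_letter[of i j'] by blast
      then have "int L dvd (i - i')" "int L dvd (j - j')" using c by blast+
      then show ?thesis using small t by blast
    qed
  qed
  have inj: "inj_on f I"
  proof (rule inj_onI)
    fix k k' assume k: "k \<in> I" "k' \<in> I" "f k = f k'"
    obtain K where K: "run_start K = run_start k" "bs K \<le> fst (f k)" "fst (f k) < bs (Suc K)" "snd (f k) = bs (K + (k - run_start k))"
      using f[OF k(1)] by blast
    obtain K' where K': "run_start K' = run_start k'" "bs K' \<le> fst (f k)" "fst (f k) < bs (Suc K')" "snd (f k) = bs (K' + (k' - run_start k'))"
      using f[OF k(2)] k(3) by auto
    have KK: "K = K'" using block_unique K(2,3) K'(2,3) by blast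
    have "K + (k - run_start k) = K' + (k' - run_start k')" using K(4) K'(4) by (simp only: bs_eq_iff)
    then have "k - run_start k = k' - run_start k'" unfolding KK by (rule add_left_imp_eq)
    moreover have "run_start k = run_start k'" using K(1) K'(1) KK by argo
    ultimately show "k = k'" by (rule Idiff[OF k(1,2)])
  qed
  have disj1: "self_pairs k0 \<inter> f ` I = {}"
  proof -
    have "f k \<notin> self_pairs k0" if k: "k \<in> I" for k
    proof
      assume "f k \<in> self_pairs k0"
      then obtain K where K: "bs K < fst (f k)" "fst (f k) < bs (Suc K)" "snd (f k) = bs K"
        by (metis prod.collapse self_pairsE)
      obtain K' where K': "bs K' \<le> fst (f k)" "fst (f k) < bs (Suc K')" "snd (f k) = bs (K' + (k - run_start k))"
        using f[OF k] by blast
      have "K = K'" using block_unique[of K "fst (f k)" K'] K K' by simp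
      moreover have "K = K' + (k - run_start k)" using K(3) K'(3) by (simp only: bs_eq_iff)
      ultimately show False using Ipos[OF k] by simp
    qed
    then show ?thesis by blast
  qed
  have disj2: "W1 \<inter> upper_turns \<times> lower_turns = {}"
  proof -
    have "(i, j) \<notin> upper_turns \<times> lower_turns" if "(i, j) \<in> W1" for i j
      using W1[OF that] lk[of i j] turn[of i j] by blast
    then show ?thesis by auto
  qed
  have finI: "finite I" unfolding I_def by simp
  have finT: "finite (upper_turns \<times> lower_turns)"
  proof (rule finite_subset)
    show "upper_turns \<times> lower_turns \<subseteq> {0..<int L} \<times> {0..<int L}"
      unfolding upper_turns_def lower_turns_def by blast
  qed simp
  have "card W1 = (L - N) + card I"
    unfolding W1_def using finite_self_pairs[of k0] finI disj1
    by (simp add: card_Un_disjoint card_self_pairs card_image[OF inj])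
  moreover have "finite W1" unfolding W1_def using finite_self_pairs[of k0] finI by simp
  ultimately have "card W = (L - N) + card I + card upper_turns * card upper_turns"
    unfolding W_def using finT disj2 by (simp add: card_Un_disjoint card_cartesian_product turns_balanced)
  moreover have "switches \<le> card I + 2 * card upper_turns"
  proof -
    have "{k \<in> {k0..<k0 + N}. even (k - run_start k)} \<subseteq> I \<union> {k \<in> {k0..<k0 + N}. sign_change k}"
      unfolding I_def by blast
    then have "card {k \<in> {k0..<k0 + N}. even (k - run_start k)} \<le> card (I \<union> {k \<in> {k0..<k0 + N}. sign_change k})"
      using finI by (intro card_mono) auto
    also have "\<dots> \<le> card I + card {k \<in> {k0..<k0 + N}. sign_change k}" by (rule card_Un_le)
    finally show ?thesis using card_even_run_positions[OF k0] card_sign_changes[OF k0p] turns_balanced by simp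
  qed
  moreover have "2 * p \<le> p * p + 1" for p :: nat
  proof -
    have "0 \<le> (int p - 1) * (int p - 1)" by simp
    then have "2 * int p \<le> int p * int p + 1" by (simp add: algebra_simps)
    then have "int (2 * p) \<le> int (p * p + 1)" by simp
    then show ?thesis by (simp only: of_nat_le_iff)
  qed
  moreover have "L \<ge> N" using L_cnt by simp
  ultimately have "L \<le> card W + switches + 1"
  proof -
    assume "card W = (L - N) + card I + card upper_turns * card upper_turns" "switches \<le> card I + 2 * card upper_turns"
      "\<And>p::nat. 2 * p \<le> p * p + 1" "L \<ge> N"
    moreover from this(3)[of "card upper_turns"] have "2 * card upper_turns \<le> card upper_turns * card upper_turns + 1" .
    ultimately show ?thesis by linarith
  qed
  then have "int L - int switches - 1 \<le> int (card W)" by linarith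
  moreover have "\<forall>(i, j)\<in>W. linked i j \<or> i \<in> upper_turns \<and> j \<in> lower_turns" using W by blast
  moreover have "separated W" unfolding separated_def using sep by blast
  ultimately show ?thesis by (intro exI[of _ W] conjI)
qed

end

section \<open>Powers of a primitive geodesic\<close>

context pants_cyclic_word
begin

lemma linked_anchor_intersect:
  assumes "linked i j" shows "anchor i j \<and> line i \<inter> line j \<noteq> {}"
proof -
  obtain T where T: "e (i - 1) \<noteq> e (j - 1)" "T > 0" "\<forall>t<T. e (i + int t) = e (j + int t)"
     "e (i + int T) \<noteq> e (j + int T)"
     "ccw (e i) (bar (e (i - 1))) (bar (e (j - 1))) \<longleftrightarrow>
      ccw (bar (e (i + int T - 1))) (e (i + int T)) (e (j + int T))"
    using assms unfolding linked_def by blast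
  have "e i = e j" using T(3)[rule_format, of 0] T(2) by simp
  then have "anchor i j" using T(1) by (simp add: anchor_def)
  moreover have "line i \<inter> line j \<noteq> {}" using linked_intersect[OF T(1,2) _ T(4,5)] T(3) by blast
  ultimately show ?thesis by blast
qed

lemma turns_anchor_intersect:
  assumes "i \<in> upper_turns" "j \<in> lower_turns" shows "anchor i j \<and> line i \<inter> line j \<noteq> {}"
proof -
  have t: "(e (i - 1), e i) \<in> {(Abar, B), (Bbar, A)}" "(e (j - 1), e j) \<in> {(A, Bbar), (B, Abar)}"
    using assms by (auto simp: upper_turns_def lower_turns_def)
  then have d: "e i \<noteq> e j" "e (i - 1) \<noteq> e (j - 1)" "e i \<noteq> bar (e (j - 1))" "e j \<noteq> bar (e (i - 1))" by auto
  then show ?thesis using crossing_turns[OF d] t by (simp add: anchor_def)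
qed

lemma primitive_lower_bound:
  assumes "switches > 0"
  shows "int L - int switches - 1 \<le> int (primitive_self_int a b w)"
proof -
  interpret switching_word "cyc_nth w" "length w" by unfold_locales (rule assms)
  have "\<exists>W. (\<forall>(i, j)\<in>W. linked i j \<or> i \<in> upper_turns \<and> j \<in> lower_turns) \<and> separated W \<and>
    int L - int switches - 1 \<le> int (card W)"
  proof (cases "\<exists>k. sign_change k")
    case True
    then obtain k where "sign_change k" by blast
    from lower_sign_change[OF this] show ?thesis .
  next
    case False
    then have "pos (bl k) = pos (bl 0)" for k by (intro sign_const) auto
    from lower_constant_sign[OF this] obtain W where "\<forall>(i, j)\<in>W. linked i j" "separated W"
      "int L - int switches - 1 \<le> int (card W)" by (elim exE conjE)
    then show ?thesis by (intro exI[of _ W]) auto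
  qed
  then obtain W where W: "\<forall>(i, j)\<in>W. linked i j \<or> i \<in> upper_turns \<and> j \<in> lower_turns"
    "separated W" "int L - int switches - 1 \<le> int (card W)" by (elim exE conjE)
  have "card W \<le> primitive_self_int a b w"
  proof (rule card_le_primitive_self_int)
    fix i j assume "(i, j) \<in> W"
    then show "anchor i j \<and> line i \<inter> line j \<noteq> {}"
      using W(1) linked_anchor_intersect turns_anchor_intersect by blast
  qed (use W(2) in \<open>unfold separated_def, blast\<close>)
  then show ?thesis using W(3) by linarith
qed

end

section \<open>Powers and primitive roots of words\<close>

lemma word_power_simps: "word_power v 0 = []" "word_power v (Suc m) = v @ word_power v m"
  by (simp_all add: word_power_def)

lemma length_word_power: "length (word_power v m) = m * length v"
  by (induction m) (simp_all add: word_power_simps)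

lemma word_power_add: "word_power v (k + m) = word_power v k @ word_power v m"
  by (induction k) (simp_all add: word_power_simps)

lemma word_power_mult: "word_power (word_power v k) m = word_power v (k * m)"
  by (induction m) (simp_all add: word_power_simps word_power_add)

lemma nth_word_power: "i < m * length v \<Longrightarrow> word_power v m ! i = v ! (i mod length v)"
proof (induction m arbitrary: i)
  case (Suc m)
  then show ?case by (cases "i < length v") (auto simp: word_power_simps nth_append le_mod_geq)
qed simp

lemma cyc_nth_word_power:
  assumes "m > 0" "v \<noteq> []" shows "cyc_nth (word_power v m) = cyc_nth v"
proof
  fix k
  let ?L = "int (length v)"
  have L: "0 < ?L" "0 < int m * ?L" using assms by auto
  define r where "r = nat (k mod (int m * ?L))"
  have r: "int r = k mod (int m * ?L)" using L by (simp add: r_def)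
  have "int r < int m * ?L" using r L by simp
  then have "r < m * length v" by (metis of_nat_less_iff of_nat_mult)
  moreover have "int (r mod length v) = k mod ?L" unfolding zmod_int r by (simp add: mod_mod_cancel)
  then have "r mod length v = nat (k mod ?L)" by linarith
  ultimately show "cyc_nth (word_power v m) k = cyc_nth v k"
    unfolding cyc_nth_def length_word_power using nth_word_power[of r m v] by (simp add: r_def)
qed

lemma cyc_nth_periods_gcd:
  fixes e :: "int \<Rightarrow> 'a"
  assumes "\<And>k. e (k + p) = e k" "\<And>k. e (k + q) = e k"
  shows "e (k + gcd p q) = e k"
proof -
  have mult: "e (k + p * c) = e k" if per: "\<And>k. e (k + p) = e k" for p k c
  proof -
    have n: "e (k + p * int m) = e k" for k m
    proof (induction m)
      case (Suc m)
      then show ?case using per[of "k + p * int m"] by (simp add: algebra_simps)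
    qed simp
    show ?thesis using n[of k "nat c"] n[of "k + p * c" "nat (- c)"] by (cases "c \<ge> 0") auto
  qed
  obtain x y where "x * p + y * q = gcd p q" using bezout_int by blast
  then have "k + gcd p q = k + p * x + q * y" by (simp add: algebra_simps)
  then show ?thesis using mult[OF assms(2), of "k + p * x" y] mult[OF assms(1), of k x] by (simp add: add.assoc)
qed

lemma cyc_nth_length: "cyc_nth w (k + int (length w)) = cyc_nth w k"
  by (simp add: cyc_nth_def)

lemma cyc_nth_nat: "i < length w \<Longrightarrow> cyc_nth w (int i) = w ! i"
  by (simp add: cyc_nth_def)

text \<open>By Bezout the greatest common divisor of \<open>d\<close> and the length is again a
  period. It divides the length, so the word is a power of a prefix of that length, and primitivity
  makes the prefix the whole word.\<close>

lemma primitive_word_period: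
  assumes "primitive_word v" "\<And>k. cyc_nth v (k + d) = cyc_nth v k"
  shows "int (length v) dvd d"
proof -
  let ?L = "length v"
  have v: "v \<noteq> []" using assms(1) by (simp add: primitive_word_def)
  define g where "g = nat (gcd (int ?L) d)"
  have g: "int g = gcd (int ?L) d" by (simp add: g_def)
  have gL: "g dvd ?L" using g by (metis gcd_dvd1 int_dvd_int_iff)
  have g0: "g > 0" using v g by (metis gcd_pos_int length_greater_0_conv of_nat_0_less_iff less_irrefl)
  have per: "cyc_nth v (k + int g) = cyc_nth v k" for k
    unfolding g by (rule cyc_nth_periods_gcd[OF cyc_nth_length assms(2)])
  have perm: "cyc_nth v (k + int (g * m)) = cyc_nth v k" for k m
  proof (induction m)
    case (Suc m)
    then show ?case using per[of "k + int (g * m)"] by (simp add: algebra_simps)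
  qed simp
  have gle: "g \<le> ?L" using gL v by (simp add: dvd_imp_le)
  have "v = word_power (take g v) (?L div g)"
  proof (rule nth_equalityI)
    show "length v = length (word_power (take g v) (?L div g))" using gle gL by (simp add: length_word_power)
    fix i assume i: "i < ?L"
    have "cyc_nth v (int i) = cyc_nth v (int (i mod g) + int (g * (i div g)))"
      by (metis mult.commute mod_div_mult_eq of_nat_add)
    then have "v ! i = v ! (i mod g)"
      using perm[of "int (i mod g)" "i div g"] i gle g0 cyc_nth_nat[of i v] cyc_nth_nat[of "i mod g" v]
      by (metis mod_less_divisor order_less_le_trans)
    also have "\<dots> = take g v ! (i mod g)" using g0 by simp
    finally show "v ! i = word_power (take g v) (?L div g) ! i"
      using nth_word_power[of i "?L div g" "take g v"] gle gL i by simp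
  qed
  then have "?L div g = 1" using assms(1) unfolding primitive_word_def by blast
  then have "g = ?L" using gL by (metis dvd_mult_div_cancel mult.right_neutral)
  then show ?thesis using g by (metis gcd_dvd2)
qed

text \<open>A root of minimal length is not a proper power, because powers of powers are
  powers.\<close>

lemma primitive_root_exists:
  assumes "w \<noteq> []" shows "\<exists>v m. primitive_word v \<and> w = word_power v m"
proof -
  define P where "P l \<longleftrightarrow> (\<exists>v m. length v = l \<and> w = word_power v m)" for l
  have "P (length w)" unfolding P_def by (intro exI[of _ w] exI[of _ 1]) (simp add: word_power_def)
  then have "P (LEAST l. P l)" by (rule LeastI)
  then obtain v m where v: "length v = (LEAST l. P l)" "w = word_power v m" unfolding P_def by blast
  have v0: "v \<noteq> []" using v(2) assms length_word_power[of v m] by auto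
  have "k = 1" if "v = word_power u k" for u k
  proof -
    have "P (length u)" unfolding P_def using v(2) that word_power_mult by blast
    then have "length v \<le> length u" unfolding v(1) by (rule Least_le)
    moreover have "length v = k * length u" using that length_word_power by blast
    moreover have "length v > 0" using v0 by simp
    ultimately show ?thesis by (cases k) (auto simp: mult_le_cancel2)
  qed
  then show ?thesis using v v0 unfolding primitive_word_def by blast
qed

text \<open>Both roots generate the same cyclic sequence, so the length of each is a period of the
  other.\<close>

lemma primitive_root_unique:
  assumes "primitive_word v" "primitive_word v'" "w = word_power v m" "w = word_power v' m'" "w \<noteq> []"
  shows "v = v'"
proof -
  have ne: "v \<noteq> []" "v' \<noteq> []" "m > 0" "m' > 0"
    using assms by (auto simp: primitive_word_def word_power_simps intro: gr0I)
  have eq: "cyc_nth v = cyc_nth v'" using cyc_nth_word_power ne assms(3,4) by metis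
  have "int (length v) dvd int (length v')" "int (length v') dvd int (length v)"
    using primitive_word_period[OF assms(1), of "int (length v')"] primitive_word_period[OF assms(2), of "int (length v)"]
      cyc_nth_length[of v] cyc_nth_length[of v'] eq by auto
  then have "length v = length v'" by (simp add: dvd_antisym)
  then show ?thesis using eq cyc_nth_nat by (metis nth_equalityI)
qed

lemma root_word:
  assumes "w \<noteq> []"
  obtains m where "primitive_word (root_word w)" "w = word_power (root_word w) m" "m > 0"
proof -
  have "\<exists>!v. primitive_word v \<and> (\<exists>m. w = word_power v m)"
    using primitive_root_exists[OF assms] primitive_root_unique[OF _ _ _ _ assms] by blast
  then have "primitive_word (root_word w) \<and> (\<exists>m. w = word_power (root_word w) m)"
    unfolding root_word_def by (rule theI')
  then obtain m where m: "primitive_word (root_word w)" "w = word_power (root_word w) m" by blast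
  moreover have "m > 0" using m(2) assms by (auto simp: word_power_simps intro: gr0I)
  ultimately show thesis using that by blast
qed

section \<open>Block pairs counted along the word\<close>

fun descents :: "letter list \<Rightarrow> nat" where
  "descents (x # y # zs) = (if horizontal x \<and> \<not> horizontal y then 1 else 0) + descents (y # zs)"
| "descents _ = 0"

lemma descents_card: "descents xs = card {i. Suc i < length xs \<and> horizontal (xs ! i) \<and> \<not> horizontal (xs ! Suc i)}"
proof (induction xs rule: descents.induct)
  case (1 x y zs)
  let ?S = "\<lambda>xs. {i. Suc i < length xs \<and> horizontal (xs ! i) \<and> \<not> horizontal (xs ! Suc i)}"
  have fin: "finite (?S xs)" for xs by (rule finite_subset[of _ "{..<length xs}"]) auto
  have "?S (x # y # zs) = (if horizontal x \<and> \<not> horizontal y then {0} else {}) \<union> Suc ` ?S (y # zs)"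
  proof (intro set_eqI)
    fix i show "i \<in> ?S (x # y # zs) \<longleftrightarrow> i \<in> (if horizontal x \<and> \<not> horizontal y then {0} else {}) \<union> Suc ` ?S (y # zs)"
      by (cases i) (auto simp: image_iff)
  qed
  moreover have "card (\<dots>) = (if horizontal x \<and> \<not> horizontal y then 1 else 0) + card (?S (y # zs))"
    using fin[of "y # zs"] by (subst card_Un_disjoint) (auto simp: card_image)
  ultimately show ?case using 1 by simp
qed auto

lemma descents_replicate:
  assumes "i > 0" "j > 0" "horizontal s" "\<not> horizontal r"
  shows "descents (replicate i s @ replicate j r @ zs) = Suc (descents zs)"
proof -
  have v: "descents (r # ys) = descents ys" for ys using assms(4) by (cases ys) auto
  have "descents (replicate j r @ zs) = descents zs" for j by (induction j) (simp_all add: v)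
  moreover have "descents (replicate (Suc k) s @ r # ys) = Suc (descents (r # ys))" for k ys
    using assms(3,4) by (induction k) auto
  ultimately show ?thesis using assms(1,2) v by (cases i; cases j) (auto simp del: replicate.simps(2) simp add: replicate_Suc[of _ r])
qed

lemma descents_blocks:
  assumes "\<And>k. k \<in> set ks \<Longrightarrow> i k > 0 \<and> j k > 0 \<and> horizontal (s k) \<and> \<not> horizontal (r k)"
  shows "descents (concat (map (\<lambda>k. replicate (i k) (s k) @ replicate (j k) (r k)) ks)) = length ks"
  using assms by (induction ks) (simp_all add: descents_replicate)

lemma cyc_nth_rotate: "w \<noteq> [] \<Longrightarrow> cyc_nth (rotate p w) k = cyc_nth w (k + int p)"
proof -
  assume w: "w \<noteq> []"
  let ?L = "int (length w)"
  have L: "0 < ?L" using w by simp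
  define r where "r = nat (k mod ?L)"
  have r: "int r = k mod ?L" using L by (simp add: r_def)
  then have rl: "r < length w" using L by (metis of_nat_less_iff pos_mod_bound)
  have "int ((p + r) mod length w) = (k + int p) mod ?L"
    unfolding zmod_int of_nat_add r by (simp add: mod_add_right_eq add.commute)
  then have "(p + r) mod length w = nat ((k + int p) mod ?L)" by linarith
  then show ?thesis using nth_rotate[OF rl, of p] by (simp add: cyc_nth_def r_def)
qed

lemma (in prim_word) card_switches_windows:
  "card {i \<in> {p..<p + int L * int m}. horizontal (e (i - 1)) \<and> \<not> horizontal (e i)} = m * switches"
proof (induction m)
  case (Suc m)
  have hz: "horizontal x \<longleftrightarrow> x \<in> {A, Abar}" "\<not> horizontal x \<longleftrightarrow> x \<in> {B, Bbar}" for x by (cases x; simp)+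
  let ?P = "\<lambda>i. horizontal (e (i - 1)) \<and> \<not> horizontal (e i)"
  have eq: "{i \<in> {p..<p + int L * int (Suc m)}. ?P i} =
     {i \<in> {p..<p + int L * int m}. ?P i} \<union> {i \<in> {p + int L * int m..<p + int L * int m + int L}. ?P i}"
  proof -
    have "{p..<p + int L * int (Suc m)} = {p..<p + int L * int m} \<union> {p + int L * int m..<p + int L * int m + int L}"
    proof -
      define M where "M = int L * int m"
      have "M \<ge> 0" "int L * int (Suc m) = M + int L" by (simp_all add: M_def algebra_simps)
      then show ?thesis unfolding M_def[symmetric] by auto
    qed
    then show ?thesis by blast
  qed
  have "card {i \<in> {p + int L * int m..<p + int L * int m + int L}. ?P i} = switches"
    unfolding card_window[of "p + int L * int m" "\<lambda>x y. horizontal x \<and> \<not> horizontal y"] switches_def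
      hz[symmetric] ..
  moreover have fin: "finite {i \<in> {x..<y}. ?P i}" for x y :: int by (rule finite_subset[of _ "{x..<y}"]) auto
  have "card {i \<in> {p..<p + int L * int (Suc m)}. ?P i} =
     card {i \<in> {p..<p + int L * int m}. ?P i} + card {i \<in> {p + int L * int m..<p + int L * int m + int L}. ?P i}"
    unfolding eq by (rule card_Un_disjoint[OF fin fin]) auto
  ultimately show ?case using Suc by simp
qed simp

text \<open>The linear count misses only the junction of the last and the first letter, which
  contributes nothing because the word begins with a horizontal letter.\<close>

lemma descents_cyclic:
  assumes "w \<noteq> []" "horizontal (hd w)"
  shows "card {i \<in> {0..<int (length w)}. horizontal (cyc_nth w (i - 1)) \<and> \<not> horizontal (cyc_nth w i)} = descents w"
proof -
  have "bij_betw (\<lambda>i. int (Suc i)) {i. Suc i < length w \<and> horizontal (w ! i) \<and> \<not> horizontal (w ! Suc i)}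
     {i \<in> {0..<int (length w)}. horizontal (cyc_nth w (i - 1)) \<and> \<not> horizontal (cyc_nth w i)}"
  proof (rule bij_betwI')
    fix y assume y: "y \<in> {i \<in> {0..<int (length w)}. horizontal (cyc_nth w (i - 1)) \<and> \<not> horizontal (cyc_nth w i)}"
    have "y \<noteq> 0"
    proof
      assume "y = 0"
      then have "cyc_nth w y = hd w" using cyc_nth_nat[of 0 w] assms(1) by (simp add: hd_conv_nth)
      then show False using y assms(2) by simp
    qed
    then obtain i where i: "y = int (Suc i)" "Suc i < length w"
      using y by (intro that[of "nat (y - 1)"]) auto
    then have "cyc_nth w y = w ! Suc i" "cyc_nth w (y - 1) = w ! i"
      using cyc_nth_nat[of "Suc i" w] cyc_nth_nat[of i w] by simp_all
    then show "\<exists>x\<in>{i. Suc i < length w \<and> horizontal (w ! i) \<and> \<not> horizontal (w ! Suc i)}. y = int (Suc x)"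
      using y i by auto
  next
    fix i assume "i \<in> {i. Suc i < length w \<and> horizontal (w ! i) \<and> \<not> horizontal (w ! Suc i)}"
    then show "int (Suc i) \<in> {i \<in> {0..<int (length w)}. horizontal (cyc_nth w (i - 1)) \<and> \<not> horizontal (cyc_nth w i)}"
      using cyc_nth_nat[of "Suc i" w] cyc_nth_nat[of i w] by auto
  qed simp
  from bij_betw_same_card[OF this] show ?thesis unfolding descents_card by (rule sym)
qed

text \<open>In the lower bound, multiplying by m turns the final 1 into m; the inequality (m - 1) (m
  x - 1) >= 0 makes up for this, and it uses x >= 1, that is, a root with a crossing. The upper
  bound is homogeneous of degree two.\<close>

lemma power_bounds:
  fixes m L s x :: int
  assumes "m \<ge> 1" "x \<ge> 1" "L - s - 1 \<le> x" "x \<le> s * L - s\<^sup>2"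
  shows "m * L - m * s - 1 \<le> m\<^sup>2 * x" "m\<^sup>2 * x \<le> (m * s) * (m * L) - (m * s)\<^sup>2"
proof -
  have "m * (L - s - 1) \<le> m * x" using assms by (intro mult_left_mono) auto
  moreover have "m * 1 \<le> m * x" using assms by (intro mult_left_mono) auto
  then have "0 \<le> (m - 1) * (m * x - 1)" using assms by (intro mult_nonneg_nonneg) auto
  ultimately show "m * L - m * s - 1 \<le> m\<^sup>2 * x" by (simp add: algebra_simps power2_eq_square)
  have "m\<^sup>2 * x \<le> m\<^sup>2 * (s * L - s\<^sup>2)" using assms by (intro mult_left_mono) auto
  then show "m\<^sup>2 * x \<le> (m * s) * (m * L) - (m * s)\<^sup>2" by (simp add: algebra_simps power2_eq_square)
qed

theorem theorem1p1:
  fixes a b :: "complex \<Rightarrow> complex" and lo hi :: "letter \<Rightarrow> real"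
    and \<gamma> :: "letter list"
    and n p :: nat and s r :: "nat \<Rightarrow> letter" and i j :: "nat \<Rightarrow> nat" and L :: nat
  assumes "pants a b lo hi"
    and "closed_geodesic_word \<gamma>"
    and "non_simple a b \<gamma>"
    and "n > 0"
    and "\<And>k. k \<in> {1..n} \<Longrightarrow> i k > 0 \<and> j k > 0 \<and> s k \<in> {A, Abar} \<and> r k \<in> {B, Bbar}"
    and "rotate p \<gamma> =
           concat (map (\<lambda>k. replicate (i k) (s k) @ replicate (j k) (r k)) [1..<n + 1])"
    and "L = (\<Sum>k = 1..n. i k + j k)"
  shows "int L - int n - 1 \<le> int (self_int a b \<gamma>) \<and>
         int (self_int a b \<gamma>) \<le> int n * int L - (int n)\<^sup>2"
proof -
  have \<gamma>: "\<gamma> \<noteq> []" "cyclically_reduced \<gamma>" using assms(2) by (auto simp: closed_geodesic_word_def)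
  define v where "v = root_word \<gamma>"
  obtain m where m: "primitive_word v" "\<gamma> = word_power v m" "m > 0"
    using root_word[OF \<gamma>(1)] unfolding v_def by metis
  have v: "v \<noteq> []" using m(1) by (simp add: primitive_word_def)
  have cyc: "cyc_nth \<gamma> = cyc_nth v" using cyc_nth_word_power[OF m(3) v] m(2) by simp
  interpret pants a b lo hi by (rule assms(1))
  interpret pants_cyclic_word a b lo hi v
  proof unfold_locales
    show "length v > 0" using v by simp
    show "cyc_nth v (k + int (length v)) = cyc_nth v k" for k by (rule cyc_nth_length)
    show "cyc_nth v (k + 1) \<noteq> bar (cyc_nth v k)" for k using \<gamma>(2) cyc by (simp add: cyclically_reduced_def)
    show "int (length v) dvd d" if "\<And>k. cyc_nth v (k + d) = cyc_nth v k" for d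
      using primitive_word_period[OF m(1) that] .
  qed
  let ?w = "rotate p \<gamma>"
  have hz: "horizontal x \<longleftrightarrow> x \<in> {A, Abar}" "\<not> horizontal x \<longleftrightarrow> x \<in> {B, Bbar}" for x by (cases x; simp)+
  have blocks: "i k > 0 \<and> j k > 0 \<and> horizontal (s k) \<and> \<not> horizontal (r k)" if "k \<in> set [1..<n + 1]" for k
    using assms(5)[of k] that unfolding hz by auto
  \<comment> \<open>The block form makes n the number of passages from horizontal to vertical
    letters around the cycle; the root has one m-th of them.\<close>
  have "descents ?w = n" unfolding assms(6) using descents_blocks[of "[1..<n + 1]" i j s r] blocks by simp
  moreover have "horizontal (hd ?w)"
  proof -
    have "1 \<in> set [1..<n + 1]" using assms(4) by auto
    note b1 = blocks[OF this]
    have "[1..<n + 1] = 1 # [2..<n + 1]" using assms(4) by (simp add: upt_conv_Cons numeral_2_eq_2)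
    then have "hd ?w = s 1" unfolding assms(6) using b1 by (cases "i 1") auto
    then show ?thesis using b1 by simp
  qed
  ultimately have n: "n = card {k \<in> {0..<int (length \<gamma>)}. horizontal (cyc_nth ?w (k - 1)) \<and> \<not> horizontal (cyc_nth ?w k)}"
    using descents_cyclic[of ?w] \<gamma>(1) by simp
  have len: "length \<gamma> = m * length v" using m(2) length_word_power by metis
  have "n = card {k \<in> {int p..<int p + int (length v) * int m}. horizontal (cyc_nth v (k - 1)) \<and> \<not> horizontal (cyc_nth v k)}"
  proof -
    have "bij_betw (\<lambda>k. k + int p) {k \<in> {0..<int (length \<gamma>)}. horizontal (cyc_nth ?w (k - 1)) \<and> \<not> horizontal (cyc_nth ?w k)}
       {k \<in> {int p..<int p + int (length v) * int m}. horizontal (cyc_nth v (k - 1)) \<and> \<not> horizontal (cyc_nth v k)}"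
      by (rule bij_betw_byWitness[where f' = "\<lambda>k. k - int p"])
        (auto simp: cyc_nth_rotate[OF \<gamma>(1)] cyc len algebra_simps)
    then show ?thesis unfolding n by (rule bij_betw_same_card)
  qed
  then have nm: "n = m * switches" using card_switches_windows by simp
  have "length ?w = (\<Sum>k\<leftarrow>[1..<n + 1]. i k + j k)" unfolding assms(6) by (simp add: length_concat comp_def)
  also have "\<dots> = (\<Sum>k = 1..n. i k + j k)"
    by (simp add: interv_sum_list_conv_sum_set_nat atLeastLessThanSuc_atLeastAtMost del: upt_Suc)
  finally have Lm: "L = m * length v" using assms(7) len by simp
  have self: "self_int a b \<gamma> = m\<^sup>2 * primitive_self_int a b v"
    unfolding self_int_def v_def[symmetric] len using v by simp
  \<comment> \<open>Non-simplicity passes from the power to its root; this is the case x >= 1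
    required by \<open>power_bounds\<close>.\<close>
  have "primitive_self_int a b v > 0" using assms(3) self unfolding non_simple_def by simp
  moreover have "switches > 0" using nm assms(4) by (cases switches) auto
  ultimately show ?thesis
    using power_bounds[of "int m" "int (primitive_self_int a b v)" "int (length v)" "int switches"]
      primitive_lower_bound primitive_upper_bound m(3) self nm Lm by simp
qed

end
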